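(* Suppose that the following hold. (A1) Each $f_i:\mathbb{R}^N\to\mathbb{R}$, $i\in\mathcal V$, is continuously differentiable, and there is a constant $l_i>0$ with $\|\nabla_i f_i(\mathbf y)-\nabla_i f_i(\mathbf z)\|\le l_i\|\mathbf y-\mathbf z\|$ for all $\mathbf y,\mathbf z\in\mathbb{R}^N$. (A2) There is a constant $\omega>0$ such that $(\mathbf y-\mathbf z)^T\big([\nabla_i f_i(\mathbf y)]_{vec}-[\nabla_i f_i(\mathbf z)]_{vec}\big)\ge \omega\|\mathbf y-\mathbf z\|^2$ for all $\mathbf y,\mathbf z\in\mathbb{R}^N$. (A3) The directed graph $\mathcal G$ is strongly connected. Let $\theta_i\in(0,\tfrac12)$ and $\Delta_i>0$ for every $i\in\mathcal V$. Consider the closed-loop system consisting of $\dot x_i=A_ix_i+B_iu_i$, $y_i=C_ix_i$, $i\in\mathcal V$, with the control input $$u_i=-\sum_{k=1}^{m_i-1}\theta_i^k\,\phi_i\big(\bar x_{i(m_i-k+1)}\big)-\theta_i^{m_i}\,\phi_i\Big(\bar x_{i1}+\Big(\prod_{k=1}^{m_i-1}\theta_i^k\Big)\int_0^t\nabla_i f_i(\mathbf z_i(\tau))\,d\tau\Big),$$ where, for $i,j\in\mathcal V$, $$\dot z_{ij}=-(c_{ij}+\rho_{ij})\xi_{ij},\qquad \dot c_{ij}=\rho_{ij},\qquad \rho_{ij}=\xi_{ij}^2,\qquad c_{ij}(0)>0 .$$ Then, for all initial conditions $x_i(0)\in\mathbb{R}^{m_i}$, $z_{ij}(0)\in\mathbb{R}$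 and $c_{ij}(0)>0$, $$\lim_{t\to\infty}\|\mathbf y(t)-\mathbf y^*\|=0,$$ where $\mathbf y^*$ is the Nash equilibrium. In addition, all the other variables, i.e., $x_i(t)$, $z_{ij}(t)$ and $c_{ij}(t)$ for all $i,j\in\mathcal V$, stay bounded and converge to finite values.
   Context: Players and dynamics. $N>1$ is an integer and $\mathcal V=\{1,\dots,N\}$ is the player set. Player $i$ has a state $x_i\in\mathbb{R}^{m_i}$, with $m_i>1$ an integer (the $m_i$ may differ between players), a control input $u_i\in\mathbb{R}$ and an action (output) $y_i\in\mathbb{R}$, with $\dot x_i=A_ix_i+B_iu_i$, $y_i=C_ix_i$. Here $A_i=\begin{bmatrix}\mathbf 0_{m_i-1}&I_{m_i-1}\\0&\mathbf 0_{m_i-1}^T\end{bmatrix}\in\mathbb{R}^{m_i\times m_i}$ (ones on the first superdiagonal, zeros elsewhere; $\mathbf 0_{m_i-1}$ is a zero column vector), $B_i=[0,\dots,0,1]^T$ and $C_i=[1,0,\dots,0]$. Write $\mathbf y=[y_1,\dots,y_N]^T$. Game. Player $i$ has an objective function $f_i(\mathbf y)=f_i(y_i,\mathbf y_{-i})$, where $\mathbf y_{-i}$ collects the actions of the other players. A Nash equilibrium is a $\mathbf y^*=(y_i^*,\mathbf y_{-i}^* )$ with $f_i(y_i^*,\mathbf y_{-i}^* )\le f_i(y_i,\mathbf y_{-i}^* )$ for all $y_i\in\mathbb{R}$, $i\in\mathcal V$; under (A1)-(A2) it is unique. $\nabla_i f_i(\mathbf z)$ denotes the partial derivative of $f_i$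 with respect to its $i$-th argument $y_i$, evaluated at $\mathbf z\in\mathbb{R}^N$. $[\chi_i]_{vec}$ is the column vector with $i$-th entry $\chi_i$. Graph. $\mathcal G=(\mathcal V,\mathcal E)$ is a directed graph with $\mathcal E\subseteq\mathcal V\times\mathcal V$. The weights satisfy $a_{ji}>0$ if $(i,j)\in\mathcal E$ (edge from $i$ to $j$), $a_{ji}=0$ otherwise, and $a_{ii}=0$. Strongly connected means there is a directed path between every ordered pair of distinct nodes. Transformation. With $\theta_i\in(0,1)$, set $x_i=T_i\bar x_i$, where $T_i=\mathbf R(A_i,B_i)\mathbf R(\bar A_i,\bar B_i)^{-1}$ is nonsingular and $\mathbf R(A,B)=[B,AB,\dots,A^{m_i-1}B]$ is the controllability matrix. Here $\bar B_i=[1,\dots,1]^T\in\mathbb{R}^{m_i}$ and $\bar A_i\in\mathbb{R}^{m_i\times m_i}$ is the strictly upper triangular matrix whose $(p,q)$ entry is $\theta_i^{m_i-q+1}$ for $q>p$ and $0$ otherwise. Thus $\dot{\bar x}_i=\bar A_i\bar x_i+\bar B_iu_i$ and $\bar x_i=[\bar x_{i1},\dots,\bar x_{im_i}]^T$. Controller variables. $\phi_i(\varsigma)=\mathrm{sign}(\varsigma)\min\{|\varsigma|,\Delta_i\}$ is a saturation function. $\mathbf z_i=[z_{i1},\dots,z_{iN}]^T$, and $\xi_{ij}=\sum_{k=1}^Na_{ik}(z_{ij}-z_{kj})+a_{ij}\big(z_{ij}+\int_0^t\nabla_jf_j(\mathbf z_j(\tau))\,d\tau\big)$. *)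

theory Defs
  imports
    "HOL-Analysis.Analysis"
    "Jordan_Normal_Form.Gauss_Jordan_Elimination"
begin

(* Player states have player-dependent dimensions m i and are vectors and matrices of
   Jordan_Normal_Form (indexed from 0); action profiles and estimates live in real ^ 'n, where
   the finite type 'n is the player set.  The infix notations of the two libraries clash. *)
no_notation Matrix.vec_index (infixl \<open>$\<close> 100)
no_notation Matrix.scalar_prod (infix \<open>\<bullet>\<close> 70)
notation Matrix.vec_index (infixl \<open>$v\<close> 100)
notation Matrix.scalar_prod (infix \<open>\<bullet>v\<close> 70)

section \<open>The game\<close>

definition set_action :: "real ^ 'n \<Rightarrow> 'n \<Rightarrow> real \<Rightarrow> real ^ 'n" where
  "set_action y i s = (\<chi> j. if j = i then s else y $ j)"

definition nash_equilibrium :: "('n::finite \<Rightarrow> real ^ 'n \<Rightarrow> real) \<Rightarrow> real ^ 'n \<Rightarrow> bool" where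
  "nash_equilibrium f ystar \<longleftrightarrow> (\<forall>i s. f i ystar \<le> f i (set_action ystar i s))"

definition partial_deriv :: "'n::finite \<Rightarrow> (real ^ 'n \<Rightarrow> real) \<Rightarrow> real ^ 'n \<Rightarrow> real" where
  "partial_deriv i g y = deriv (\<lambda>s. g (set_action y i s)) (y $ i)"

definition pseudo_gradient :: "('n::finite \<Rightarrow> real ^ 'n \<Rightarrow> real) \<Rightarrow> real ^ 'n \<Rightarrow> real ^ 'n" where
  "pseudo_gradient f y = (\<chi> i. partial_deriv i (f i) y)"

definition continuously_differentiable :: "(real ^ 'n::finite \<Rightarrow> real) \<Rightarrow> bool" where
  "continuously_differentiable g \<longleftrightarrow>
     (\<exists>g'. continuous_on UNIV g' \<and> (\<forall>y. GDERIV g y :> g' y))"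

section \<open>The communication graph\<close>

(* a j i is the weight of the edge from i to j *)
definition weights_of_digraph :: "('n \<times> 'n) set \<Rightarrow> ('n \<Rightarrow> 'n \<Rightarrow> real) \<Rightarrow> bool" where
  "weights_of_digraph E a \<longleftrightarrow>
     (\<forall>i j. ((i, j) \<in> E \<longrightarrow> a j i > 0) \<and> ((i, j) \<notin> E \<longrightarrow> a j i = 0)) \<and> (\<forall>i. a i i = 0)"

definition strongly_connected :: "('n \<times> 'n) set \<Rightarrow> bool" where
  "strongly_connected E \<longleftrightarrow> (\<forall>i j. i \<noteq> j \<longrightarrow> (i, j) \<in> E\<^sup>+)"

section \<open>Player dynamics and change of coordinates\<close>

definition A_mat :: "nat \<Rightarrow> real mat" where
  "A_mat m = Matrix.mat m m (\<lambda>(p, q). if q = p + 1 then 1 else 0)"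

definition B_vec :: "nat \<Rightarrow> real Matrix.vec" where
  "B_vec m = unit_vec m (m - 1)"

definition C_vec :: "nat \<Rightarrow> real Matrix.vec" where
  "C_vec m = unit_vec m 0"

(* With indices starting at 0, the entry theta^(m-q+1) in column q becomes theta^(m-q). *)
definition Abar_mat :: "nat \<Rightarrow> real \<Rightarrow> real mat" where
  "Abar_mat m \<theta> = Matrix.mat m m (\<lambda>(p, q). if p < q then \<theta> ^ (m - q) else 0)"

definition Bbar_vec :: "nat \<Rightarrow> real Matrix.vec" where
  "Bbar_vec m = Matrix.vec m (\<lambda>_. 1)"

definition controllability_mat :: "nat \<Rightarrow> real mat \<Rightarrow> real Matrix.vec \<Rightarrow> real mat" where
  "controllability_mat m A B = mat_of_cols m (map (\<lambda>k. (A ^\<^sub>m k) *\<^sub>v B) [0..<m])"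

(* "the (mat_inverse M)" is the inverse of M; both matrices it is applied to below are
   nonsingular for theta > 0. *)
definition T_mat :: "nat \<Rightarrow> real \<Rightarrow> real mat" where
  "T_mat m \<theta> = controllability_mat m (A_mat m) (B_vec m) *
     the (mat_inverse (controllability_mat m (Abar_mat m \<theta>) (Bbar_vec m)))"

(* the solution xbar of x = T xbar *)
definition bar_coords :: "nat \<Rightarrow> real \<Rightarrow> real Matrix.vec \<Rightarrow> real Matrix.vec" where
  "bar_coords m \<theta> x = the (mat_inverse (T_mat m \<theta>)) *\<^sub>v x"

definition outputs :: "('n::finite \<Rightarrow> nat) \<Rightarrow> ('n \<Rightarrow> real \<Rightarrow> real Matrix.vec) \<Rightarrow> real \<Rightarrow> real ^ 'n" where
  "outputs m x t = (\<chi> i. C_vec (m i) \<bullet>v x i t)"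

section \<open>The controller\<close>

definition sat :: "real \<Rightarrow> real \<Rightarrow> real" where
  "sat \<Delta> s = sgn s * min \<bar>s\<bar> \<Delta>"

definition grad_integral ::
  "('n::finite \<Rightarrow> real ^ 'n \<Rightarrow> real) \<Rightarrow> ('n \<Rightarrow> real \<Rightarrow> real ^ 'n) \<Rightarrow> 'n \<Rightarrow> real \<Rightarrow> real" where
  "grad_integral f z i t = integral {0..t} (\<lambda>\<tau>. partial_deriv i (f i) (z i \<tau>))"

(* xbar_{i(m-k+1)} is component m - k when counting from 0. *)
definition control_input ::
  "nat \<Rightarrow> real \<Rightarrow> real \<Rightarrow> real Matrix.vec \<Rightarrow> real \<Rightarrow> real" where
  "control_input m \<theta> \<Delta> xbar \<sigma> =
     - (\<Sum>k = 1..m - 1. \<theta> ^ k * sat \<Delta> (xbar $v (m - k)))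
     - \<theta> ^ m * sat \<Delta> (xbar $v 0 + (\<Prod>k = 1..m - 1. \<theta> ^ k) * \<sigma>)"

definition xi ::
  "('n::finite \<Rightarrow> real ^ 'n \<Rightarrow> real) \<Rightarrow> ('n \<Rightarrow> 'n \<Rightarrow> real) \<Rightarrow> ('n \<Rightarrow> real \<Rightarrow> real ^ 'n) \<Rightarrow>
   'n \<Rightarrow> 'n \<Rightarrow> real \<Rightarrow> real" where
  "xi f a z i j t =
     (\<Sum>k\<in>UNIV. a i k * (z i t $ j - z k t $ j)) + a i j * (z i t $ j + grad_integral f z j t)"

(* (x, z, c) solves the closed-loop system on [0, infinity); z i t $ j is z_{ij}(t). *)
definition closed_loop ::
  "('n::finite \<Rightarrow> nat) \<Rightarrow> ('n \<Rightarrow> real) \<Rightarrow> ('n \<Rightarrow> real) \<Rightarrow> ('n \<Rightarrow> real ^ 'n \<Rightarrow> real) \<Rightarrow>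
   ('n \<Rightarrow> 'n \<Rightarrow> real) \<Rightarrow>
   ('n \<Rightarrow> real \<Rightarrow> real Matrix.vec) \<Rightarrow> ('n \<Rightarrow> real \<Rightarrow> real ^ 'n) \<Rightarrow> ('n \<Rightarrow> 'n \<Rightarrow> real \<Rightarrow> real) \<Rightarrow> bool"
where
  "closed_loop m \<theta> \<Delta> f a x z c \<longleftrightarrow>
    (\<forall>t\<ge>0. \<forall>i.
      x i t \<in> carrier_vec (m i) \<and>
      (let u = control_input (m i) (\<theta> i) (\<Delta> i) (bar_coords (m i) (\<theta> i) (x i t))
                 (grad_integral f z i t)
       in \<forall>k<m i. ((\<lambda>s. x i s $v k) has_real_derivative
            (A_mat (m i) *\<^sub>v x i t + u \<cdot>\<^sub>v B_vec (m i)) $v k) (at t within {0..})) \<and>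
      (\<forall>j. let \<xi> = xi f a z i j t; \<rho> = \<xi>\<^sup>2 in
        ((\<lambda>s. z i s $ j) has_real_derivative - (c i j t + \<rho>) * \<xi>) (at t within {0..}) \<and>
        (c i j has_real_derivative \<rho>) (at t within {0..})))"

definition bounded_and_convergent :: "(real \<Rightarrow> real) \<Rightarrow> bool" where
  "bounded_and_convergent g \<longleftrightarrow> bounded (g ` {0..}) \<and> (\<exists>L. (g \<longlongrightarrow> L) at_top)"

end

theory Submission
  imports Defs "HOL-Probability.Discrete_Topology" "Jordan_Normal_Form.Determinant"
begin

(* From here on $ and the inner product dot belong to real ^ 'n again. *)
no_notation Matrix.vec_index (infixl \<open>$\<close> 100)
no_notation Matrix.scalar_prod (infix \<open>\<bullet>\<close> 70)

text \<open>The closed loop is a cascade. Let \<open>w\<^sub>j\<close> be minus the integral of the \<open>j\<close>-th partial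
derivative along \<open>z\<^sub>j\<close>. The triple \<open>(w, z, c)\<close> solves an autonomous system that never sees the
states \<open>x\<close>, and player \<open>i\<close> only has to steer a chain of integrators towards the signal \<open>w\<^sub>i\<close>.

The estimators. If all rows of \<open>z\<close> agreed with \<open>w\<close>, then \<open>w\<close> would follow the pseudo-gradient flow,
which strong monotonicity contracts to the equilibrium \<open>y\<^sup>*\<close>. Column \<open>j\<close> of \<open>z\<close> is a consensus
network in which \<open>w\<^sub>j\<close> acts as a leader attached to the out-neighbours of \<open>j\<close>, so \<open>\<xi>\<close> is a pinned
Laplacian applied to the column error. Strong connectivity provides positive weights \<open>p\<close> that
balance the digraph (\<open>exists_balancing_weights\<close>); with respect to them all pinned Laplacians are
coercive at once (\<open>pinned_laplacian_coercive\<close>). The function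
\<open>K/2 |w - y\<^sup>*|\<^sup>2 + \<Sum> p\<^sub>i/2 ((2 c\<^sub>i\<^sub>j + \<xi>\<^sub>i\<^sub>j\<^sup>2) \<xi>\<^sub>i\<^sub>j\<^sup>2 + (c\<^sub>i\<^sub>j - \<alpha>)\<^sup>2)\<close> then decreases at least at the
rate \<open>|w - y\<^sup>*|\<^sup>2 + |\<xi>|\<^sup>2\<close> (\<open>lyapunov_rate_le\<close>): \<open>K\<close> is taken so large that the contraction of \<open>w\<close>
absorbs the forcing that the moving leaders exert on the columns, and then \<open>\<alpha>\<close>, a virtual gain
that occurs only in the analysis, so large that all remaining multiples of \<open>|\<xi>|\<^sup>2\<close> are absorbed.
Hence \<open>w\<close>, \<open>z\<close> and the nondecreasing gains \<open>c\<close> are bounded, and a Barbalat argument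
(\<open>tendsto_0_if_dissipated\<close>) sends \<open>w\<close> and all rows of \<open>z\<close> to \<open>y\<^sup>*\<close>.

The players. In the coordinates of the theorem, the control cancels the couplings of a stage to the
stages handled before it, as soon as those have left saturation. Because \<open>\<theta> < 1/2\<close>, the gain of a
stage exceeds the sum of the gains of all later stages, so the stages leave saturation one after the
other; afterwards the loop is linear and its states converge in the opposite order
(\<open>saturated_cascade_tendsto_0\<close>). The first coordinate approaches \<open>\<Prod>\<theta>\<^sup>k\<close> times \<open>w\<^sub>i\<close>, and the
corner entry of the transformation is the reciprocal of that product (\<open>T_mat_entry_00\<close>), which
makes the output approach \<open>y\<^sup>*\<^sub>i\<close>.

Existence of solutions. The estimator field is only locally Lipschitz, but the Lyapunov function
gives an a priori bound, so the field may be composed with the nearest-point retraction onto a large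
ball without changing its solutions (\<open>bounded_ode_has_solution\<close>); the globally Lipschitz case is
solved on the whole half line by one contraction (\<open>lipschitz_ode_has_solution\<close>).

The equilibrium. Strong monotonicity makes each objective convex in the player's own action, so Nash
equilibria are the zeros of the pseudo-gradient (\<open>nash_equilibrium_iff_critical\<close>), of which there is
exactly one (\<open>strongly_monotone_unique_zero\<close>).\<close>

section \<open>Scalar comparison arguments and saturated cascades\<close>

lemma real_MVT_within:
  fixes W W' :: "real \<Rightarrow> real"
  assumes "r < s" "{r..s} \<subseteq> S"
    and "\<And>t. t \<in> {r..s} \<Longrightarrow> (W has_real_derivative W' t) (at t within S)"
  obtains \<xi> where "r < \<xi>" "\<xi> < s" "W s - W r = W' \<xi> * (s - r)"
proof -
  have "\<exists>x\<in>{r<..<s}. W s - W r = (\<lambda>t h. h * W' t) x (s - r)"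
  proof (rule mvt_simple[OF assms(1)])
    fix x assume "r \<le> x" "x \<le> s"
    then have "(W has_real_derivative W' x) (at x within {r..s})"
      using assms(2,3) by (meson DERIV_subset atLeastAtMost_iff)
    then show "(W has_derivative (\<lambda>h. h * W' x)) (at x within {r..s})"
      by (simp add: has_field_derivative_def mult.commute[of _ "W' x"])
  qed
  then show ?thesis using that by (auto simp: mult.commute)
qed

text \<open>Above the level \<open>R\<close> the function falls at a uniform speed, so it gets down to \<open>R\<close>. It cannot climb back:
after the last time at or below \<open>R\<close> the mean value theorem would need a nonnegative slope above \<open>R\<close>.\<close>

lemma eventually_le_if_decreasing_above:
  fixes W W' :: "real \<Rightarrow> real"
  assumes deriv: "\<And>t. t \<ge> t0 \<Longrightarrow> (W has_real_derivative W' t) (at t within {t0..})"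
    and decr: "\<And>t. t \<ge> t0 \<Longrightarrow> W t > R \<Longrightarrow> W' t \<le> - \<epsilon>"
    and "\<epsilon> > 0"
  shows "\<exists>T\<ge>t0. \<forall>t\<ge>T. W t \<le> R"
proof -
  have cont: "continuous_on {t0..} W"
    using deriv by (auto simp: continuous_on_eq_continuous_within intro: DERIV_continuous)
  have "\<exists>T\<ge>t0. W T \<le> R"
  proof (rule ccontr)
    assume "\<not> ?thesis"
    then have above: "W t > R" if "t \<ge> t0" for t using that by force
    define s where "s = t0 + (\<bar>W t0 - R\<bar> + 1) / \<epsilon>"
    have st: "t0 < s" using \<open>\<epsilon> > 0\<close> by (simp add: s_def add_nonneg_pos)
    obtain \<xi> where \<xi>: "t0 < \<xi>" "\<xi> < s" "W s - W t0 = W' \<xi> * (s - t0)"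
      by (rule real_MVT_within[OF st, of "{t0..}" W W']) (use deriv in auto)
    have "W' \<xi> * (s - t0) \<le> - \<epsilon> * (s - t0)"
      using decr[of \<xi>] above[of \<xi>] \<xi>(1) st by (intro mult_right_mono) auto
    also have "\<dots> = - (\<bar>W t0 - R\<bar> + 1)" using \<open>\<epsilon> > 0\<close> by (simp add: s_def)
    finally have "W s < R" using \<xi>(3) by linarith
    then show False using above[of s] st by simp
  qed
  then obtain T where T: "T \<ge> t0" "W T \<le> R" by blast
  have "W t \<le> R" if "t \<ge> T" for t
  proof (rule ccontr)
    assume "\<not> W t \<le> R"
    define Z where "Z = {s \<in> {T..t}. W s \<le> R}"
    have "compact Z"
    proof -
      have "closed Z"
        unfolding Z_def using T(1)
        by (intro continuous_on_closed_Collect_le continuous_on_const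
            continuous_on_subset[OF cont]) auto
      then show ?thesis
        by (intro compact_eq_bounded_closed[THEN iffD2] conjI bounded_subset[of "{T..t}" Z]) (auto simp: Z_def)
    qed
    moreover have "T \<in> Z" using T \<open>t \<ge> T\<close> by (simp add: Z_def)
    ultimately obtain s where s: "s \<in> Z" "\<And>r. r \<in> Z \<Longrightarrow> r \<le> s"
      using compact_attains_sup[of Z] by blast
    have "s < t" using s(1) \<open>\<not> W t \<le> R\<close> by (auto simp: Z_def order_le_less)
    obtain \<xi> where \<xi>: "s < \<xi>" "\<xi> < t" "W t - W s = W' \<xi> * (t - s)"
      by (rule real_MVT_within[OF \<open>s < t\<close>, of "{t0..}" W W']) (use deriv s T in \<open>auto simp: Z_def\<close>)
    have "W \<xi> > R" using s(1) s(2)[of \<xi>] \<xi> unfolding Z_def by fastforce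
    then have "W' \<xi> < 0" using decr[of \<xi>] s(1) T \<xi> \<open>\<epsilon> > 0\<close> by (auto simp: Z_def)
    then have "W t \<le> W s" using \<xi> by (smt (verit) mult_neg_pos)
    then show False using s(1) \<open>\<not> W t \<le> R\<close> by (auto simp: Z_def)
  qed
  then show ?thesis using T(1) by blast
qed

lemma abs_sat_le: "\<Delta> \<ge> 0 \<Longrightarrow> \<bar>sat \<Delta> s\<bar> \<le> \<Delta>"
  by (auto simp: sat_def abs_mult sgn_if)

lemma sat_eq_self: "\<bar>s\<bar> \<le> \<Delta> \<Longrightarrow> sat \<Delta> s = s"
  by (auto simp: sat_def sgn_if min_def)

text \<open>Outside \<open>[-r, r]\<close> the saturated feedback still pulls back with strength at least \<open>r\<close>; this is what
drives \<open>v\<^sup>2\<close> down in the next lemma.\<close>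

lemma mult_sat_ge:
  assumes "0 \<le> r" "r \<le> \<Delta>" "\<bar>v\<bar> \<ge> r"
  shows "v * sat \<Delta> v \<ge> r * \<bar>v\<bar>"
proof -
  have "v * sat \<Delta> v = \<bar>v\<bar> * min \<bar>v\<bar> \<Delta>"
    by (auto simp: sat_def sgn_if)
  moreover have "r * \<bar>v\<bar> \<le> \<bar>v\<bar> * min \<bar>v\<bar> \<Delta>"
    using assms by (subst mult.commute) (intro mult_left_mono, auto)
  ultimately show ?thesis by simp
qed

lemma sat_lipschitz: "\<Delta> \<ge> 0 \<Longrightarrow> \<bar>sat \<Delta> s - sat \<Delta> r\<bar> \<le> \<bar>s - r\<bar>"
proof -
  assume "\<Delta> \<ge> 0"
  then have "sat \<Delta> x = max (- \<Delta>) (min x \<Delta>)" for x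
    by (auto simp: sat_def sgn_if min_def max_def)
  then show ?thesis by simp
qed

text \<open>While \<open>|v| > r\<close>, the derivative of \<open>v\<^sup>2\<close> is at most \<open>-2 r (\<kappa> r - \<delta>)\<close>, because the feedback beats the
disturbance.\<close>

lemma saturated_ode_eventually_le:
  fixes v d :: "real \<Rightarrow> real"
  assumes deriv: "\<And>t. t \<ge> t0 \<Longrightarrow>
      (v has_real_derivative - \<kappa> * sat \<Delta> (v t) + d t) (at t within {t0..})"
    and d: "\<And>t. t \<ge> t0 \<Longrightarrow> \<bar>d t\<bar> \<le> \<delta>"
    and \<kappa>: "\<kappa> > 0" and r: "0 < r" "r \<le> \<Delta>" and \<delta>: "\<delta> < \<kappa> * r"
  shows "\<exists>T\<ge>t0. \<forall>t\<ge>T. \<bar>v t\<bar> \<le> r"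
proof -
  have "\<exists>T\<ge>t0. \<forall>t\<ge>T. (v t)\<^sup>2 \<le> r\<^sup>2"
  proof (rule eventually_le_if_decreasing_above)
    show "((\<lambda>t. (v t)\<^sup>2) has_real_derivative 2 * v t * (- \<kappa> * sat \<Delta> (v t) + d t)) (at t within {t0..})"
      if "t \<ge> t0" for t
      by (rule derivative_eq_intros deriv that refl)+ simp
    show "2 * r * (\<kappa> * r - \<delta>) > 0" using r \<delta> by simp
    fix t assume t: "t \<ge> t0" and "r\<^sup>2 < (v t)\<^sup>2"
    then have vr: "r < \<bar>v t\<bar>"
      using r abs_le_square_iff[of "v t" r] by (simp add: not_le[symmetric])
    have "v t * d t \<le> \<bar>v t\<bar> * \<delta>"
      using mult_left_mono[OF d[OF t] abs_ge_zero[of "v t"]] abs_ge_self[of "v t * d t"]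
      by (simp add: abs_mult)
    moreover have "\<kappa> * (v t * sat \<Delta> (v t)) \<ge> \<kappa> * (r * \<bar>v t\<bar>)"
      using mult_sat_ge[of r \<Delta> "v t"] r vr \<kappa> by (intro mult_left_mono) auto
    moreover have "\<bar>v t\<bar> * (\<kappa> * r - \<delta>) \<ge> r * (\<kappa> * r - \<delta>)"
      using vr \<delta> by (intro mult_right_mono) auto
    ultimately show "2 * v t * (- \<kappa> * sat \<Delta> (v t) + d t) \<le> - (2 * r * (\<kappa> * r - \<delta>))"
      by (simp add: algebra_simps)
  qed
  then show ?thesis using r abs_le_square_iff[of _ r] by simp
qed

lemma saturated_ode_tendsto_0:
  fixes v d :: "real \<Rightarrow> real"
  assumes deriv: "\<And>t. t \<ge> 0 \<Longrightarrow>
      (v has_real_derivative - \<kappa> * sat \<Delta> (v t) + d t) (at t within {0..})"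
    and d: "(d \<longlongrightarrow> 0) at_top"
    and \<kappa>: "\<kappa> > 0" and \<Delta>: "\<Delta> > 0"
  shows "(v \<longlongrightarrow> 0) at_top"
proof (rule tendstoI)
  fix e :: real assume "e > 0"
  define r where "r = min (e/2) \<Delta>"
  have r: "0 < r" "r \<le> \<Delta>" "r < e" using \<open>e > 0\<close> \<Delta> by (auto simp: r_def)
  have "eventually (\<lambda>t. \<bar>d t\<bar> < \<kappa> * r / 2) at_top"
    using tendstoD[OF d, of "\<kappa> * r / 2"] r \<kappa> by (simp add: dist_real_def)
  then obtain t1 where t1: "\<And>t. t \<ge> t1 \<Longrightarrow> \<bar>d t\<bar> < \<kappa> * r / 2"
    by (auto simp: eventually_at_top_linorder)
  have "\<exists>T\<ge>max 0 t1. \<forall>t\<ge>T. \<bar>v t\<bar> \<le> r"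
  proof (rule saturated_ode_eventually_le[where d=d and \<kappa>=\<kappa> and \<Delta>=\<Delta> and \<delta>="\<kappa> * r / 2"])
    show "(v has_real_derivative - \<kappa> * sat \<Delta> (v t) + d t) (at t within {max 0 t1..})"
      if "t \<ge> max 0 t1" for t
      using that by (intro DERIV_subset[OF deriv]) auto
    show "\<bar>d t\<bar> \<le> \<kappa> * r / 2" if "t \<ge> max 0 t1" for t using t1[of t] that by simp
  qed (use r \<kappa> in auto)
  then show "eventually (\<lambda>t. dist (v t) 0 < e) at_top"
    using r by (auto simp: eventually_at_top_linorder dist_real_def intro: order_le_less_trans)
qed

text \<open>What \<open>\<theta> < 1/2\<close> is for: the gain of one stage exceeds the total gain of all later stages.\<close>

lemma geometric_tail_less:
  fixes \<theta> :: real
  assumes "0 < \<theta>" "\<theta> < 1/2"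
  shows "(\<Sum>l = k + 1..m. \<theta> ^ l) < \<theta> ^ k"
proof (cases "k \<le> m")
  case True
  then have "(\<Sum>l = k + 1..m. \<theta> ^ l) \<le> \<theta> ^ k - \<theta> ^ m"
  proof (induction m rule: dec_induct)
    case (step n)
    have "(\<Sum>l = k + 1..Suc n. \<theta> ^ l) = (\<Sum>l = k + 1..n. \<theta> ^ l) + \<theta> ^ Suc n"
      using step by simp
    moreover have "2 * \<theta> * \<theta> ^ n \<le> 1 * \<theta> ^ n" using assms by (intro mult_right_mono) auto
    ultimately show ?case using step by simp
  qed simp
  moreover have "\<theta> ^ m > 0" using assms by simp
  ultimately show ?thesis by linarith
qed (use assms in simp)

text \<open>Two passes in opposite directions. Forwards: once the stages before \<open>k\<close> have left saturation, their
feedback cancels their coupling into stage \<open>k\<close>, and what is left of the later stages is bounded by the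
geometric tail, which the gain \<open>\<theta> ^ k\<close> beats; so stage \<open>k\<close> leaves saturation too. Backwards: then
stage \<open>k\<close> is disturbed only by later stages, which tend to zero by induction.\<close>

lemma saturated_cascade_tendsto_0:
  fixes s d :: "nat \<Rightarrow> real \<Rightarrow> real"
  assumes deriv: "\<And>k t. k \<in> {1..m} \<Longrightarrow> t \<ge> 0 \<Longrightarrow>
      (s k has_real_derivative (\<Sum>l = 1..<k. \<theta> ^ l * s l t)
         - (\<Sum>l = 1..m. \<theta> ^ l * sat \<Delta> (s l t)) + d k t) (at t within {0..})"
    and d: "\<And>k. k \<in> {1..m} \<Longrightarrow> (d k \<longlongrightarrow> 0) at_top"
    and \<theta>: "0 < \<theta>" "\<theta> < 1/2" and \<Delta>: "\<Delta> > 0"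
    and k: "k \<in> {1..m}"
  shows "(s k \<longlongrightarrow> 0) at_top"
proof -
  \<comment> \<open>rest k collects everything in the equation of stage k except its own feedback; its first sum
    vanishes as soon as the stages before k are unsaturated.\<close>
  define rest where "rest k t = (\<Sum>l = 1..<k. \<theta> ^ l * (s l t - sat \<Delta> (s l t)))
      - (\<Sum>l = k + 1..m. \<theta> ^ l * sat \<Delta> (s l t)) + d k t" for k t
  have deriv': "(s k has_real_derivative - (\<theta> ^ k) * sat \<Delta> (s k t) + rest k t) (at t within {0..})"
    if "k \<in> {1..m}" "t \<ge> 0" for k t
  proof -
    let ?F = "\<lambda>l. \<theta> ^ l * sat \<Delta> (s l t)"
    have "{1..m} = {1..<k} \<union> insert k {k+1..m}" using that(1) by auto
    then have "sum ?F {1..m} = sum ?F ({1..<k} \<union> insert k {k+1..m})" by (simp only:)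
    also have "\<dots> = sum ?F {1..<k} + sum ?F (insert k {k+1..m})"
      by (rule sum.union_disjoint) auto
    also have "sum ?F (insert k {k+1..m}) = ?F k + sum ?F {k+1..m}" by simp
    finally have "(\<Sum>l = 1..<k. \<theta> ^ l * s l t) - sum ?F {1..m} + d k t
      = - (\<theta> ^ k) * sat \<Delta> (s k t) + rest k t"
      unfolding rest_def right_diff_distrib sum_subtractf minus_mult_left[symmetric] by linarith
    then show ?thesis using deriv[OF that] by simp
  qed
  have unsat: "eventually (\<lambda>t. \<bar>s k t\<bar> \<le> \<Delta>) at_top" if "k \<in> {1..m}" for k
    using that
  proof (induction k rule: less_induct)
    case (less k)
    define \<mu> where "\<mu> = \<theta> ^ k - (\<Sum>l = k + 1..m. \<theta> ^ l)"
    have \<mu>: "\<mu> > 0" using geometric_tail_less[OF \<theta>] by (simp add: \<mu>_def)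
    have "eventually (\<lambda>t. \<forall>l\<in>{1..<k}. \<bar>s l t\<bar> \<le> \<Delta>) at_top"
      using less.IH less.prems by (intro eventually_ball_finite) auto
    moreover have "eventually (\<lambda>t. \<bar>d k t\<bar> < \<mu> * \<Delta> / 2) at_top"
      using tendstoD[OF d[OF less.prems], of "\<mu> * \<Delta> / 2"] \<mu> \<Delta> by (simp add: dist_real_def)
    ultimately have "eventually (\<lambda>t. (\<forall>l\<in>{1..<k}. \<bar>s l t\<bar> \<le> \<Delta>) \<and> \<bar>d k t\<bar> < \<mu> * \<Delta> / 2) at_top"
      by (rule eventually_conj)
    then obtain t1 where "\<forall>t\<ge>t1. (\<forall>l\<in>{1..<k}. \<bar>s l t\<bar> \<le> \<Delta>) \<and> \<bar>d k t\<bar> < \<mu> * \<Delta> / 2"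
      unfolding eventually_at_top_linorder by blast
    then have t1: "\<And>t l. t \<ge> t1 \<Longrightarrow> l\<in>{1..<k} \<Longrightarrow> \<bar>s l t\<bar> \<le> \<Delta>"
       "\<And>t. t \<ge> t1 \<Longrightarrow> \<bar>d k t\<bar> < \<mu> * \<Delta> / 2"
      by blast+
    have "\<exists>T\<ge>max 0 t1. \<forall>t\<ge>T. \<bar>s k t\<bar> \<le> \<Delta>"
    proof (rule saturated_ode_eventually_le[where \<kappa>="\<theta> ^ k" and d="rest k" and \<Delta>=\<Delta>
            and \<delta>="(\<theta> ^ k - \<mu> / 2) * \<Delta>"])
      show "(s k has_real_derivative - (\<theta> ^ k) * sat \<Delta> (s k t) + rest k t) (at t within {max 0 t1..})"
        if "t \<ge> max 0 t1" for t
        using that by (intro DERIV_subset[OF deriv'[OF less.prems]]) auto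
      show "\<bar>rest k t\<bar> \<le> (\<theta> ^ k - \<mu> / 2) * \<Delta>" if "t \<ge> max 0 t1" for t
      proof -
        have "(\<Sum>l = 1..<k. \<theta> ^ l * (s l t - sat \<Delta> (s l t))) = 0"
          using t1(1)[of t] that by (intro sum.neutral) (auto simp: sat_eq_self)
        moreover have "\<bar>\<Sum>l = k + 1..m. \<theta> ^ l * sat \<Delta> (s l t)\<bar> \<le> (\<Sum>l = k + 1..m. \<theta> ^ l * \<Delta>)"
          using \<theta> \<Delta> by (intro order_trans[OF sum_abs] sum_mono)
            (auto simp: abs_mult intro!: abs_sat_le)
        moreover have "(\<Sum>l = k + 1..m. \<theta> ^ l * \<Delta>) = (\<theta> ^ k - \<mu>) * \<Delta>"
          by (simp add: \<mu>_def sum_distrib_right)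
        moreover have "\<bar>d k t\<bar> \<le> \<mu> * \<Delta> / 2" using t1(2)[of t] that by simp
        moreover have "(\<theta> ^ k - \<mu>) * \<Delta> + \<mu> * \<Delta> / 2 = (\<theta> ^ k - \<mu> / 2) * \<Delta>"
          by (simp add: field_simps)
        ultimately show ?thesis unfolding rest_def by linarith
      qed
    qed (use \<theta> \<Delta> \<mu> in auto)
    then show ?case by (auto simp: eventually_at_top_linorder)
  qed
  have "(s k \<longlongrightarrow> 0) at_top" if "k \<in> {1..m}" for k
    using that
  proof (induction "m - k" arbitrary: k rule: less_induct)
    case less
    have vanish: "((\<lambda>t. \<theta> ^ l * (s l t - sat \<Delta> (s l t))) \<longlongrightarrow> 0) at_top" if "l \<in> {1..<k}" for l
    proof -
      have "eventually (\<lambda>t. \<bar>s l t\<bar> \<le> \<Delta>) at_top" using less.prems that by (intro unsat) auto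
      then have "eventually (\<lambda>t. \<theta> ^ l * (s l t - sat \<Delta> (s l t)) = 0) at_top"
        by (rule eventually_mono) (simp add: sat_eq_self)
      then show ?thesis by (rule tendsto_eventually)
    qed
    have "((\<lambda>t. \<theta> ^ l * sat \<Delta> (s l t)) \<longlongrightarrow> 0) at_top" if "l \<in> {k+1..m}" for l
    proof -
      have l: "l \<in> {1..m}" using that by auto
      have "(s l \<longlongrightarrow> 0) at_top" using less.hyps[of l] less.prems that by auto
      moreover have "eventually (\<lambda>t. sat \<Delta> (s l t) = s l t) at_top"
        using unsat[OF l] by (auto elim!: eventually_mono simp: sat_eq_self)
      ultimately have "((\<lambda>t. sat \<Delta> (s l t)) \<longlongrightarrow> 0) at_top"
        by (subst tendsto_cong)
      then show ?thesis by (rule tendsto_mult_right_zero)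
    qed
    then have "(rest k \<longlongrightarrow> 0 - 0 + 0) at_top"
      unfolding rest_def
      by (intro tendsto_add tendsto_diff tendsto_null_sum d[OF less.prems] vanish)
    then show ?case
      using saturated_ode_tendsto_0[of "s k" "\<theta> ^ k" \<Delta> "rest k"] deriv'[OF less.prems] \<theta> \<Delta>
      by simp
  qed
  then show ?thesis using k by blast
qed

text \<open>A form of Barbalat's lemma without integrals. Since \<open>h\<close> is Lipschitz, \<open>V\<close> drops by at least
\<open>\<delta> (h t - M \<delta>)\<close> during \<open>[t, t + \<delta>]\<close>; but a nonincreasing \<open>V\<close> that is bounded below can drop only
by arbitrarily little at late times.\<close>

lemma tendsto_0_if_dissipated:
  fixes V V' h h' :: "real \<Rightarrow> real"
  assumes V: "\<And>t. t \<ge> 0 \<Longrightarrow> (V has_real_derivative V' t) (at t within {0..})"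
    and V': "\<And>t. t \<ge> 0 \<Longrightarrow> V' t \<le> - h t" and V_nonneg: "\<And>t. t \<ge> 0 \<Longrightarrow> V t \<ge> 0"
    and h: "\<And>t. t \<ge> 0 \<Longrightarrow> (h has_real_derivative h' t) (at t within {0..})"
    and h': "\<And>t. t \<ge> 0 \<Longrightarrow> \<bar>h' t\<bar> \<le> M" and h_nonneg: "\<And>t. t \<ge> 0 \<Longrightarrow> h t \<ge> 0"
  shows "(h \<longlongrightarrow> 0) at_top"
proof (rule tendstoI)
  fix e :: real assume "e > 0"
  have M: "M \<ge> 0" using h'[of 0] by simp
  define \<delta> where "\<delta> = e / (2 * (M + 1))"
  have \<delta>: "\<delta> > 0" "M * \<delta> < e / 2" using \<open>e > 0\<close> M by (auto simp: \<delta>_def field_simps)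
  have h_lip: "h s \<ge> h t - M * (s - t)" if ts: "0 \<le> t" "t < s" for s t
  proof -
    obtain \<xi> where \<xi>: "t < \<xi>" "\<xi> < s" "h s - h t = h' \<xi> * (s - t)"
      by (rule real_MVT_within[OF ts(2), of "{0..}" h h']) (use h ts in auto)
    have "- (h' \<xi>) \<le> M" using h'[of \<xi>] \<xi> ts by auto
    then have "- (h' \<xi>) * (s - t) \<le> M * (s - t)" using ts by (intro mult_right_mono) auto
    then show ?thesis using \<xi>(3) by (simp add: algebra_simps)
  qed
  have drop: "V (t + \<delta>) \<le> V t - \<delta> * (h t - M * \<delta>)" if t: "t \<ge> 0" for t
  proof -
    obtain \<xi> where \<xi>: "t < \<xi>" "\<xi> < t + \<delta>" "V (t + \<delta>) - V t = V' \<xi> * (t + \<delta> - t)"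
      by (rule real_MVT_within[of t "t + \<delta>" "{0..}" V V']) (use V \<delta> t in auto)
    have "M * (\<xi> - t) \<le> M * \<delta>" using \<xi> M by (intro mult_left_mono) auto
    then have "V' \<xi> \<le> - (h t - M * \<delta>)"
      using V'[of \<xi>] h_lip[of t \<xi>] \<xi> t by linarith
    then have "V' \<xi> * \<delta> \<le> - (h t - M * \<delta>) * \<delta>" using \<delta> by (intro mult_right_mono) auto
    then show ?thesis using \<xi>(3) by (simp add: algebra_simps)
  qed
  have mono: "V s \<le> V t" if ts: "0 \<le> t" "t \<le> s" for s t
  proof (cases "t = s")
    case False
    obtain \<xi> where \<xi>: "t < \<xi>" "\<xi> < s" "V s - V t = V' \<xi> * (s - t)"
      by (rule real_MVT_within[of t s "{0..}" V V']) (use V ts False in auto)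
    have "V' \<xi> \<le> 0" using V'[of \<xi>] h_nonneg[of \<xi>] \<xi> ts by auto
    then show ?thesis using \<xi> ts by (smt (verit) mult_nonneg_nonneg mult_minus_left)
  qed simp
  define v where "v = Inf (V ` {0..})"
  have bdd: "bdd_below (V ` {0..})" using V_nonneg by (auto intro!: bdd_belowI[of _ 0])
  obtain t0 where t0: "t0 \<ge> 0" "V t0 < v + \<delta> * (e / 2)"
  proof -
    have "v < v + \<delta> * (e / 2)" using \<delta> \<open>e > 0\<close> by simp
    then show ?thesis
      using cInf_lessD[of "V ` {0..}" "v + \<delta> * (e / 2)"] that unfolding v_def by force
  qed
  have "\<bar>h t\<bar> < e" if "t \<ge> t0" for t
  proof -
    have "v \<le> V (t + \<delta>)" unfolding v_def using bdd t0 that \<delta> by (intro cInf_lower) auto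
    also have "\<dots> \<le> V t - \<delta> * (h t - M * \<delta>)" using drop[of t] t0 that by simp
    also have "V t \<le> V t0" using mono[of t0 t] t0 that by simp
    finally have "\<delta> * (h t - M * \<delta>) < \<delta> * (e / 2)" using t0 by simp
    then have "h t - M * \<delta> < e / 2" using \<delta> by simp
    then show ?thesis using \<delta> h_nonneg[of t] t0 that by simp
  qed
  then show "eventually (\<lambda>t. dist (h t) 0 < e) at_top"
    by (auto simp: eventually_at_top_linorder dist_real_def)
qed

lemma bounded_and_convergentI:
  assumes cont: "continuous_on {0..} g" and lim: "(g \<longlongrightarrow> L) at_top"
  shows "bounded_and_convergent g"
proof -
  obtain T where T: "\<And>t. t \<ge> T \<Longrightarrow> dist (g t) L < 1"
    using tendstoD[OF lim, of 1] by (auto simp: eventually_at_top_linorder)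
  have "compact (g ` {0..max 0 T})"
    by (rule compact_continuous_image[OF continuous_on_subset[OF cont]]) auto
  moreover have "g ` {0..} \<subseteq> g ` {0..max 0 T} \<union> cball L 1"
  proof
    fix y assume "y \<in> g ` {0..}"
    then obtain t where "t \<ge> 0" "y = g t" by auto
    then show "y \<in> g ` {0..max 0 T} \<union> cball L 1"
      using less_imp_le[OF T[of t]] by (cases "t \<le> max 0 T") (auto simp: dist_commute)
  qed
  ultimately have "bounded (g ` {0..})"
    by (meson bounded_Un bounded_cball bounded_subset compact_imp_bounded)
  then show ?thesis using lim by (auto simp: bounded_and_convergent_def)
qed

section \<open>Global solutions of ordinary differential equations\<close>

lemma integral_has_vector_derivative_halfline:
  fixes f :: "real \<Rightarrow> 'a::banach"
  assumes "continuous_on {0..} f" "t \<ge> 0"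
  shows "((\<lambda>u. integral {0..u} f) has_vector_derivative f t) (at t within {0..})"
proof -
  have "((\<lambda>u. integral {0..u} f) has_vector_derivative f t) (at t within {0..t + 1})"
    using assms by (intro integral_has_vector_derivative continuous_on_subset[OF assms(1)]) auto
  moreover have "at t within {0..t + 1} = at t within {0..}"
    by (rule at_within_nhd[of t "{..<t + 1}"]) auto
  ultimately show ?thesis by simp
qed

lemma continuous_on_compose_lipschitz_family:
  fixes F :: "real \<Rightarrow> 'a::real_normed_vector \<Rightarrow> 'b::real_normed_vector"
  assumes lip: "\<And>t x y. t \<in> S \<Longrightarrow> norm (F t x - F t y) \<le> L * norm (x - y)"
    and cont: "\<And>x. continuous_on S (\<lambda>t. F t x)" and v: "continuous_on S v"
  shows "continuous_on S (\<lambda>t. F t (v t))"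
  unfolding continuous_on_def
proof
  fix s assume s: "s \<in> S"
  have "((\<lambda>t. F t (v t) - F t (v s)) \<longlongrightarrow> 0) (at s within S)"
  proof (rule Lim_null_comparison)
    show "eventually (\<lambda>t. norm (F t (v t) - F t (v s)) \<le> L * norm (v t - v s)) (at s within S)"
      using lip by (auto simp: eventually_at_filter)
    have "((\<lambda>t. v t - v s) \<longlongrightarrow> v s - v s) (at s within S)"
      using v s by (intro tendsto_diff) (auto simp: continuous_on_def)
    then show "((\<lambda>t. L * norm (v t - v s)) \<longlongrightarrow> 0) (at s within S)"
      by (intro tendsto_mult_right_zero tendsto_norm_zero) simp
  qed
  moreover have "((\<lambda>t. F t (v s)) \<longlongrightarrow> F s (v s)) (at s within S)"
    using cont s by (auto simp: continuous_on_def)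
  ultimately have "((\<lambda>t. (F t (v t) - F t (v s)) + F t (v s)) \<longlongrightarrow> 0 + F s (v s)) (at s within S)"
    by (rule tendsto_add)
  then show "((\<lambda>t. F t (v t)) \<longlongrightarrow> F s (v s)) (at s within S)" by simp
qed

text \<open>The estimate behind the weighted norm below: integrating a function of size \<open>exp (K \<tau>)\<close> gains a
factor \<open>1 / K\<close> relative to the same weight.\<close>

lemma norm_integral_exp_bound:
  fixes f :: "real \<Rightarrow> 'a::banach"
  assumes f: "continuous_on {0..} f" and K: "K > 0" and t: "t \<ge> 0" and C: "C \<ge> 0"
    and bound: "\<And>\<tau>. \<tau> \<ge> 0 \<Longrightarrow> norm (f \<tau>) \<le> C * exp (K * \<tau>)"
  shows "norm (integral {0..t} f) \<le> C / K * exp (K * t)"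
proof -
  have "((\<lambda>\<tau>. C * exp (K * \<tau>)) has_integral C / K * exp (K * t) - C / K * exp (K * 0)) {0..t}"
    using K t
    by (intro fundamental_theorem_of_calculus)
      (auto intro!: derivative_eq_intros simp: has_real_derivative_iff_has_vector_derivative[symmetric])
  then have "(\<lambda>\<tau>. C * exp (K * \<tau>)) integrable_on {0..t}"
    and "integral {0..t} (\<lambda>\<tau>. C * exp (K * \<tau>)) = C / K * exp (K * t) - C / K"
    by (auto simp: has_integral_integrable_integral)
  moreover have "f integrable_on {0..t}"
    by (intro integrable_continuous_real continuous_on_subset[OF f]) auto
  ultimately have "norm (integral {0..t} f) \<le> C / K * exp (K * t) - C / K"
    using bound integral_norm_bound_integral[of f "{0..t}" "\<lambda>\<tau>. C * exp (K * \<tau>)"] by auto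
  then show ?thesis using C K by (smt (verit) divide_nonneg_pos)
qed

text \<open>Picard iteration in the weighted variable \<open>v t = exp (- K t) u t\<close> with \<open>K = 2 L\<close>: for bounded
continuous \<open>v\<close> it is a contraction with factor \<open>1/2\<close> on the entire half line, so its
fixed point is the solution for all times at once.\<close>

theorem lipschitz_ode_has_solution:
  fixes F :: "real \<Rightarrow> 'a::banach \<Rightarrow> 'a"
  assumes lip: "\<And>t x y. t \<ge> 0 \<Longrightarrow> norm (F t x - F t y) \<le> L * norm (x - y)"
    and cont: "\<And>x. continuous_on {0..} (\<lambda>t. F t x)"
    and bound: "\<And>t. t \<ge> 0 \<Longrightarrow> norm (F t 0) \<le> A" and "L > 0"
  obtains u where "u 0 = u0"
    "\<And>t. t \<ge> 0 \<Longrightarrow> (u has_vector_derivative F t (u t)) (at t within {0..})"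
proof -
  define K where "K = 2 * L"
  have K: "K > 0" using \<open>L > 0\<close> by (simp add: K_def)
  have A: "A \<ge> 0" using order_trans[OF norm_ge_zero bound[of 0]] by simp
  define N where "N v \<tau> = F \<tau> (exp (K * \<tau>) *\<^sub>R apply_bcontfun v \<tau>)" for v :: "real \<Rightarrow>\<^sub>C 'a" and \<tau>
  have N_cont: "continuous_on {0..} (N v)" for v
    unfolding N_def
    by (rule continuous_on_compose_lipschitz_family[where L=L])
      (use lip cont in \<open>auto intro!: continuous_intros\<close>)
  have int_deriv: "((\<lambda>u. integral {0..u} (N v)) has_vector_derivative N v t) (at t within {0..})"
    if "t \<ge> 0" for v t
    by (rule integral_has_vector_derivative_halfline[OF N_cont that])
  have N_bound: "norm (N v \<tau>) \<le> (A + L * norm v) * exp (K * \<tau>)" if "\<tau> \<ge> 0" for v \<tau>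
  proof -
    have "norm (N v \<tau>) \<le> norm (F \<tau> 0) + L * (exp (K * \<tau>) * norm (apply_bcontfun v \<tau>))"
      using lip[OF that, of "exp (K * \<tau>) *\<^sub>R apply_bcontfun v \<tau>" 0]
        norm_triangle_ineq2[of "N v \<tau>" "F \<tau> 0"] by (simp add: N_def)
    also have "\<dots> \<le> A * exp (K * \<tau>) + L * (exp (K * \<tau>) * norm v)"
      using bound[OF that] A \<open>L > 0\<close> K that norm_bounded[of v \<tau>]
        mult_left_mono[of 1 "exp (K * \<tau>)" A]
      by (intro add_mono mult_left_mono) (auto intro: order_trans)
    finally show ?thesis by (simp add: algebra_simps)
  qed
  \<comment> \<open>Bounded continuous functions live on all of the reals; negative times carry the value at 0.\<close>
  define \<Phi> where "\<Phi> v t = exp (- K * max 0 t) *\<^sub>R (u0 + integral {0..max 0 t} (N v))" for v t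
  have cont_pos: "continuous_on {0..} (\<lambda>t. integral {0..t} (N v))" for v
    using int_deriv by (auto simp: continuous_on_eq_continuous_within intro!: has_vector_derivative_continuous)
  have \<Phi>_mem: "\<Phi> v \<in> bcontfun" for v
  proof (rule bcontfun_normI)
    have "continuous_on UNIV (\<lambda>t. integral {0..max 0 t} (N v))"
      by (rule continuous_on_compose2[OF cont_pos]) (auto intro!: continuous_intros)
    then show "continuous_on UNIV (\<Phi> v)" unfolding \<Phi>_def by (intro continuous_intros)
    fix t :: real
    define s where "s = max 0 t"
    have "s \<ge> 0" by (simp add: s_def)
    have "norm (integral {0..s} (N v)) \<le> (A + L * norm v) / K * exp (K * s)"
      using A \<open>L > 0\<close> by (intro norm_integral_exp_bound[OF N_cont K \<open>s \<ge> 0\<close>] N_bound) auto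
    then have "norm (u0 + integral {0..s} (N v)) \<le> norm u0 + (A + L * norm v) / K * exp (K * s)"
      using norm_triangle_ineq[of u0 "integral {0..s} (N v)"] by linarith
    then have "norm (\<Phi> v t) \<le> exp (- K * s) * (norm u0 + (A + L * norm v) / K * exp (K * s))"
      unfolding \<Phi>_def s_def[symmetric] by simp
    also have "\<dots> = exp (- K * s) * norm u0 + (A + L * norm v) / K"
      by (simp add: distrib_left exp_minus)
    also have "\<dots> \<le> 1 * norm u0 + (A + L * norm v) / K"
      using K \<open>s \<ge> 0\<close> by (intro add_mono mult_right_mono) auto
    finally show "norm (\<Phi> v t) \<le> 1 * norm u0 + (A + L * norm v) / K" .
  qed
  have contraction: "dist (Bcontfun (\<Phi> v)) (Bcontfun (\<Phi> w)) \<le> 1 / 2 * dist v w" for v w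
  proof (rule dist_bound)
    fix t :: real
    define s where "s = max 0 t"
    have s: "s \<ge> 0" by (simp add: s_def)
    have "norm (integral {0..s} (\<lambda>\<tau>. N v \<tau> - N w \<tau>)) \<le> (L * dist v w) / K * exp (K * s)"
    proof (rule norm_integral_exp_bound[OF _ K s])
      fix \<tau> :: real assume "\<tau> \<ge> 0"
      then have "norm (N v \<tau> - N w \<tau>) \<le>
          L * (exp (K * \<tau>) * dist (apply_bcontfun v \<tau>) (apply_bcontfun w \<tau>))"
        unfolding N_def using lip[of \<tau> "exp (K * \<tau>) *\<^sub>R apply_bcontfun v \<tau>" "exp (K * \<tau>) *\<^sub>R apply_bcontfun w \<tau>"]
        by (simp add: dist_norm scaleR_diff_right[symmetric])
      also have "\<dots> \<le> L * (exp (K * \<tau>) * dist v w)"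
        using \<open>L > 0\<close> dist_bounded[of v \<tau> w] by (intro mult_left_mono) auto
      finally show "norm (N v \<tau> - N w \<tau>) \<le> L * dist v w * exp (K * \<tau>)" by (simp add: mult_ac)
    qed (use \<open>L > 0\<close> N_cont in \<open>auto intro!: continuous_intros\<close>)
    moreover have "integral {0..s} (\<lambda>\<tau>. N v \<tau> - N w \<tau>) = integral {0..s} (N v) - integral {0..s} (N w)"
      by (intro integral_diff integrable_continuous_real continuous_on_subset[OF N_cont]) auto
    ultimately have "norm (integral {0..s} (N v) - integral {0..s} (N w)) \<le> 1 / 2 * dist v w * exp (K * s)"
      using \<open>L > 0\<close> by (simp add: K_def)
    then have "exp (- K * s) * norm (integral {0..s} (N v) - integral {0..s} (N w))
        \<le> exp (- K * s) * (1 / 2 * dist v w * exp (K * s))"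
      by (intro mult_left_mono) auto
    also have "\<dots> = 1 / 2 * dist v w" by (simp add: exp_minus)
    finally show "dist (apply_bcontfun (Bcontfun (\<Phi> v)) t) (apply_bcontfun (Bcontfun (\<Phi> w)) t)
        \<le> 1 / 2 * dist v w"
      by (simp add: Bcontfun_inverse[OF \<Phi>_mem])
        (simp add: \<Phi>_def s_def[symmetric] dist_norm scaleR_diff_right[symmetric])
  qed
  obtain v where "Bcontfun (\<Phi> v) = v"
    using banach_fix_type[of "1 / 2" "\<lambda>v. Bcontfun (\<Phi> v)"] contraction by auto
  then have v: "apply_bcontfun v = \<Phi> v" by (metis Bcontfun_inverse[OF \<Phi>_mem])
  define u where "u t = u0 + integral {0..t} (N v)" for t
  have N_v: "N v t = F t (u t)" if "t \<ge> 0" for t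
    using that by (simp add: N_def v) (simp add: \<Phi>_def u_def exp_minus max_def)
  show ?thesis
  proof
    show "u 0 = u0" by (simp add: u_def)
    show "(u has_vector_derivative F t (u t)) (at t within {0..})" if "t \<ge> 0" for t
      unfolding u_def[abs_def] using int_deriv[OF that, of v] N_v[OF that]
      by (auto simp: u_def intro!: derivative_eq_intros)
  qed
qed

text \<open>Lets spaces of bounded functions serve as state spaces in \<open>lipschitz_ode_has_solution\<close>.\<close>

instance bcontfun :: (metric_space, banach) banach ..

text \<open>For systems whose number of components is a value and not a type, such as a player's state: the state
space consists of the bounded functions on a discrete copy of the index type, with the components
outside \<open>I\<close> kept at zero.\<close>

lemma finite_system_has_solution:
  fixes \<Phi> :: "real \<Rightarrow> ('k \<Rightarrow> real) \<Rightarrow> 'k \<Rightarrow> real"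
  assumes lip: "\<And>t x y k. t \<ge> 0 \<Longrightarrow> k \<in> I \<Longrightarrow> \<bar>\<Phi> t x k - \<Phi> t y k\<bar> \<le> L * (\<Sum>q\<in>I. \<bar>x q - y q\<bar>)"
    and cont: "\<And>x k. k \<in> I \<Longrightarrow> continuous_on {0..} (\<lambda>t. \<Phi> t x k)"
    and bound: "\<And>t k. t \<ge> 0 \<Longrightarrow> k \<in> I \<Longrightarrow> \<bar>\<Phi> t (\<lambda>_. 0) k\<bar> \<le> A"
    and L: "L > 0" and I: "finite I" "I \<noteq> {}"
  obtains x where "\<And>k. k \<in> I \<Longrightarrow> x 0 k = x0 k"
    "\<And>t k. t \<ge> 0 \<Longrightarrow> k \<in> I \<Longrightarrow> ((\<lambda>s. x s k) has_real_derivative \<Phi> t (x t) k) (at t within {0..})"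
proof -
  define G where "G h = (\<lambda>d. if of_discrete d \<in> I then h (of_discrete d) else 0)" for h :: "'k \<Rightarrow> real"
  have G_mem: "G h \<in> bcontfun" for h
  proof (rule bcontfun_normI)
    show "continuous_on UNIV (G h)" by (simp add: continuous_on_open_vimage open_discrete)
    show "norm (G h d) \<le> (\<Sum>q\<in>I. \<bar>h q\<bar>)" for d
      using I by (auto simp: G_def sum_nonneg intro: member_le_sum)
  qed
  define co where "co X k = apply_bcontfun X (discrete k)" for X :: "'k discrete \<Rightarrow>\<^sub>C real" and k
  have co_G: "co (Bcontfun (G h)) k = (if k \<in> I then h k else 0)" for h k
    using Bcontfun_inverse[OF G_mem] by (simp add: co_def G_def discrete_inverse)
  have co_diff: "co (X - Y) k = co X k - co Y k" for X Y k by (simp add: co_def)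
  have co_le: "\<bar>co X k\<bar> \<le> norm X" for X k
    using norm_bounded[of X "discrete k"] by (simp add: co_def)
  have norm_le: "norm X \<le> b" if "\<And>k. \<bar>co X k\<bar> \<le> b" for X b
    by (rule norm_bound) (use that in \<open>metis co_def of_discrete_inverse real_norm_def\<close>)
  have co_linear: "bounded_linear (\<lambda>X. co X k)" for k
    by (rule bounded_linear_intro[where K=1]) (use co_le in \<open>auto simp: co_def\<close>)
  define F where "F t X = Bcontfun (G (\<Phi> t (co X)))" for t X
  have co_F: "co (F t X) k = (if k \<in> I then \<Phi> t (co X) k else 0)" for t X k
    by (simp add: F_def co_G)
  have sum_le: "(\<Sum>q\<in>I. \<bar>co X q - co Y q\<bar>) \<le> real (card I) * norm (X - Y)" for X Y
  proof -
    have "(\<Sum>q\<in>I. \<bar>co X q - co Y q\<bar>) \<le> (\<Sum>q\<in>I. norm (X - Y))"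
      using co_le[of "X - Y"] by (intro sum_mono) (simp add: co_diff)
    then show ?thesis by simp
  qed
  obtain k0 where "k0 \<in> I" using I(2) by blast
  then have A: "A \<ge> 0" using order_trans[OF abs_ge_zero bound[of 0 k0]] by simp
  obtain u where u0: "u 0 = Bcontfun (G x0)"
    and u: "\<And>t. t \<ge> 0 \<Longrightarrow> (u has_vector_derivative F t (u t)) (at t within {0..})"
  proof (rule lipschitz_ode_has_solution[of F "L * real (card I)" A])
    show "norm (F t X - F t Y) \<le> L * real (card I) * norm (X - Y)" if "t \<ge> 0" for t X Y
    proof (rule norm_le)
      fix k
      have "\<bar>co (F t X - F t Y) k\<bar> \<le> L * (\<Sum>q\<in>I. \<bar>co X q - co Y q\<bar>)"
        using lip[OF \<open>t \<ge> 0\<close>, of k] L by (auto simp: co_diff co_F sum_nonneg)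
      also have "\<dots> \<le> L * (real (card I) * norm (X - Y))"
        using L sum_le by (intro mult_left_mono) auto
      finally show "\<bar>co (F t X - F t Y) k\<bar> \<le> L * real (card I) * norm (X - Y)" by simp
    qed
    show "continuous_on {0..} (\<lambda>t. F t X)" for X
      unfolding continuous_on_iff
    proof (intro ballI allI impI)
      fix s e :: real assume s: "s \<in> {0..}" and "e > 0"
      have "eventually (\<lambda>t. \<forall>k\<in>I. dist (\<Phi> t (co X) k) (\<Phi> s (co X) k) < e / 2) (at s within {0..})"
        using cont s \<open>e > 0\<close> I
        by (intro eventually_ball_finite ballI tendstoD) (auto simp: continuous_on_def)
      then obtain d where d: "d > 0" "\<And>t k. t \<in> {0..} \<Longrightarrow> t \<noteq> s \<Longrightarrow> dist t s < d \<Longrightarrow> k \<in> I \<Longrightarrow>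
          dist (\<Phi> t (co X) k) (\<Phi> s (co X) k) < e / 2"
        unfolding eventually_at by blast
      have "dist (F t X) (F s X) \<le> e / 2" if "t \<in> {0..}" "dist t s < d" for t
        unfolding dist_norm
      proof (rule norm_le)
        fix k
        have "co (F s X - F s X) k = 0" by (simp add: co_def)
        then show "\<bar>co (F t X - F s X) k\<bar> \<le> e / 2"
          using d(2)[OF that(1) _ that(2), of k] \<open>e > 0\<close>
          by (cases "t = s") (auto simp: co_diff co_F dist_real_def)
      qed
      then show "\<exists>d>0. \<forall>t\<in>{0..}. dist t s < d \<longrightarrow> dist (F t X) (F s X) < e"
        using d(1) \<open>e > 0\<close> by (intro exI[of _ d]) force
    qed
    have "co 0 = (\<lambda>_. 0)" by (auto simp: co_def)
    then show "norm (F t 0) \<le> A" if "t \<ge> 0" for t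
      using bound[OF that] A by (intro norm_le) (auto simp: co_F)
  qed (use L I in \<open>auto simp: card_gt_0_iff\<close>)
  show ?thesis
  proof
    show "co (u 0) k = x0 k" if "k \<in> I" for k using that u0 by (simp add: co_G)
    show "((\<lambda>s. co (u s) k) has_real_derivative \<Phi> t (co (u t)) k) (at t within {0..})"
      if "t \<ge> 0" "k \<in> I" for t k
      using bounded_linear.has_vector_derivative[OF co_linear u[OF that(1)], of k] that
      by (simp add: co_F has_real_derivative_iff_has_vector_derivative)
  qed
qed

text \<open>Composing \<open>F\<close> with the nearest-point map onto a ball of radius larger than \<open>B\<close> makes it globally
Lipschitz. Up to the first time its solution reaches the boundary of the ball it also solves the
original equation and hence obeys the a priori bound, so that time never comes.\<close>

theorem bounded_ode_has_solution:
  fixes F :: "'a::euclidean_space \<Rightarrow> 'a"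
  assumes lip: "\<And>M. M > 0 \<Longrightarrow> \<exists>L. L-lipschitz_on (cball 0 M) F"
    and u0_le: "norm u0 \<le> B"
    and apriori: "\<And>T u. T \<ge> 0 \<Longrightarrow> u 0 = u0 \<Longrightarrow>
      (\<And>t. t \<in> {0..T} \<Longrightarrow> (u has_vector_derivative F (u t)) (at t within {0..T})) \<Longrightarrow>
      norm (u T) \<le> B"
  obtains u where "u 0 = u0"
    "\<And>t. t \<ge> 0 \<Longrightarrow> (u has_vector_derivative F (u t)) (at t within {0..})"
proof -
  define M where "M = \<bar>B\<bar> + 1"
  obtain L0 where L0: "L0-lipschitz_on (cball 0 M) F" using lip[of M] unfolding M_def by force
  define L where "L = L0 + 1"
  have L: "L-lipschitz_on (cball 0 M) F" "L > 0"
    using lipschitz_on_nonneg[OF L0] lipschitz_on_mono[OF L0] by (auto simp: L_def)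
  let ?P = "closest_point (cball (0::'a) M)"
  have P_mem: "?P x \<in> cball 0 M" for x
    by (rule closest_point_in_set) (auto simp: M_def)
  obtain u where u0: "u 0 = u0"
    and u: "\<And>t. t \<ge> 0 \<Longrightarrow> (u has_vector_derivative F (?P (u t))) (at t within {0..})"
  proof (rule lipschitz_ode_has_solution[of "\<lambda>t x. F (?P x)" L "norm (F (?P 0))"])
    show "norm (F (?P x) - F (?P y)) \<le> L * norm (x - y)" for x y
    proof -
      have "norm (F (?P x) - F (?P y)) \<le> L * norm (?P x - ?P y)"
        using lipschitz_on_normD[OF L(1)] P_mem by blast
      also have "norm (?P x - ?P y) \<le> norm (x - y)"
        using closest_point_lipschitz[of "cball (0::'a) M" x y] by (simp add: M_def dist_norm)
      finally show ?thesis using L(2) by simp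
    qed
  qed (use L in auto)
  have u_cont: "continuous_on {0..} u"
    using u by (auto simp: continuous_on_eq_continuous_within intro!: has_vector_derivative_continuous)
  have apriori': "norm (u T) \<le> B" if "T \<ge> 0" and le: "\<And>t. t \<in> {0..T} \<Longrightarrow> norm (u t) \<le> M" for T
  proof (rule apriori[of T u, OF that(1) u0])
    show "(u has_vector_derivative F (u t)) (at t within {0..T})" if "t \<in> {0..T}" for t
      using u[of t] le[OF that] that closest_point_self[of "u t" "cball 0 M"]
      by (auto intro: has_vector_derivative_within_subset)
  qed
  have inside: "norm (u t) < M" if "t \<ge> 0" for t
  proof (rule ccontr)
    assume "\<not> norm (u t) < M"
    define Z where "Z = {s \<in> {0..t}. M \<le> norm (u s)}"
    have "closed Z" unfolding Z_def
      by (intro continuous_on_closed_Collect_le continuous_intros continuous_on_subset[OF u_cont]) auto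
    then have "compact Z"
      by (intro compact_eq_bounded_closed[THEN iffD2] conjI bounded_subset[of "{0..t}" Z]) (auto simp: Z_def)
    moreover have "t \<in> Z" using that \<open>\<not> norm (u t) < M\<close> by (simp add: Z_def)
    ultimately obtain T where T: "T \<in> Z" "\<And>s. s \<in> Z \<Longrightarrow> T \<le> s"
      using compact_attains_inf[of Z] by blast
    have "norm (u s) \<le> M" if "s \<in> {0..T}" for s
    proof (rule ccontr)
      assume "\<not> norm (u s) \<le> M"
      have "\<exists>r. 0 \<le> r \<and> r \<le> s \<and> norm (u r) = M"
      proof (rule IVT')
        show "norm (u 0) \<le> M" using u0 u0_le by (simp add: M_def)
        show "M \<le> norm (u s)" using \<open>\<not> norm (u s) \<le> M\<close> by simp
        show "continuous_on {0..s} (\<lambda>r. norm (u r))"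
          by (intro continuous_on_norm continuous_on_subset[OF u_cont]) auto
      qed (use that in auto)
      then obtain r where r: "0 \<le> r" "r \<le> s" "norm (u r) = M" by blast
      then have "r \<in> Z" using that T(1) by (auto simp: Z_def)
      then have "T \<le> r" by (rule T(2))
      then have "r = s" using r that by auto
      then show False using r \<open>\<not> norm (u s) \<le> M\<close> by simp
    qed
    then have "norm (u T) \<le> B" using apriori' T(1) by (simp add: Z_def)
    moreover have "\<bar>B\<bar> + 1 \<le> norm (u T)" using T(1) by (simp add: Z_def M_def)
    ultimately show False by linarith
  qed
  show ?thesis
  proof
    show "(u has_vector_derivative F (u t)) (at t within {0..})" if "t \<ge> 0" for t
      using u[OF that] inside[OF that] closest_point_self[of "u t" "cball 0 M"] by simp
  qed (rule u0)
qed

section \<open>Weighted coercivity of the pinned Laplacian\<close>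

lemma norm_square_vec: "(norm v)\<^sup>2 = (\<Sum>i\<in>UNIV. (v $ i)\<^sup>2)" for v :: "real ^ 'n::finite"
  by (simp add: norm_vec_def L2_set_def sum_nonneg)

text \<open>The Laplacian of the weights \<open>a\<close> plus the diagonal of the pinning gains \<open>a i j\<close> that attach the network
to a leader \<open>j\<close>, applied to \<open>v\<close>.\<close>

definition pinned_laplacian :: "('n::finite \<Rightarrow> 'n \<Rightarrow> real) \<Rightarrow> 'n \<Rightarrow> ('n \<Rightarrow> real) \<Rightarrow> 'n \<Rightarrow> real" where
  "pinned_laplacian a j v i = (\<Sum>k\<in>UNIV. a i k * (v i - v k)) + a i j * v i"

text \<open>\<open>p\<close> is a positive left null vector of the Laplacian. Constants are in the kernel, so some \<open>q \<noteq> 0\<close>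
is a left null vector. Passing to absolute values gives inequalities \<open>\<bar>q\<^sub>k\<bar> d\<^sub>k \<le> \<Sum>\<^sub>i \<bar>q\<^sub>i\<bar> a\<^sub>i\<^sub>k\<close> whose
two sides have the same total over \<open>k\<close>, so they are equalities. A zero of \<open>\<bar>q\<bar>\<close> would spread along
all edges, hence to every node.\<close>

lemma exists_balancing_weights:
  fixes a :: "'n::finite \<Rightarrow> 'n \<Rightarrow> real"
  assumes weights: "weights_of_digraph E a" and conn: "strongly_connected E"
  obtains p where "\<And>i. p i > 0" "\<And>k. (\<Sum>j\<in>UNIV. p k * a k j) = (\<Sum>i\<in>UNIV. p i * a i k)"
proof -
  have a_nonneg: "a i k \<ge> 0" for i k using weights unfolding weights_of_digraph_def by (metis less_eq_real_def)
  have a_pos: "a k i > 0" if "(i, k) \<in> E" for i k using weights that by (auto simp: weights_of_digraph_def)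
  define d where "d k = (\<Sum>j\<in>UNIV. a k j)" for k
  define L :: "real^'n^'n" where "L = (\<chi> i k. (if i = k then d i else 0) - a i k)"
  have "L *v 1 = 0"
    by (simp add: L_def d_def matrix_vector_mult_def Finite_Cartesian_Product.vec_eq_iff sum_subtractf zero_vec_def)
  then have not_inv: "\<not> (\<exists>B. B ** L = Finite_Cartesian_Product.mat 1)"
    unfolding matrix_left_invertible_ker using zero_neq_one by metis
  have "\<not> (\<forall>x. Finite_Cartesian_Product.transpose L *v x = 0 \<longrightarrow> x = 0)"
  proof
    assume "\<forall>x. Finite_Cartesian_Product.transpose L *v x = 0 \<longrightarrow> x = 0"
    then obtain B where "B ** Finite_Cartesian_Product.transpose L = Finite_Cartesian_Product.mat 1" unfolding matrix_left_invertible_ker[symmetric] by blast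
    then have "Finite_Cartesian_Product.transpose (B ** Finite_Cartesian_Product.transpose L) = Finite_Cartesian_Product.mat 1" by (simp add: Finite_Cartesian_Product.transpose_mat)
    then have "L ** Finite_Cartesian_Product.transpose B = Finite_Cartesian_Product.mat 1" by (simp add: matrix_transpose_mul)
    then show False using not_inv matrix_left_right_inverse by blast
  qed
  then obtain q where q: "Finite_Cartesian_Product.transpose L *v q = 0" "q \<noteq> 0" by blast
  have q_eq: "q $ k * d k = (\<Sum>i\<in>UNIV. q $ i * a i k)" for k
  proof -
    have "0 = (Finite_Cartesian_Product.transpose L *v q) $ k" using q(1) by simp
    also have "\<dots> = (\<Sum>i\<in>UNIV. (if i = k then d i * q $ i else 0) - a i k * q $ i)"
      unfolding matrix_vector_mult_def Finite_Cartesian_Product.transpose_def L_def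
      by (auto intro!: sum.cong simp: left_diff_distrib)
    also have "\<dots> = d k * q $ k - (\<Sum>i\<in>UNIV. a i k * q $ i)"
      by (simp add: sum_subtractf)
    finally show ?thesis by (simp add: mult.commute)
  qed
  define p where "p i = \<bar>q $ i\<bar>" for i
  have p_nonneg: "p i \<ge> 0" for i by (simp add: p_def)
  have p_le: "p k * d k \<le> (\<Sum>i\<in>UNIV. p i * a i k)" for k
  proof -
    have "p k * d k = \<bar>q $ k * d k\<bar>"
      using a_nonneg by (simp add: p_def abs_mult d_def sum_nonneg)
    also have "\<dots> \<le> (\<Sum>i\<in>UNIV. p i * a i k)"
      unfolding q_eq using a_nonneg
      by (intro order_trans[OF sum_abs] sum_mono) (simp add: p_def abs_mult)
    finally show ?thesis .
  qed
  have "(\<Sum>k\<in>UNIV. (\<Sum>i\<in>UNIV. p i * a i k)) = (\<Sum>i\<in>UNIV. \<Sum>k\<in>UNIV. p i * a i k)"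
    by (rule sum.swap)
  then have "(\<Sum>k\<in>UNIV. (\<Sum>i\<in>UNIV. p i * a i k) - p k * d k) = 0"
    by (simp add: sum_subtractf d_def sum_distrib_left)
  then have "\<forall>k\<in>UNIV. (\<Sum>i\<in>UNIV. p i * a i k) - p k * d k = 0"
    using p_le by (subst (asm) sum_nonneg_eq_0_iff) auto
  then have p_eq: "p k * d k = (\<Sum>i\<in>UNIV. p i * a i k)" for k by simp
  have zero_step: "p i = 0" if "p k = 0" "(k, i) \<in> E" for k i
  proof -
    have "(\<Sum>i\<in>UNIV. p i * a i k) = 0" using p_eq[of k] that(1) by simp
    then have "p i * a i k = 0"
      using p_nonneg a_nonneg by (subst (asm) sum_nonneg_eq_0_iff) auto
    then show ?thesis using a_pos[OF that(2)] by simp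
  qed
  have zero_path: "p k = 0 \<longrightarrow> p i = 0" if "(k, i) \<in> E\<^sup>+" for k i
    using that by (induction rule: trancl_induct) (auto dest: zero_step)
  have "p i \<noteq> 0" for i
  proof
    assume "p i = 0"
    then have "p k = 0" for k
      using zero_path[of i k] conn by (cases "k = i") (auto simp: strongly_connected_def)
    then show False using q(2) by (simp add: p_def Finite_Cartesian_Product.vec_eq_iff)
  qed
  then have "p i > 0" for i using p_nonneg[of i] by (simp add: order_le_less)
  then show ?thesis using that[of p] p_eq by (simp add: d_def sum_distrib_left)
qed

lemma positive_quadratic_coercive:
  fixes Q :: "'a::euclidean_space \<Rightarrow> real"
  assumes cont: "continuous_on UNIV Q" and hom: "\<And>c v. Q (c *\<^sub>R v) = c\<^sup>2 * Q v"
    and pos: "\<And>v. v \<noteq> 0 \<Longrightarrow> Q v > 0"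
  obtains \<mu> where "\<mu> > 0" "\<And>v. \<mu> * (norm v)\<^sup>2 \<le> Q v"
proof -
  obtain u where u: "u \<in> sphere 0 1" "\<And>v. v \<in> sphere 0 1 \<Longrightarrow> Q u \<le> Q v"
    using continuous_attains_inf[of "sphere (0::'a) 1" Q] continuous_on_subset[OF cont]
    by (auto simp: sphere_eq_empty)
  have "Q u * (norm v)\<^sup>2 \<le> Q v" for v
  proof (cases "v = 0")
    case True
    then show ?thesis using hom[of 0 0] by simp
  next
    case False
    have "Q u * (norm v)\<^sup>2 \<le> Q (sgn v) * (norm v)\<^sup>2"
      using u(2)[of "sgn v"] False by (intro mult_right_mono) (auto simp: norm_sgn)
    also have "\<dots> = Q v"
      using hom[of "norm v" "sgn v"] False by (simp add: sgn_div_norm)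
    finally show ?thesis .
  qed
  moreover have "Q u > 0" using u(1) by (intro pos) auto
  ultimately show ?thesis using that by blast
qed

text \<open>Balance is exactly what makes the weighted form of the directed Laplacian a sum of squares.\<close>

lemma balanced_laplacian_form:
  fixes a :: "'n::finite \<Rightarrow> 'n \<Rightarrow> real"
  assumes "\<And>k. (\<Sum>j\<in>UNIV. p k * a k j) = (\<Sum>i\<in>UNIV. p i * a i k)"
  shows "(\<Sum>i\<in>UNIV. p i * v i * pinned_laplacian a j v i) =
    (\<Sum>i\<in>UNIV. \<Sum>k\<in>UNIV. p i * a i k * (v i - v k)\<^sup>2) / 2 + (\<Sum>i\<in>UNIV. p i * a i j * (v i)\<^sup>2)"
proof -
  let ?A = "\<Sum>i\<in>UNIV. \<Sum>k\<in>UNIV. p i * a i k * (v i)\<^sup>2"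
  let ?B = "\<Sum>i\<in>UNIV. \<Sum>k\<in>UNIV. p i * a i k * (v i * v k)"
  let ?C = "\<Sum>i\<in>UNIV. \<Sum>k\<in>UNIV. p i * a i k * (v k)\<^sup>2"
  have "?C = (\<Sum>k\<in>UNIV. (\<Sum>i\<in>UNIV. p i * a i k) * (v k)\<^sup>2)"
    by (subst sum.swap) (simp add: sum_distrib_right)
  also have "\<dots> = ?A"
    unfolding assms[symmetric] by (simp add: sum_distrib_right)
  finally have "?C = ?A" .
  moreover have "(\<Sum>i\<in>UNIV. \<Sum>k\<in>UNIV. p i * a i k * (v i - v k)\<^sup>2) = ?A - 2 * ?B + ?C"
    by (simp add: sum_distrib_left sum_subtractf[symmetric] sum.distrib[symmetric])
      (intro sum.cong refl, simp add: power2_eq_square algebra_simps)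
  moreover have "(\<Sum>i\<in>UNIV. p i * v i * pinned_laplacian a j v i)
      = ?A - ?B + (\<Sum>i\<in>UNIV. p i * a i j * (v i)\<^sup>2)"
    unfolding pinned_laplacian_def
    by (simp add: sum_distrib_left sum_subtractf[symmetric] sum.distrib[symmetric] distrib_left)
      (intro sum.cong refl arg_cong2[where f="(+)"], auto simp: power2_eq_square algebra_simps)
  ultimately show ?thesis by simp
qed

text \<open>By \<open>balanced_laplacian_form\<close> the quadratic form vanishes only if \<open>v\<close> is constant along edges and zero at
the nodes attached to \<open>j\<close>. There is such a node because \<open>j\<close> has an outgoing edge, and strong
connectivity then forces \<open>v = 0\<close>. Compactness turns definiteness into a constant, and finitely many
\<open>j\<close> share one.\<close>

lemma pinned_laplacian_coercive:
  fixes a :: "'n::finite \<Rightarrow> 'n \<Rightarrow> real"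
  assumes card: "CARD('n) > 1"
    and weights: "weights_of_digraph E a" and conn: "strongly_connected E"
    and p: "\<And>i. p i > 0" "\<And>k. (\<Sum>j\<in>UNIV. p k * a k j) = (\<Sum>i\<in>UNIV. p i * a i k)"
  obtains \<mu> where "\<mu> > 0"
    "\<And>j v. \<mu> * (\<Sum>i\<in>UNIV. (v i)\<^sup>2) \<le> (\<Sum>i\<in>UNIV. p i * v i * pinned_laplacian a j v i)"
proof -
  have a_nonneg: "a i k \<ge> 0" for i k using weights unfolding weights_of_digraph_def by (metis less_eq_real_def)
  have a_pos: "a k i > 0" if "(i, k) \<in> E" for i k using weights that by (auto simp: weights_of_digraph_def)
  define Q where "Q j v = (\<Sum>i\<in>UNIV. p i * v i * pinned_laplacian a j v i)" for j v
  have Q_eq: "Q j v = (\<Sum>i\<in>UNIV. \<Sum>k\<in>UNIV. p i * a i k * (v i - v k)\<^sup>2) / 2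
      + (\<Sum>i\<in>UNIV. p i * a i j * (v i)\<^sup>2)" for j v
    unfolding Q_def by (rule balanced_laplacian_form[OF p(2)])
  have t1: "(\<Sum>i\<in>UNIV. \<Sum>k\<in>UNIV. p i * a i k * (v i - v k)\<^sup>2) \<ge> 0" for v
    using p(1) a_nonneg by (intro sum_nonneg) (simp add: less_imp_le)
  have t2: "(\<Sum>i\<in>UNIV. p i * a i j * (v i)\<^sup>2) \<ge> 0" for j v
    using p(1) a_nonneg by (intro sum_nonneg) (simp add: less_imp_le)
  have zero: "v = (\<lambda>_. 0)" if Q0: "Q j v \<le> 0" for j v
  proof -
    have z1: "(\<Sum>i\<in>UNIV. \<Sum>k\<in>UNIV. p i * a i k * (v i - v k)\<^sup>2) = 0"
      and z2: "(\<Sum>i\<in>UNIV. p i * a i j * (v i)\<^sup>2) = 0"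
      using Q0 t1[of v] t2[of j v] unfolding Q_eq by linarith+
    have edge: "v i = v k" if "(k, i) \<in> E" for i k
    proof -
      have "(\<Sum>k\<in>UNIV. p i * a i k * (v i - v k)\<^sup>2) = 0"
        using z1 p(1) a_nonneg
        by (subst (asm) sum_nonneg_eq_0_iff) (auto intro!: sum_nonneg simp: less_imp_le)
      then have "p i * a i k * (v i - v k)\<^sup>2 = 0"
        using p(1) a_nonneg by (subst (asm) sum_nonneg_eq_0_iff) (auto simp: less_imp_le)
      then show ?thesis using p(1)[of i] a_pos[OF that] by simp
    qed
    have path: "v i = v k" if "(k, i) \<in> E\<^sup>+" for i k
      using that by (induction rule: trancl_induct) (auto dest: edge)
    obtain i0 where "i0 \<noteq> j"
    proof (rule ccontr)
      assume "\<not> thesis"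
      then have "UNIV = {j}" using that by auto
      then have "CARD('n) = 1" by (metis card_1_singleton_iff One_nat_def)
      then show False using card by simp
    qed
    then have "(j, i0) \<in> E\<^sup>+" using conn by (auto simp: strongly_connected_def)
    then obtain i where i: "(j, i) \<in> E" by (blast dest: tranclD)
    have "p i * a i j * (v i)\<^sup>2 = 0"
      using z2 p(1) a_nonneg by (subst (asm) sum_nonneg_eq_0_iff) (auto simp: less_imp_le)
    then have "v i = 0" using p(1)[of i] a_pos[OF i] by simp
    then show ?thesis using path conn unfolding strongly_connected_def by metis
  qed
  have "\<exists>\<mu>>0. \<forall>v :: real ^ 'n. \<mu> * (norm v)\<^sup>2 \<le> Q j (($) v)" for j
  proof (rule positive_quadratic_coercive[of "\<lambda>v :: real ^ 'n. Q j (($) v)"])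
    show "continuous_on UNIV (\<lambda>v :: real ^ 'n. Q j (($) v))"
      unfolding Q_eq by (intro continuous_intros) simp
    show "Q j (($) (c *\<^sub>R v)) = c\<^sup>2 * Q j (($) v)" for c and v :: "real ^ 'n"
      unfolding Q_eq
      by (simp add: sum_distrib_left distrib_left right_diff_distrib[symmetric] power_mult_distrib mult_ac)
    show "Q j (($) v) > 0" if "v \<noteq> 0" for v :: "real ^ 'n"
      using zero[of j "($) v"] that by (metis Finite_Cartesian_Product.vec_eq_iff not_le zero_index)
  qed blast
  then obtain \<mu> where \<mu>: "\<And>j. \<mu> j > 0" "\<And>j (v :: real ^ 'n). \<mu> j * (norm v)\<^sup>2 \<le> Q j (($) v)"
    by metis
  show ?thesis
  proof
    show "Min (range \<mu>) > 0" using \<mu>(1) by simp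
    fix j and v :: "'n \<Rightarrow> real"
    have "Min (range \<mu>) * (\<Sum>i\<in>UNIV. (v i)\<^sup>2) \<le> \<mu> j * (\<Sum>i\<in>UNIV. (v i)\<^sup>2)"
      by (intro mult_right_mono sum_nonneg) auto
    also have "\<dots> \<le> Q j v" using \<mu>(2)[of j "\<chi> i. v i"] by (simp add: norm_square_vec vec_lambda_beta[abs_def])
    finally show "Min (range \<mu>) * (\<Sum>i\<in>UNIV. (v i)\<^sup>2)
        \<le> (\<Sum>i\<in>UNIV. p i * v i * pinned_laplacian a j v i)" by (simp add: Q_def)
  qed
qed

section \<open>Nash equilibria as zeros of the pseudo-gradient\<close>

lemma pseudo_gradient_nth: "pseudo_gradient f y $ i = partial_deriv i (f i) y"
  by (simp add: pseudo_gradient_def)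

lemma set_action_eq: "set_action y i s = y + (s - y $ i) *\<^sub>R axis i 1"
  by (auto simp: set_action_def Finite_Cartesian_Product.vec_eq_iff axis_def)

lemma set_action_set_action: "set_action (set_action y i s) i r = set_action y i r"
  by (auto simp: set_action_def Finite_Cartesian_Product.vec_eq_iff)

lemma set_action_nth: "set_action y i s $ i = s"
  by (simp add: set_action_def)

lemma set_action_same: "set_action y i (y $ i) = y"
  by (auto simp: set_action_def Finite_Cartesian_Product.vec_eq_iff)

lemma has_partial_deriv:
  assumes "continuously_differentiable g"
  shows "((\<lambda>s. g (set_action y i s)) has_real_derivative partial_deriv i g (set_action y i r)) (at r)"
proof -
  obtain g' where g': "\<And>y. GDERIV g y :> g' y"
    using assms by (auto simp: continuously_differentiable_def)
  have deriv: "((\<lambda>s. g (set_action y i s)) has_real_derivative axis i 1 \<bullet> g' (set_action y i r)) (at r)"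
    for y r
  proof -
    have "(set_action y i has_derivative (\<lambda>h. h *\<^sub>R axis i 1)) (at r)"
      unfolding set_action_eq[abs_def] by (auto intro!: derivative_eq_intros)
    moreover have "(g has_derivative (\<lambda>h. h \<bullet> g' (set_action y i r))) (at (set_action y i r))"
      using g' by (simp add: gderiv_def)
    ultimately have "((\<lambda>s. g (set_action y i s)) has_derivative
        (\<lambda>h. (h *\<^sub>R axis i 1) \<bullet> g' (set_action y i r))) (at r)"
      by (rule has_derivative_compose)
    then show ?thesis by (simp add: has_field_derivative_def mult.commute[of _ "axis i 1 \<bullet> _"])
  qed
  have "partial_deriv i g (set_action y i r) = axis i 1 \<bullet> g' (set_action y i r)"
    unfolding partial_deriv_def set_action_set_action set_action_nth
    by (rule DERIV_imp_deriv[OF deriv])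
  then show ?thesis using deriv by simp
qed

text \<open>Monotonicity along one coordinate says that the own partial derivative has the sign of the deviation,
so a critical own action is a global minimum.\<close>

lemma nash_equilibrium_iff_critical:
  fixes f :: "'n::finite \<Rightarrow> real ^ 'n \<Rightarrow> real"
  assumes smooth: "\<And>i. continuously_differentiable (f i)"
    and mono: "\<And>y z. (y - z) \<bullet> (pseudo_gradient f y - pseudo_gradient f z) \<ge> 0"
  shows "nash_equilibrium f w \<longleftrightarrow> pseudo_gradient f w = 0"
proof
  assume nash: "nash_equilibrium f w"
  have "partial_deriv i (f i) w = 0" for i
  proof (rule DERIV_local_min)
    show "((\<lambda>s. f i (set_action w i s)) has_real_derivative partial_deriv i (f i) w) (at (w $ i))"
      using has_partial_deriv[OF smooth, of i w i "w $ i"] by (simp add: set_action_same)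
    show "\<forall>s. \<bar>w $ i - s\<bar> < 1 \<longrightarrow> f i (set_action w i (w $ i)) \<le> f i (set_action w i s)"
      using nash by (simp add: nash_equilibrium_def set_action_same)
  qed simp
  then show "pseudo_gradient f w = 0" by (simp add: Finite_Cartesian_Product.vec_eq_iff pseudo_gradient_nth)
next
  assume crit: "pseudo_gradient f w = 0"
  show "nash_equilibrium f w"
    unfolding nash_equilibrium_def
  proof (intro allI)
    fix i s
    let ?\<phi> = "\<lambda>s. f i (set_action w i s)" and ?\<phi>' = "\<lambda>s. partial_deriv i (f i) (set_action w i s)"
    have deriv: "(?\<phi> has_real_derivative ?\<phi>' r) (at r within UNIV)" for r
      using has_partial_deriv[OF smooth] by simp
    have sign: "(r - w $ i) * ?\<phi>' r \<ge> 0" for r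
      using mono[of "set_action w i r" w] crit
      by (simp add: set_action_eq inner_axis' pseudo_gradient_nth)
    consider "s = w $ i" | "s < w $ i" | "w $ i < s" by linarith
    then have "?\<phi> (w $ i) \<le> ?\<phi> s"
    proof cases
      case 2
      obtain \<xi> where \<xi>: "s < \<xi>" "\<xi> < w $ i" "?\<phi> (w $ i) - ?\<phi> s = ?\<phi>' \<xi> * (w $ i - s)"
        by (rule real_MVT_within[OF 2, of UNIV ?\<phi> ?\<phi>']) (use deriv in auto)
      have "?\<phi>' \<xi> \<le> 0" using sign[of \<xi>] \<xi> by (simp add: zero_le_mult_iff)
      then show ?thesis using \<xi>(3) 2 by (smt (verit) mult_nonpos_nonneg)
    next
      case 3
      obtain \<xi> where \<xi>: "w $ i < \<xi>" "\<xi> < s" "?\<phi> s - ?\<phi> (w $ i) = ?\<phi>' \<xi> * (s - w $ i)"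
        by (rule real_MVT_within[OF 3, of UNIV ?\<phi> ?\<phi>']) (use deriv in auto)
      have "?\<phi>' \<xi> \<ge> 0" using sign[of \<xi>] \<xi> by (simp add: zero_le_mult_iff)
      then show ?thesis using \<xi>(3) 3 by (smt (verit) mult_nonneg_nonneg)
    qed simp
    then show "f i w \<le> f i (set_action w i s)" by (simp add: set_action_same)
  qed
qed

text \<open>With the step \<open>\<omega> / L\<^sup>2\<close> the map \<open>y - \<epsilon> G y\<close> contracts squared distances by \<open>1 - \<omega>\<^sup>2 / L\<^sup>2\<close>.\<close>

lemma strongly_monotone_unique_zero:
  fixes G :: "'a::{complete_space, real_inner} \<Rightarrow> 'a"
  assumes lip: "\<And>y z. norm (G y - G z) \<le> L * norm (y - z)"
    and mono: "\<And>y z. (y - z) \<bullet> (G y - G z) \<ge> \<omega> * (norm (y - z))\<^sup>2"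
    and pos: "\<omega> > 0" "L > 0"
  shows "\<exists>!y. G y = 0"
proof -
  define \<epsilon> where "\<epsilon> = \<omega> / L\<^sup>2"
  define q where "q = 1 - \<omega>\<^sup>2 / L\<^sup>2"
  have \<epsilon>: "\<epsilon> > 0" using pos by (simp add: \<epsilon>_def)
  have q: "q < 1" using pos by (simp add: q_def)
  define S where "S y = y - \<epsilon> *\<^sub>R G y" for y
  have step: "(dist (S y) (S z))\<^sup>2 \<le> max q 0 * (dist y z)\<^sup>2" for y z
  proof -
    have "(dist (S y) (S z))\<^sup>2 = (norm (y - z))\<^sup>2 - 2 * \<epsilon> * ((y - z) \<bullet> (G y - G z))
        + \<epsilon>\<^sup>2 * (norm (G y - G z))\<^sup>2"
    proof -
      have "S y - S z = (y - z) - \<epsilon> *\<^sub>R (G y - G z)" by (simp add: S_def algebra_simps)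
      then show ?thesis
        unfolding dist_norm power2_norm_eq_inner
        by (simp only: inner_diff_left inner_diff_right inner_scaleR_left inner_scaleR_right)
          (simp add: inner_commute power2_eq_square algebra_simps)
    qed
    also have "\<dots> \<le> (norm (y - z))\<^sup>2 - 2 * \<epsilon> * (\<omega> * (norm (y - z))\<^sup>2) + \<epsilon>\<^sup>2 * (L * norm (y - z))\<^sup>2"
      using mono[of y z] lip[of y z] \<epsilon> by (intro add_mono diff_mono mult_left_mono power_mono) auto
    also have "\<dots> = q * (norm (y - z))\<^sup>2"
      using pos by (simp add: q_def \<epsilon>_def field_simps power2_eq_square)
    also have "\<dots> \<le> max q 0 * (dist y z)\<^sup>2" by (simp add: dist_norm mult_right_mono)
    finally show ?thesis .
  qed
  have "\<exists>!y. S y = y"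
  proof (rule banach_fix_type[where c="sqrt (max q 0)"])
    show "\<forall>y z. dist (S y) (S z) \<le> sqrt (max q 0) * dist y z"
    proof (intro allI)
      fix y z
      have "dist (S y) (S z) = sqrt ((dist (S y) (S z))\<^sup>2)" by simp
      also have "\<dots> \<le> sqrt (max q 0 * (dist y z)\<^sup>2)" using step by (rule real_sqrt_le_mono)
      finally show "dist (S y) (S z) \<le> sqrt (max q 0) * dist y z" by (simp add: real_sqrt_mult)
    qed
  qed (use q in auto)
  then show ?thesis using \<epsilon> by (simp add: S_def)
qed

lemma pseudo_gradient_lipschitz:
  fixes f :: "'n::finite \<Rightarrow> real ^ 'n \<Rightarrow> real"
  assumes "\<And>i y z. \<bar>partial_deriv i (f i) y - partial_deriv i (f i) z\<bar> \<le> l i * norm (y - z)"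
  shows "norm (pseudo_gradient f y - pseudo_gradient f z) \<le> (\<Sum>i\<in>UNIV. l i) * norm (y - z)"
proof -
  have "norm (pseudo_gradient f y - pseudo_gradient f z)
      \<le> (\<Sum>i\<in>UNIV. \<bar>(pseudo_gradient f y - pseudo_gradient f z) $ i\<bar>)"
    by (rule norm_le_l1_cart)
  also have "\<dots> \<le> (\<Sum>i\<in>UNIV. l i * norm (y - z))"
    using assms by (intro sum_mono) (simp add: pseudo_gradient_nth)
  finally show ?thesis by (simp add: sum_distrib_right)
qed

section \<open>A Lyapunov function for the adaptive estimators\<close>

lemma young_ineq:
  fixes x y \<epsilon> :: real
  assumes "\<epsilon> > 0"
  shows "x * y \<le> \<epsilon> / 2 * x\<^sup>2 + y\<^sup>2 / (2 * \<epsilon>)"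
proof -
  have "0 \<le> (\<epsilon> * x - y)\<^sup>2 / (2 * \<epsilon>)" using assms by simp
  also have "\<dots> = \<epsilon> / 2 * x\<^sup>2 + y\<^sup>2 / (2 * \<epsilon>) - x * y"
    using assms by (simp add: power2_eq_square field_simps)
  finally show ?thesis by simp
qed

text \<open>A constant \<open>\<gamma>\<close> is invisible to the Laplacian and enters only through the pinning term.\<close>

lemma pinned_laplacian_shift:
  "pinned_laplacian a j (\<lambda>k. - v k + \<gamma>) i = - pinned_laplacian a j v i + a i j * \<gamma>"
proof -
  have "(\<Sum>k\<in>UNIV. a i k * (- v i + \<gamma> - (- v k + \<gamma>))) = - (\<Sum>k\<in>UNIV. a i k * (v i - v k))"
    unfolding sum_negf[symmetric] by (intro sum.cong refl) (simp add: algebra_simps)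
  then show ?thesis by (simp add: pinned_laplacian_def algebra_simps)
qed

text \<open>\<open>g j\<close> is the partial derivative of player \<open>j\<close>'s objective in its own action; \<open>coercive\<close> is what the
graph contributes.\<close>

locale estimator_network =
  fixes g :: "'n::finite \<Rightarrow> real ^ 'n \<Rightarrow> real" and a :: "'n \<Rightarrow> 'n \<Rightarrow> real"
    and p l :: "'n \<Rightarrow> real" and ystar :: "real ^ 'n" and \<omega> \<mu> :: real
  assumes g_lipschitz: "\<bar>g j y - g j y'\<bar> \<le> l j * norm (y - y')"
    and g_zero: "g j ystar = 0"
    and g_monotone: "(y - ystar) \<bullet> (\<chi> j. g j y) \<ge> \<omega> * (norm (y - ystar))\<^sup>2"
    and \<omega>: "\<omega> > 0" and p_pos: "p i > 0" and \<mu>: "\<mu> > 0"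
    and coercive: "\<mu> * (\<Sum>i\<in>UNIV. (v i)\<^sup>2) \<le> (\<Sum>i\<in>UNIV. p i * v i * pinned_laplacian a j v i)"
begin

text \<open>The variable \<open>\<xi>\<^sub>i\<^sub>j\<close> of the controller, written through the column error \<open>z - w\<close>.\<close>

definition residual :: "real ^ 'n \<Rightarrow> ('n \<Rightarrow> real ^ 'n) \<Rightarrow> 'n \<Rightarrow> 'n \<Rightarrow> real" where
  "residual w z i j = pinned_laplacian a j (\<lambda>k. z k $ j - w $ j) i"

definition feedback :: "real ^ 'n \<Rightarrow> ('n \<Rightarrow> real ^ 'n) \<Rightarrow> ('n \<Rightarrow> 'n \<Rightarrow> real) \<Rightarrow> 'n \<Rightarrow> 'n \<Rightarrow> real" where
  "feedback w z c i j = (c i j + (residual w z i j)\<^sup>2) * residual w z i j"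

text \<open>The time derivative of the residual: the column error moves by minus the feedback plus the drift
\<open>g j (z j)\<close> of its leader.\<close>

definition residual_rate :: "real ^ 'n \<Rightarrow> ('n \<Rightarrow> real ^ 'n) \<Rightarrow> ('n \<Rightarrow> 'n \<Rightarrow> real) \<Rightarrow> 'n \<Rightarrow> 'n \<Rightarrow> real" where
  "residual_rate w z c i j = pinned_laplacian a j (\<lambda>k. - feedback w z c k j + g j (z j)) i"

definition dissipation :: "real ^ 'n \<Rightarrow> ('n \<Rightarrow> real ^ 'n) \<Rightarrow> real" where
  "dissipation w z = (\<Sum>j\<in>UNIV. (w $ j - ystar $ j)\<^sup>2) + (\<Sum>j\<in>UNIV. \<Sum>i\<in>UNIV. (residual w z i j)\<^sup>2)"

text \<open>The first summand measures the gradient flow. In the second, \<open>(2 c + \<xi>\<^sup>2) \<xi>\<^sup>2\<close> is chosen because its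
\<open>\<xi>\<close>-derivative is \<open>4 (c + \<xi>\<^sup>2) \<xi>\<close>, four times the feedback, so that coercivity applies to the feedback
vector; \<open>\<alpha>\<close> is a virtual gain.\<close>

definition lyapunov :: "real \<Rightarrow> real \<Rightarrow> real ^ 'n \<Rightarrow> ('n \<Rightarrow> real ^ 'n) \<Rightarrow> ('n \<Rightarrow> 'n \<Rightarrow> real) \<Rightarrow> real" where
  "lyapunov K \<alpha> w z c = K / 2 * (\<Sum>j\<in>UNIV. (w $ j - ystar $ j)\<^sup>2)
    + (\<Sum>j\<in>UNIV. \<Sum>i\<in>UNIV. p i / 2 *
        ((2 * c i j + (residual w z i j)\<^sup>2) * (residual w z i j)\<^sup>2 + (c i j - \<alpha>)\<^sup>2))"

definition lyapunov_rate :: "real \<Rightarrow> real \<Rightarrow> real ^ 'n \<Rightarrow> ('n \<Rightarrow> real ^ 'n) \<Rightarrow> ('n \<Rightarrow> 'n \<Rightarrow> real) \<Rightarrow> real" where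
  "lyapunov_rate K \<alpha> w z c = K * (\<Sum>j\<in>UNIV. (w $ j - ystar $ j) * - g j (z j))
    + (\<Sum>j\<in>UNIV. \<Sum>i\<in>UNIV. p i * ((residual w z i j)^4
        + 2 * feedback w z c i j * residual_rate w z c i j + (c i j - \<alpha>) * (residual w z i j)\<^sup>2))"

text \<open>The factors of the squared residuals, leader speeds and distances that Young's inequality and the
Lipschitz constants leave over in the estimates below.\<close>

definition "C_res = (\<Sum>i\<in>UNIV. (p i)\<^sup>2 / (2 * \<mu>))"
definition "C_pin = (\<Sum>j\<in>UNIV. \<Sum>i\<in>UNIV. 2 * (p i * a i j)\<^sup>2 / \<mu>)"
definition "C_lip = 2 * (\<Sum>j\<in>UNIV. (l j)\<^sup>2)"

lemma C_nonneg: "C_res \<ge> 0" "C_pin \<ge> 0" "C_lip \<ge> 0"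
  using \<mu> by (auto simp: C_res_def C_pin_def C_lip_def intro!: sum_nonneg)

lemma weighted_young:
  "(\<Sum>i\<in>UNIV. p i * u i * v i) \<le> \<mu> / 2 * (\<Sum>i\<in>UNIV. (u i)\<^sup>2) + C_res * (\<Sum>i\<in>UNIV. (v i)\<^sup>2)"
proof -
  have "p i * u i * v i \<le> \<mu> / 2 * (u i)\<^sup>2 + C_res * (v i)\<^sup>2" for i
  proof -
    have "p i * u i * v i \<le> \<mu> / 2 * (u i)\<^sup>2 + (p i)\<^sup>2 / (2 * \<mu>) * (v i)\<^sup>2"
      using young_ineq[OF \<mu>, of "u i" "p i * v i"] by (simp add: power_mult_distrib mult_ac)
    moreover have "(p i)\<^sup>2 / (2 * \<mu>) \<le> C_res"
      unfolding C_res_def using \<mu> by (intro member_le_sum) auto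
    ultimately show ?thesis by (smt (verit) mult_right_mono zero_le_power2)
  qed
  then show ?thesis by (simp add: sum_distrib_left sum.distrib[symmetric] sum_mono)
qed

lemma column_error_le_residual:
  "(\<Sum>i\<in>UNIV. (v i)\<^sup>2) \<le> 2 * C_res / \<mu> * (\<Sum>i\<in>UNIV. (pinned_laplacian a j v i)\<^sup>2)"
proof -
  have "\<mu> / 2 * (\<Sum>i\<in>UNIV. (v i)\<^sup>2) \<le> C_res * (\<Sum>i\<in>UNIV. (pinned_laplacian a j v i)\<^sup>2)"
    using coercive[of v j] weighted_young[of v "pinned_laplacian a j v"] by linarith
  then show ?thesis using \<mu> by (simp add: field_simps)
qed

text \<open>Coercivity bounds the errors by the residuals, column by column.\<close>

lemma error_le_residual:
  "(\<Sum>j\<in>UNIV. \<Sum>i\<in>UNIV. (z i $ j - w $ j)\<^sup>2)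
    \<le> 2 * C_res / \<mu> * (\<Sum>j\<in>UNIV. \<Sum>i\<in>UNIV. (residual w z i j)\<^sup>2)"
  unfolding sum_distrib_left[of "2 * C_res / \<mu>"] residual_def
proof (rule sum_mono)
  fix j
  show "(\<Sum>i\<in>UNIV. (z i $ j - w $ j)\<^sup>2) \<le> (\<Sum>i\<in>UNIV. 2 * C_res / \<mu> * (pinned_laplacian a j (\<lambda>k. z k $ j - w $ j) i)\<^sup>2)"
    using column_error_le_residual[of "\<lambda>k. z k $ j - w $ j" j] by (simp add: sum_distrib_left)
qed

lemma row_error_le:
  fixes z :: "'n \<Rightarrow> real ^ 'n" and w :: "real ^ 'n"
  shows
  "(norm (z i - w))\<^sup>2 \<le> (\<Sum>j\<in>UNIV. \<Sum>i\<in>UNIV. (z i $ j - w $ j)\<^sup>2)"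
proof -
  have "(norm (z i - w))\<^sup>2 = (\<Sum>j\<in>UNIV. (z i $ j - w $ j)\<^sup>2)" by (simp add: norm_square_vec)
  also have "\<dots> \<le> (\<Sum>j\<in>UNIV. \<Sum>i\<in>UNIV. (z i $ j - w $ j)\<^sup>2)"
  proof (rule sum_mono)
    show "(z i $ j - w $ j)\<^sup>2 \<le> (\<Sum>i\<in>UNIV. (z i $ j - w $ j)\<^sup>2)" for j
      by (rule member_le_sum[where f="\<lambda>i. (z i $ j - w $ j)\<^sup>2"]) auto
  qed
  finally show ?thesis .
qed

lemma sum_square_lipschitz:
  assumes "\<And>j. \<bar>d j\<bar> \<le> l j * r j" "\<And>j. (r j)\<^sup>2 \<le> s"
  shows "(\<Sum>j\<in>UNIV. (d j)\<^sup>2) \<le> C_lip / 2 * s"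
proof -
  have "(d j)\<^sup>2 \<le> (l j)\<^sup>2 * s" for j
  proof -
    have "(d j)\<^sup>2 \<le> (l j * r j)\<^sup>2"
      using power_mono[OF assms(1)[of j] abs_ge_zero, of 2] by simp
    also have "\<dots> \<le> (l j)\<^sup>2 * s" using assms(2) by (simp add: power_mult_distrib mult_left_mono)
    finally show ?thesis .
  qed
  then show ?thesis by (simp add: C_lip_def sum_distrib_right sum_mono)
qed

text \<open>Coercivity yields \<open>-2 \<mu> |\<eta>|\<^sup>2\<close> for the feedback vector \<open>\<eta>\<close>, which pays for the two terms
\<open>p \<eta> \<xi>\<close> (from the growth of the gains) and \<open>2 p a \<eta> \<gamma>\<close> (from the moving leader) by Young's inequality.\<close>

lemma adaptation_column_le:
  fixes w :: "real ^ 'n" and z :: "'n \<Rightarrow> real ^ 'n" and c :: "'n \<Rightarrow> 'n \<Rightarrow> real" and j :: 'n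
  defines "\<xi> \<equiv> \<lambda>i. residual w z i j" and "\<eta> \<equiv> \<lambda>i. feedback w z c i j"
  shows "(\<Sum>i\<in>UNIV. p i * (\<xi> i ^ 4 + 2 * \<eta> i * residual_rate w z c i j + (c i j - \<alpha>) * (\<xi> i)\<^sup>2))
    \<le> C_res * (\<Sum>i\<in>UNIV. (\<xi> i)\<^sup>2) + C_pin * (g j (z j))\<^sup>2 - \<alpha> * (\<Sum>i\<in>UNIV. p i * (\<xi> i)\<^sup>2)"
proof -
  let ?\<gamma> = "g j (z j)"
  have "p i * (\<xi> i ^ 4 + 2 * \<eta> i * residual_rate w z c i j + (c i j - \<alpha>) * (\<xi> i)\<^sup>2)
      = p i * \<eta> i * \<xi> i - 2 * (p i * \<eta> i * pinned_laplacian a j \<eta> i)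
        + 2 * (p i * a i j * \<eta> i * ?\<gamma>) - \<alpha> * (p i * (\<xi> i)\<^sup>2)" for i
    unfolding residual_rate_def \<xi>_def \<eta>_def pinned_laplacian_shift
    by (simp add: feedback_def algebra_simps power2_eq_square power4_eq_xxxx)
  then have "(\<Sum>i\<in>UNIV. p i * (\<xi> i ^ 4 + 2 * \<eta> i * residual_rate w z c i j + (c i j - \<alpha>) * (\<xi> i)\<^sup>2))
      = (\<Sum>i\<in>UNIV. p i * \<eta> i * \<xi> i) - 2 * (\<Sum>i\<in>UNIV. p i * \<eta> i * pinned_laplacian a j \<eta> i)
        + 2 * (\<Sum>i\<in>UNIV. p i * a i j * \<eta> i * ?\<gamma>) - \<alpha> * (\<Sum>i\<in>UNIV. p i * (\<xi> i)\<^sup>2)"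
    by (simp add: sum.distrib sum_subtractf sum_distrib_left)
  moreover have "2 * (\<Sum>i\<in>UNIV. p i * a i j * \<eta> i * ?\<gamma>) \<le> \<mu> / 2 * (\<Sum>i\<in>UNIV. (\<eta> i)\<^sup>2) + C_pin * ?\<gamma>\<^sup>2"
  proof -
    have "2 * (p i * a i j * \<eta> i * ?\<gamma>) \<le> \<mu> / 2 * (\<eta> i)\<^sup>2 + 2 * (p i * a i j)\<^sup>2 / \<mu> * ?\<gamma>\<^sup>2" for i
      using young_ineq[OF \<mu>, of "\<eta> i" "2 * (p i * a i j * ?\<gamma>)"] by (simp add: power_mult_distrib mult_ac)
    then have "2 * (\<Sum>i\<in>UNIV. p i * a i j * \<eta> i * ?\<gamma>)
        \<le> \<mu> / 2 * (\<Sum>i\<in>UNIV. (\<eta> i)\<^sup>2) + (\<Sum>i\<in>UNIV. 2 * (p i * a i j)\<^sup>2 / \<mu>) * ?\<gamma>\<^sup>2"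
      unfolding sum_distrib_left sum_distrib_right sum.distrib[symmetric] by (rule sum_mono)
    moreover have "(\<Sum>i\<in>UNIV. 2 * (p i * a i j)\<^sup>2 / \<mu>) \<le> C_pin"
      unfolding C_pin_def
      by (rule member_le_sum[where f="\<lambda>j. \<Sum>i\<in>UNIV. 2 * (p i * a i j)\<^sup>2 / \<mu>"])
        (use \<mu> in \<open>auto intro!: sum_nonneg\<close>)
    ultimately show ?thesis by (smt (verit) mult_right_mono zero_le_power2)
  qed
  moreover have "\<mu> * (\<Sum>i\<in>UNIV. (\<eta> i)\<^sup>2) \<ge> 0" using \<mu> by (simp add: sum_nonneg)
  ultimately show ?thesis
    using coercive[of \<eta> j] weighted_young[of \<eta> \<xi>] by linarith
qed

text \<open>Half of the strong monotonicity is spent, through Young's inequality, on the difference between the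
estimated and the true gradient, which the row errors control.\<close>

lemma gradient_flow_le:
  "(\<Sum>j\<in>UNIV. (w $ j - ystar $ j) * - g j (z j)) \<le> - (\<omega> / 2) * (\<Sum>j\<in>UNIV. (w $ j - ystar $ j)\<^sup>2)
    + C_lip / (4 * \<omega>) * (\<Sum>j\<in>UNIV. \<Sum>i\<in>UNIV. (z i $ j - w $ j)\<^sup>2)"
proof -
  let ?S = "\<Sum>j\<in>UNIV. \<Sum>i\<in>UNIV. (z i $ j - w $ j)\<^sup>2" and ?X = "\<Sum>j\<in>UNIV. (w $ j - ystar $ j)\<^sup>2"
  have "(\<Sum>j\<in>UNIV. (w $ j - ystar $ j) * - g j (z j))
      = - (\<Sum>j\<in>UNIV. (w $ j - ystar $ j) * g j w) + (\<Sum>j\<in>UNIV. (w $ j - ystar $ j) * (g j w - g j (z j)))"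
    unfolding sum_negf[symmetric] sum.distrib[symmetric] by (intro sum.cong) (auto simp: algebra_simps)
  moreover have "\<omega> * ?X \<le> (\<Sum>j\<in>UNIV. (w $ j - ystar $ j) * g j w)"
    using g_monotone[of w] by (simp add: norm_square_vec inner_vec_def)
  moreover have "(\<Sum>j\<in>UNIV. (w $ j - ystar $ j) * (g j w - g j (z j)))
      \<le> \<omega> / 2 * ?X + 1 / (2 * \<omega>) * (\<Sum>j\<in>UNIV. (g j w - g j (z j))\<^sup>2)"
    unfolding sum_distrib_left sum.distrib[symmetric]
    by (rule sum_mono) (use young_ineq[OF \<omega>] in simp)
  moreover have "(\<Sum>j\<in>UNIV. (g j w - g j (z j))\<^sup>2) \<le> C_lip / 2 * ?S"
    by (rule sum_square_lipschitz[where r="\<lambda>j. norm (z j - w)"])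
      (use g_lipschitz row_error_le in \<open>auto simp: norm_minus_commute\<close>)
  then have "1 / (2 * \<omega>) * (\<Sum>j\<in>UNIV. (g j w - g j (z j))\<^sup>2) \<le> 1 / (2 * \<omega>) * (C_lip / 2 * ?S)"
    using \<omega> by (intro mult_left_mono) auto
  ultimately show ?thesis by (simp add: field_simps)
qed

text \<open>The leaders slow down near the equilibrium, since \<open>g\<close> vanishes there.\<close>

lemma gradient_square_le:
  "(\<Sum>j\<in>UNIV. (g j (z j))\<^sup>2) \<le> C_lip * ((\<Sum>j\<in>UNIV. (w $ j - ystar $ j)\<^sup>2)
     + (\<Sum>j\<in>UNIV. \<Sum>i\<in>UNIV. (z i $ j - w $ j)\<^sup>2))"
proof -
  let ?S = "\<Sum>j\<in>UNIV. \<Sum>i\<in>UNIV. (z i $ j - w $ j)\<^sup>2" and ?X = "\<Sum>j\<in>UNIV. (w $ j - ystar $ j)\<^sup>2"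
  have "(norm (z j - ystar))\<^sup>2 \<le> 2 * (?X + ?S)" for j
  proof -
    have "(norm (z j - ystar))\<^sup>2 \<le> (norm (z j - w) + norm (w - ystar))\<^sup>2"
      using norm_triangle_ineq[of "z j - w" "w - ystar"] by (intro power_mono) auto
    also have "\<dots> \<le> 2 * ((norm (w - ystar))\<^sup>2 + (norm (z j - w))\<^sup>2)"
      using sum_squares_bound[of "norm (z j - w)" "norm (w - ystar)"] by (simp add: power2_sum)
    finally show ?thesis using row_error_le[of z j w] by (simp add: norm_square_vec[of "w - ystar"])
  qed
  then have "(\<Sum>j\<in>UNIV. (g j (z j))\<^sup>2) \<le> C_lip / 2 * (2 * (?X + ?S))"
    using g_lipschitz[of _ _ ystar] g_zero
    by (intro sum_square_lipschitz[where r="\<lambda>j. norm (z j - ystar)"]) auto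
  then show ?thesis by (simp add: distrib_left)
qed

text \<open>All error terms are multiples of the squared distance \<open>|w - y\<^sup>*|\<^sup>2\<close> and of the squared residuals. The
constants have to be chosen in this order: \<open>K\<close> absorbs the first kind and creates more of the second
kind, and \<open>\<alpha>\<close> absorbs the second kind.\<close>

lemma lyapunov_rate_le:
  obtains K \<alpha> where "K > 0" "\<And>w z c. lyapunov_rate K \<alpha> w z c \<le> - dissipation w z"
proof -
  define C6 where "C6 = 2 * C_res / \<mu>"
  define K where "K = 2 * (C_pin * C_lip + 1) / \<omega>"
  define P where "P = Min (range p)"
  define \<alpha> where "\<alpha> = (K * (C_lip / (4 * \<omega>)) * C6 + C_res + C_pin * C_lip * C6 + 1) / P"
  have P: "P > 0" "P \<le> p i" for i using p_pos by (auto simp: P_def)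
  have C6: "C6 \<ge> 0" using C_nonneg \<mu> by (simp add: C6_def)
  have K: "K > 0" using C_nonneg \<omega> by (simp add: K_def add_nonneg_pos)
  have \<alpha>: "\<alpha> \<ge> 0" using C_nonneg C6 K \<omega> P by (simp add: \<alpha>_def)
  have "lyapunov_rate K \<alpha> w z c \<le> - dissipation w z" for w z c
  proof -
    let ?S = "\<Sum>j\<in>UNIV. \<Sum>i\<in>UNIV. (z i $ j - w $ j)\<^sup>2" and ?X = "\<Sum>j\<in>UNIV. (w $ j - ystar $ j)\<^sup>2"
    let ?R = "\<Sum>j\<in>UNIV. \<Sum>i\<in>UNIV. (residual w z i j)\<^sup>2"
    have 1: "(\<Sum>j\<in>UNIV. \<Sum>i\<in>UNIV. p i * ((residual w z i j)^4
        + 2 * feedback w z c i j * residual_rate w z c i j + (c i j - \<alpha>) * (residual w z i j)\<^sup>2))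
      \<le> C_res * ?R + C_pin * (\<Sum>j\<in>UNIV. (g j (z j))\<^sup>2) - \<alpha> * (\<Sum>j\<in>UNIV. \<Sum>i\<in>UNIV. p i * (residual w z i j)\<^sup>2)"
      unfolding sum_distrib_left[of C_res "\<lambda>j. \<Sum>i\<in>UNIV. (residual w z i j)\<^sup>2"] sum_distrib_left[of C_pin]
        sum_distrib_left[of \<alpha> "\<lambda>j. \<Sum>i\<in>UNIV. p i * (residual w z i j)\<^sup>2"]
        sum_subtractf[symmetric] sum.distrib[symmetric]
      by (rule sum_mono) (rule adaptation_column_le)
    have 2: "C_pin * (\<Sum>j\<in>UNIV. (g j (z j))\<^sup>2) \<le> C_pin * (C_lip * (?X + ?S))"
      using gradient_square_le C_nonneg by (intro mult_left_mono) auto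
    have 3: "?S \<le> C6 * ?R" unfolding C6_def by (rule error_le_residual)
    have 4: "K * (\<Sum>j\<in>UNIV. (w $ j - ystar $ j) * - g j (z j))
        \<le> K * (- (\<omega> / 2) * ?X + C_lip / (4 * \<omega>) * ?S)"
      using gradient_flow_le K by (intro mult_left_mono) auto
    have 5: "P * ?R \<le> (\<Sum>j\<in>UNIV. \<Sum>i\<in>UNIV. p i * (residual w z i j)\<^sup>2)"
      unfolding sum_distrib_left by (intro sum_mono mult_right_mono P) auto
    have 6: "\<alpha> * (P * ?R) \<le> \<alpha> * (\<Sum>j\<in>UNIV. \<Sum>i\<in>UNIV. p i * (residual w z i j)\<^sup>2)"
      using 5 \<alpha> by (rule mult_left_mono)
    have 7: "\<alpha> * (P * ?R) = (K * (C_lip / (4 * \<omega>)) * C6 + C_res + C_pin * C_lip * C6 + 1) * ?R"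
      using P by (simp add: \<alpha>_def)
    have 8: "(K * (C_lip / (4 * \<omega>)) + C_pin * C_lip) * ?S \<le> (K * (C_lip / (4 * \<omega>)) + C_pin * C_lip) * (C6 * ?R)"
      using 3 C_nonneg K \<omega> by (intro mult_left_mono) auto
    have 9: "K * (\<omega> / 2) * ?X = (C_pin * C_lip + 1) * ?X" using \<omega> by (simp add: K_def)
    show ?thesis
      unfolding lyapunov_rate_def dissipation_def
      using 1 2 4 6 8 unfolding 7 using 9 by (simp only: algebra_simps)
  qed
  then show ?thesis using that K by blast
qed

end

section \<open>Convergence of the estimators\<close>

text \<open>Boundedness of a signal on \<open>[0, \<infinity>)\<close>, as a predicate closed under the operations that build the vector field.\<close>

definition bounded_on_halfline :: "(real \<Rightarrow> real) \<Rightarrow> bool" where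
  "bounded_on_halfline f \<longleftrightarrow> (\<exists>M. \<forall>t\<ge>0. \<bar>f t\<bar> \<le> M)"

lemma bounded_on_halflineI: "(\<And>t. t \<ge> 0 \<Longrightarrow> \<bar>f t\<bar> \<le> M) \<Longrightarrow> bounded_on_halfline f"
  by (auto simp: bounded_on_halfline_def)

lemma bounded_on_halfline_const: "bounded_on_halfline (\<lambda>_. c)"
  by (auto simp: bounded_on_halfline_def)

lemma bounded_on_halfline_add:
  assumes "bounded_on_halfline f" "bounded_on_halfline g"
  shows "bounded_on_halfline (\<lambda>t. f t + g t)"
proof -
  obtain M N where "\<forall>t\<ge>0. \<bar>f t\<bar> \<le> M" "\<forall>t\<ge>0. \<bar>g t\<bar> \<le> N"
    using assms by (auto simp: bounded_on_halfline_def)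
  then show ?thesis by (intro bounded_on_halflineI[of _ "M + N"]) (smt (verit))
qed

lemma bounded_on_halfline_mult:
  assumes "bounded_on_halfline f" "bounded_on_halfline g"
  shows "bounded_on_halfline (\<lambda>t. f t * g t)"
proof -
  obtain M N where MN: "\<forall>t\<ge>0. \<bar>f t\<bar> \<le> M" "\<forall>t\<ge>0. \<bar>g t\<bar> \<le> N"
    using assms by (auto simp: bounded_on_halfline_def)
  have "M \<ge> 0" using MN(1) abs_ge_zero[of "f 0"] by (meson order_refl order_trans)
  then have "\<bar>f t * g t\<bar> \<le> M * N" if "t \<ge> 0" for t
    unfolding abs_mult using MN that by (intro mult_mono) auto
  then show ?thesis by (rule bounded_on_halflineI)
qed

lemma bounded_on_halfline_minus: "bounded_on_halfline f \<Longrightarrow> bounded_on_halfline (\<lambda>t. - f t)"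
  by (simp add: bounded_on_halfline_def)

lemma bounded_on_halfline_diff:
  "bounded_on_halfline f \<Longrightarrow> bounded_on_halfline g \<Longrightarrow> bounded_on_halfline (\<lambda>t. f t - g t)"
  using bounded_on_halfline_add[of f "\<lambda>t. - g t"] bounded_on_halfline_minus[of g] by simp

lemma bounded_on_halfline_power:
  "bounded_on_halfline f \<Longrightarrow> bounded_on_halfline (\<lambda>t. f t ^ n)"
  by (induction n) (simp_all add: bounded_on_halfline_const bounded_on_halfline_mult)

lemma bounded_on_halfline_sum:
  "(\<And>i. i \<in> A \<Longrightarrow> bounded_on_halfline (f i)) \<Longrightarrow> bounded_on_halfline (\<lambda>t. \<Sum>i\<in>A. f i t)"
  by (induction A rule: infinite_finite_induct)
    (simp_all add: bounded_on_halfline_const bounded_on_halfline_add)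

lemmas bounded_on_halfline_intros = bounded_on_halfline_const bounded_on_halfline_add
  bounded_on_halfline_mult bounded_on_halfline_minus bounded_on_halfline_diff
  bounded_on_halfline_power bounded_on_halfline_sum

lemma mono_bounded_tendsto:
  fixes f :: "real \<Rightarrow> real"
  assumes mono: "\<And>s t. 0 \<le> s \<Longrightarrow> s \<le> t \<Longrightarrow> f s \<le> f t" and bdd: "\<And>t. t \<ge> 0 \<Longrightarrow> f t \<le> M"
  obtains L where "(f \<longlongrightarrow> L) at_top"
proof
  have bdd': "bdd_above (f ` {0..})" using bdd by (auto intro!: bdd_aboveI[of _ M])
  show "(f \<longlongrightarrow> Sup (f ` {0..})) at_top"
  proof (rule order_tendstoI)
    fix y assume "y < Sup (f ` {0..})"
    then obtain s where "s \<ge> 0" "y < f s" using less_cSupD[of "f ` {0..}" y] by force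
    then have "\<forall>t\<ge>s. y < f t" using mono by (meson less_le_trans)
    then show "eventually (\<lambda>t. y < f t) at_top" by (auto simp: eventually_at_top_linorder)
  next
    fix y assume y: "Sup (f ` {0..}) < y"
    have "f t < y" if "t \<ge> 0" for t
      using cSup_upper[OF _ bdd', of "f t"] that y by auto
    then show "eventually (\<lambda>t. f t < y) at_top"
      by (auto simp: eventually_at_top_linorder)
  qed
qed

context estimator_network
begin

text \<open>\<open>S\<close> is \<open>{0..}\<close> for the convergence proof and \<open>{0..T}\<close> for the a priori bound in the existence proof.\<close>

definition trajectory ::
  "real set \<Rightarrow> (real \<Rightarrow> real ^ 'n) \<Rightarrow> ('n \<Rightarrow> real \<Rightarrow> real ^ 'n) \<Rightarrow> ('n \<Rightarrow> 'n \<Rightarrow> real \<Rightarrow> real) \<Rightarrow> bool" where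
  "trajectory S w z c \<longleftrightarrow> (\<forall>t\<in>S. \<forall>j.
     ((\<lambda>s. w s $ j) has_real_derivative - g j (z j t)) (at t within S) \<and>
     (\<forall>i. ((\<lambda>s. z i s $ j) has_real_derivative - feedback (w t) (\<lambda>i. z i t) (\<lambda>i j. c i j t) i j) (at t within S) \<and>
          (c i j has_real_derivative (residual (w t) (\<lambda>i. z i t) i j)\<^sup>2) (at t within S)))"

lemma dissipation_nonneg: "dissipation w z \<ge> 0"
  unfolding dissipation_def by (intro add_nonneg_nonneg sum_nonneg) auto

lemma trajectory_subset: "trajectory S w z c \<Longrightarrow> S' \<subseteq> S \<Longrightarrow> trajectory S' w z c"
  unfolding trajectory_def by (meson DERIV_subset subsetD)

lemma residual_has_derivative:
  assumes "trajectory S w z c" "t \<in> S"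
  shows "((\<lambda>s. residual (w s) (\<lambda>i. z i s) i j) has_real_derivative
    residual_rate (w t) (\<lambda>i. z i t) (\<lambda>i j. c i j t) i j) (at t within S)"
proof -
  have e: "((\<lambda>s. z k s $ j - w s $ j) has_real_derivative
      - feedback (w t) (\<lambda>i. z i t) (\<lambda>i j. c i j t) k j + g j (z j t)) (at t within S)" for k
    using DERIV_diff[of "\<lambda>s. z k s $ j" _ t S "\<lambda>s. w s $ j"] assms unfolding trajectory_def by fastforce
  show ?thesis
    unfolding residual_def residual_rate_def pinned_laplacian_def
    by (intro DERIV_add DERIV_sum DERIV_cmult DERIV_diff e)
qed

lemma lyapunov_has_derivative:
  assumes traj: "trajectory S w z c" and t: "t \<in> S"
  shows "((\<lambda>s. lyapunov K \<alpha> (w s) (\<lambda>i. z i s) (\<lambda>i j. c i j s)) has_real_derivative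
    lyapunov_rate K \<alpha> (w t) (\<lambda>i. z i t) (\<lambda>i j. c i j t)) (at t within S)"
proof -
  let ?\<xi> = "\<lambda>s i j. residual (w s) (\<lambda>i. z i s) i j"
  let ?\<eta> = "feedback (w t) (\<lambda>i. z i t) (\<lambda>i j. c i j t)"
  let ?r = "residual_rate (w t) (\<lambda>i. z i t) (\<lambda>i j. c i j t)"
  have w: "((\<lambda>s. w s $ j) has_real_derivative - g j (z j t)) (at t within S)" for j
    using traj t by (simp add: trajectory_def)
  have c: "(c i j has_real_derivative (?\<xi> t i j)\<^sup>2) (at t within S)" for i j
    using traj t by (simp add: trajectory_def)
  note \<xi> = residual_has_derivative[OF traj t]
  have 1: "((\<lambda>s. K / 2 * (\<Sum>j\<in>UNIV. (w s $ j - ystar $ j)\<^sup>2)) has_real_derivative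
      K * (\<Sum>j\<in>UNIV. (w t $ j - ystar $ j) * - g j (z j t))) (at t within S)"
  proof -
    have "((\<lambda>s. (w s $ j - ystar $ j)\<^sup>2) has_real_derivative 2 * ((w t $ j - ystar $ j) * - g j (z j t)))
        (at t within S)" for j
      by (rule derivative_eq_intros w refl)+ simp
    then have "((\<lambda>s. K / 2 * (\<Sum>j\<in>UNIV. (w s $ j - ystar $ j)\<^sup>2)) has_real_derivative
      K / 2 * (\<Sum>j\<in>UNIV. 2 * ((w t $ j - ystar $ j) * - g j (z j t)))) (at t within S)"
      by (intro DERIV_cmult DERIV_sum)
    then show ?thesis by (simp only: sum_distrib_left[symmetric]) simp
  qed
  have 2: "((\<lambda>s. p i / 2 * ((2 * c i j s + (?\<xi> s i j)\<^sup>2) * (?\<xi> s i j)\<^sup>2 + (c i j s - \<alpha>)\<^sup>2)) has_real_derivative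
      p i * (?\<xi> t i j ^ 4 + 2 * ?\<eta> i j * ?r i j + (c i j t - \<alpha>) * (?\<xi> t i j)\<^sup>2)) (at t within S)" for i j
    by (rule derivative_eq_intros \<xi> c refl)+
      (simp add: feedback_def algebra_simps power2_eq_square power4_eq_xxxx)
  show ?thesis
    unfolding lyapunov_def lyapunov_rate_def by (intro DERIV_add DERIV_sum 1 2)
qed

lemma gain_mono:
  assumes traj: "trajectory S w z c" and st: "s \<le> t" "{s..t} \<subseteq> S"
  shows "c i j s \<le> c i j t"
proof (cases "s = t")
  case False
  then have "s < t" using st by simp
  obtain r where "s < r" "r < t" "c i j t - c i j s = (residual (w r) (\<lambda>i. z i r) i j)\<^sup>2 * (t - s)"
    by (rule real_MVT_within[OF \<open>s < t\<close> st(2), of "c i j" "\<lambda>r. (residual (w r) (\<lambda>i. z i r) i j)\<^sup>2"])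
      (use traj st in \<open>auto simp: trajectory_def\<close>)
  then show ?thesis using \<open>s < t\<close> by (smt (verit) mult_nonneg_nonneg zero_le_power2)
qed simp

text \<open>Positive gains make every summand of the Lyapunov function nonnegative, so each of them is bounded by
\<open>V0\<close> separately.\<close>

lemma lyapunov_bound:
  assumes V: "lyapunov K \<alpha> w z c \<le> V0" and c: "\<And>i j. c i j > 0" and K: "K > 0"
    and P: "P > 0" "\<And>i. P \<le> p i"
  shows "(\<Sum>j\<in>UNIV. (w $ j - ystar $ j)\<^sup>2) \<le> 2 * V0 / K"
    and "(residual w z i j)\<^sup>2 \<le> 1 + 2 * V0 / P"
    and "(c i j - \<alpha>)\<^sup>2 \<le> 2 * V0 / P"
proof -
  let ?X = "\<Sum>j\<in>UNIV. (w $ j - ystar $ j)\<^sup>2"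
  let ?T = "\<lambda>i j. (2 * c i j + (residual w z i j)\<^sup>2) * (residual w z i j)\<^sup>2 + (c i j - \<alpha>)\<^sup>2"
  have T: "?T i j \<ge> 0" for i j using c[of i j] by simp
  then have pT: "p i / 2 * ?T i j \<ge> 0" for i j using p_pos[of i] by simp
  have X: "K / 2 * ?X \<ge> 0" using K by (simp add: sum_nonneg)
  have sum_nn: "(\<Sum>j\<in>UNIV. \<Sum>i\<in>UNIV. p i / 2 * ?T i j) \<ge> 0"
    using pT by (intro sum_nonneg) auto
  have "K / 2 * ?X \<le> V0" using V sum_nn unfolding lyapunov_def by linarith
  then show "?X \<le> 2 * V0 / K" using K by (simp add: field_simps)
  have "p i / 2 * ?T i j \<le> (\<Sum>i\<in>UNIV. p i / 2 * ?T i j)"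
    by (rule member_le_sum[where f="\<lambda>i. p i / 2 * ?T i j"]) (use pT in auto)
  also have "\<dots> \<le> (\<Sum>j\<in>UNIV. \<Sum>i\<in>UNIV. p i / 2 * ?T i j)"
    by (rule member_le_sum[where f="\<lambda>j. \<Sum>i\<in>UNIV. p i / 2 * ?T i j"]) (use pT in \<open>auto intro!: sum_nonneg\<close>)
  also have "\<dots> \<le> V0" using V X unfolding lyapunov_def by linarith
  finally have "p i / 2 * ?T i j \<le> V0" .
  moreover have "P / 2 * ?T i j \<le> p i / 2 * ?T i j"
    using P T[of i j] by (intro mult_right_mono) auto
  ultimately have "?T i j \<le> 2 * V0 / P" using P by (simp add: field_simps)
  moreover have "c i j * (residual w z i j)\<^sup>2 \<ge> 0" using c[of i j] by simp
  moreover have "(residual w z i j)\<^sup>2 \<le> 1 + (residual w z i j)\<^sup>2 * (residual w z i j)\<^sup>2"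
    using sum_squares_bound[of 1 "(residual w z i j)\<^sup>2"] by (simp add: power2_eq_square) (smt (verit) zero_le_square)
  moreover have "(residual w z i j)\<^sup>2 * (residual w z i j)\<^sup>2 \<ge> 0" "(c i j - \<alpha>)\<^sup>2 \<ge> 0" by simp_all
  ultimately show "(residual w z i j)\<^sup>2 \<le> 1 + 2 * V0 / P" "(c i j - \<alpha>)\<^sup>2 \<le> 2 * V0 / P"
    by (simp_all only: distrib_right)
qed

text \<open>The bound does not depend on the length of the interval, since the Lyapunov function does not increase
and the gains stay above their positive initial values.\<close>

lemma apriori_bound:
  assumes c0: "\<And>i j. c0 i j > 0"
  obtains B where "\<And>T w z c i j. T \<ge> 0 \<Longrightarrow> trajectory {0..T} w z c \<Longrightarrow> w 0 = w0 \<Longrightarrow>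
      (\<And>i. z i 0 = z0 i) \<Longrightarrow> (\<And>i j. c i j 0 = c0 i j) \<Longrightarrow>
      \<bar>w T $ j\<bar> \<le> B \<and> \<bar>z i T $ j\<bar> \<le> B \<and> \<bar>c i j T\<bar> \<le> B"
proof -
  obtain K \<alpha> where K: "K > 0" and rate: "\<And>w z c. lyapunov_rate K \<alpha> w z c \<le> - dissipation w z"
    using lyapunov_rate_le by metis
  define P where "P = Min (range p)"
  have P: "P > 0" "P \<le> p i" for i using p_pos by (auto simp: P_def)
  \<comment> \<open>V0 depends on the initial values only, and so do all bounds derived from it.\<close>
  define V0 where "V0 = lyapunov K \<alpha> w0 z0 c0"
  \<comment> \<open>B1, B2 and B3 bound the distance of w to the equilibrium, of c to \<alpha>, and of z to w. The summand 1
    turns a bound on a square into a bound on the absolute value.\<close>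
  define B1 where "B1 = 1 + 2 * \<bar>V0\<bar> / K"
  define B2 where "B2 = 1 + 2 * \<bar>V0\<bar> / P"
  define B3 where "B3 = 1 + 2 * C_res / \<mu> * (real CARD('n) * (real CARD('n) * B2))"
  define Y where "Y = Max (range (\<lambda>j. \<bar>ystar $ j\<bar>))"
  have Y: "\<bar>ystar $ j\<bar> \<le> Y" for j by (simp add: Y_def)
  define B where "B = Y + B1 + B3 + B2 + \<bar>\<alpha>\<bar>"
  have abs_le: "\<bar>x\<bar> \<le> 1 + y" if "x\<^sup>2 \<le> y" for x y :: real
    using that sum_squares_bound[of 1 "\<bar>x\<bar>"] by simp
  have B_nn: "B1 \<ge> 1" "B2 \<ge> 1" "B3 \<ge> 1"
    using K P C_nonneg \<mu> by (auto simp: B1_def B2_def B3_def)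
  show ?thesis
  proof
    fix T w z c i j
    assume T: "T \<ge> 0" and traj: "trajectory {0..T} w z c" and w0: "w 0 = w0"
      and z0: "\<And>i. z i 0 = z0 i" and c0': "\<And>i j. c i j 0 = c0 i j"
    have c_pos: "c i j T > 0" for i j
      using gain_mono[OF traj T, of i j] c0[of i j] c0'[of i j] by simp
    let ?V = "\<lambda>s. lyapunov K \<alpha> (w s) (\<lambda>i. z i s) (\<lambda>i j. c i j s)"
    have "?V T \<le> ?V 0"
    proof (cases "T = 0")
      case False
      then have "0 < T" using T by simp
      let ?V' = "\<lambda>s. lyapunov_rate K \<alpha> (w s) (\<lambda>i. z i s) (\<lambda>i j. c i j s)"
      obtain r where r: "0 < r" "r < T" "?V T - ?V 0 = ?V' r * (T - 0)"
        by (rule real_MVT_within[OF \<open>0 < T\<close>, of "{0..T}" ?V ?V'])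
          (use lyapunov_has_derivative[OF traj] in auto)
      have "?V' r \<le> 0"
        using rate[of "w r"] by (rule order_trans) (simp add: dissipation_nonneg)
      then show ?thesis using r \<open>0 < T\<close> by (smt (verit) mult_nonpos_nonneg)
    qed simp
    then have V: "lyapunov K \<alpha> (w T) (\<lambda>i. z i T) (\<lambda>i j. c i j T) \<le> \<bar>V0\<bar>"
      using w0 z0 c0' by (simp add: V0_def)
    note bounds = lyapunov_bound[OF V c_pos K P]
    have "(w T $ j - ystar $ j)\<^sup>2 \<le> (\<Sum>j\<in>UNIV. (w T $ j - ystar $ j)\<^sup>2)"
      by (rule member_le_sum[where f="\<lambda>j. (w T $ j - ystar $ j)\<^sup>2"]) auto
    then have w_le: "\<bar>w T $ j - ystar $ j\<bar> \<le> B1" unfolding B1_def using bounds(1) by (intro abs_le) linarith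
    have "(\<Sum>j\<in>UNIV. \<Sum>i\<in>UNIV. (residual (w T) (\<lambda>i. z i T) i j)\<^sup>2) \<le> (\<Sum>j\<in>(UNIV::'n set). \<Sum>i\<in>(UNIV::'n set). B2)"
      unfolding B2_def by (intro sum_mono bounds(2))
    then have "2 * C_res / \<mu> * (\<Sum>j\<in>UNIV. \<Sum>i\<in>UNIV. (residual (w T) (\<lambda>i. z i T) i j)\<^sup>2)
        \<le> 2 * C_res / \<mu> * (real CARD('n) * (real CARD('n) * B2))"
      using C_nonneg \<mu> by (intro mult_left_mono) auto
    moreover have "(z i T $ j - w T $ j)\<^sup>2 \<le> (\<Sum>j\<in>UNIV. \<Sum>i\<in>UNIV. (z i T $ j - w T $ j)\<^sup>2)"
    proof -
      have "(z i T $ j - w T $ j)\<^sup>2 \<le> (\<Sum>i\<in>UNIV. (z i T $ j - w T $ j)\<^sup>2)"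
        by (rule member_le_sum[where f="\<lambda>i. (z i T $ j - w T $ j)\<^sup>2"]) auto
      also have "\<dots> \<le> (\<Sum>j\<in>UNIV. \<Sum>i\<in>UNIV. (z i T $ j - w T $ j)\<^sup>2)"
        by (rule member_le_sum[where f="\<lambda>j. \<Sum>i\<in>UNIV. (z i T $ j - w T $ j)\<^sup>2"]) (auto intro!: sum_nonneg)
      finally show ?thesis .
    qed
    ultimately have z_le: "\<bar>z i T $ j - w T $ j\<bar> \<le> B3"
      unfolding B3_def using error_le_residual[of "\<lambda>i. z i T" "w T"] by (intro abs_le) linarith
    have c_le: "\<bar>c i j T - \<alpha>\<bar> \<le> B2" unfolding B2_def using bounds(3) by (intro abs_le)
    show "\<bar>w T $ j\<bar> \<le> B \<and> \<bar>z i T $ j\<bar> \<le> B \<and> \<bar>c i j T\<bar> \<le> B"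
      using w_le z_le c_le Y[of j] B_nn abs_ge_zero[of "ystar $ j"] unfolding B_def by (auto simp: abs_le_iff)
  qed
qed

text \<open>The dissipation tends to zero: it is dominated by the decay of the Lyapunov function and has a bounded
derivative, being built from bounded signals. It controls \<open>w - y\<^sup>*\<close> and, by coercivity, the errors
\<open>z - w\<close>. The gains converge because they are bounded and nondecreasing.\<close>

theorem trajectory_converges:
  assumes traj: "trajectory {0..} w z c" and c_pos: "\<And>i j. c i j 0 > 0"
  shows "((\<lambda>t. w t $ j) \<longlongrightarrow> ystar $ j) at_top" "((\<lambda>t. z i t $ j) \<longlongrightarrow> ystar $ j) at_top"
    "\<exists>L. (c i j \<longlongrightarrow> L) at_top"
proof -
  obtain B where B: "\<And>T w' z' c' i j. T \<ge> 0 \<Longrightarrow> trajectory {0..T} w' z' c' \<Longrightarrow> w' 0 = w 0 \<Longrightarrow>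
      (\<And>i. z' i 0 = z i 0) \<Longrightarrow> (\<And>i j. c' i j 0 = c i j 0) \<Longrightarrow>
      \<bar>w' T $ j\<bar> \<le> B \<and> \<bar>z' i T $ j\<bar> \<le> B \<and> \<bar>c' i j T\<bar> \<le> B"
    using apriori_bound[of "\<lambda>i j. c i j 0" "w 0" "\<lambda>i. z i 0"] c_pos by metis
  have bnd: "\<bar>w t $ j\<bar> \<le> B \<and> \<bar>z i t $ j\<bar> \<le> B \<and> \<bar>c i j t\<bar> \<le> B" if "t \<ge> 0" for t i j
    using B[OF that trajectory_subset[OF traj]] by auto
  have bw: "bounded_on_halfline (\<lambda>t. w t $ j)" and bz: "bounded_on_halfline (\<lambda>t. z i t $ j)"
    and bc: "bounded_on_halfline (\<lambda>t. c i j t)" for i j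
    using bnd by (auto intro!: bounded_on_halflineI[of _ B])
  have bg: "bounded_on_halfline (\<lambda>t. g j (z j t))" for j
  proof (rule bounded_on_halflineI)
    fix t :: real assume "t \<ge> 0"
    have "\<bar>g j (z j t)\<bar> \<le> l j * norm (z j t - ystar)" using g_lipschitz[of j "z j t" ystar] g_zero by simp
    also have "\<dots> \<le> \<bar>l j\<bar> * (\<Sum>k\<in>UNIV. \<bar>(z j t - ystar) $ k\<bar>)"
      by (intro mult_mono norm_le_l1_cart) auto
    also have "\<dots> \<le> \<bar>l j\<bar> * (\<Sum>k\<in>UNIV. B + \<bar>ystar $ k\<bar>)"
      using bnd[OF \<open>t \<ge> 0\<close>] by (intro mult_left_mono sum_mono) (auto intro: order_trans[OF abs_triangle_ineq4])
    finally show "\<bar>g j (z j t)\<bar> \<le> \<bar>l j\<bar> * (\<Sum>k\<in>UNIV. B + \<bar>ystar $ k\<bar>)" .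
  qed
  have br: "bounded_on_halfline (\<lambda>t. residual (w t) (\<lambda>i. z i t) i j)" for i j
    unfolding residual_def pinned_laplacian_def by (intro bounded_on_halfline_intros bw bz)
  have bf: "bounded_on_halfline (\<lambda>t. feedback (w t) (\<lambda>i. z i t) (\<lambda>i j. c i j t) i j)" for i j
    unfolding feedback_def by (intro bounded_on_halfline_intros br bc)
  have brr: "bounded_on_halfline (\<lambda>t. residual_rate (w t) (\<lambda>i. z i t) (\<lambda>i j. c i j t) i j)" for i j
    unfolding residual_rate_def pinned_laplacian_def by (intro bounded_on_halfline_intros bf bg)
  obtain K \<alpha> where K: "K > 0" and rate: "\<And>w z c. lyapunov_rate K \<alpha> w z c \<le> - dissipation w z"
    using lyapunov_rate_le by metis
  let ?h = "\<lambda>t. dissipation (w t) (\<lambda>i. z i t)"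
  let ?h' = "\<lambda>t. (\<Sum>j\<in>UNIV. 2 * ((w t $ j - ystar $ j) * - g j (z j t))) + (\<Sum>j\<in>UNIV. \<Sum>i\<in>UNIV.
     2 * (residual (w t) (\<lambda>i. z i t) i j * residual_rate (w t) (\<lambda>i. z i t) (\<lambda>i j. c i j t) i j))"
  have c_nonneg: "c i j t > 0" if "t \<ge> 0" for i j t
    using gain_mono[OF traj that, of i j] c_pos[of i j] by auto
  have "bounded_on_halfline ?h'"
    by (intro bounded_on_halfline_intros bw bg br brr)
  then obtain M where M: "\<And>t. t \<ge> 0 \<Longrightarrow> \<bar>?h' t\<bar> \<le> M" by (auto simp: bounded_on_halfline_def)
  have h_lim: "(?h \<longlongrightarrow> 0) at_top"
  proof (rule tendsto_0_if_dissipated)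
    fix t :: real assume t: "t \<ge> 0"
    show "((\<lambda>t. lyapunov K \<alpha> (w t) (\<lambda>i. z i t) (\<lambda>i j. c i j t)) has_real_derivative
        lyapunov_rate K \<alpha> (w t) (\<lambda>i. z i t) (\<lambda>i j. c i j t)) (at t within {0..})"
      using lyapunov_has_derivative[OF traj] t by simp
    show "lyapunov_rate K \<alpha> (w t) (\<lambda>i. z i t) (\<lambda>i j. c i j t) \<le> - ?h t" by (rule rate)
    show "lyapunov K \<alpha> (w t) (\<lambda>i. z i t) (\<lambda>i j. c i j t) \<ge> 0"
      unfolding lyapunov_def using K p_pos c_nonneg[OF t]
      by (intro add_nonneg_nonneg mult_nonneg_nonneg sum_nonneg) (auto simp: less_imp_le)
    have w: "((\<lambda>s. w s $ j) has_real_derivative - g j (z j t)) (at t within {0..})" for j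
      using traj t by (simp add: trajectory_def)
    have "((\<lambda>s. (w s $ j - ystar $ j)\<^sup>2) has_real_derivative 2 * ((w t $ j - ystar $ j) * - g j (z j t)))
        (at t within {0..})" for j
      by (rule derivative_eq_intros w refl)+ simp
    moreover have "((\<lambda>s. (residual (w s) (\<lambda>i. z i s) i j)\<^sup>2) has_real_derivative
        2 * (residual (w t) (\<lambda>i. z i t) i j * residual_rate (w t) (\<lambda>i. z i t) (\<lambda>i j. c i j t) i j))
        (at t within {0..})" for i j
      by (rule derivative_eq_intros residual_has_derivative[OF traj] refl)+ (use t in simp_all)
    ultimately show "(?h has_real_derivative ?h' t) (at t within {0..})"
      unfolding dissipation_def by (intro DERIV_add DERIV_sum)
    show "\<bar>?h' t\<bar> \<le> M" using M t by blast
    show "?h t \<ge> 0" by (rule dissipation_nonneg)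
  qed
  have w_le: "(w t $ j - ystar $ j)\<^sup>2 \<le> ?h t" for t j
    unfolding dissipation_def
    using member_le_sum[where f="\<lambda>j. (w t $ j - ystar $ j)\<^sup>2" and i=j and A=UNIV]
    by (auto intro!: add_increasing2 sum_nonneg)
  have z_le: "(z i t $ j - w t $ j)\<^sup>2 \<le> 2 * C_res / \<mu> * ?h t" for t i j
  proof -
    have "(z i t $ j - w t $ j)\<^sup>2 \<le> (\<Sum>i\<in>UNIV. (z i t $ j - w t $ j)\<^sup>2)"
      by (rule member_le_sum[where f="\<lambda>i. (z i t $ j - w t $ j)\<^sup>2"]) auto
    also have "\<dots> \<le> (\<Sum>j\<in>UNIV. \<Sum>i\<in>UNIV. (z i t $ j - w t $ j)\<^sup>2)"
      by (rule member_le_sum[where f="\<lambda>j. \<Sum>i\<in>UNIV. (z i t $ j - w t $ j)\<^sup>2"]) (auto intro!: sum_nonneg)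
    also have "\<dots> \<le> 2 * C_res / \<mu> * (\<Sum>j\<in>UNIV. \<Sum>i\<in>UNIV. (residual (w t) (\<lambda>i. z i t) i j)\<^sup>2)"
      by (rule error_le_residual)
    also have "\<dots> \<le> 2 * C_res / \<mu> * ?h t"
      unfolding dissipation_def using C_nonneg \<mu> by (intro mult_left_mono) (auto simp: sum_nonneg)
    finally show ?thesis .
  qed
  have square_lim: "(f \<longlongrightarrow> 0) at_top" if "\<And>t. (f t)\<^sup>2 \<le> C * ?h t" for f :: "real \<Rightarrow> real" and C
  proof -
    have "((\<lambda>t. (f t)\<^sup>2) \<longlongrightarrow> 0) at_top"
      by (rule tendsto_sandwich[OF _ _ tendsto_const tendsto_mult_right_zero[OF h_lim, of C]])
        (auto simp: that)
    then have "((\<lambda>t. sqrt ((f t)\<^sup>2)) \<longlongrightarrow> sqrt 0) at_top" by (rule tendsto_real_sqrt)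
    then show ?thesis by (simp add: tendsto_rabs_zero_iff)
  qed
  have w_lim: "((\<lambda>t. w t $ j - ystar $ j) \<longlongrightarrow> 0) at_top" for j
    by (rule square_lim[of _ 1]) (simp add: w_le)
  then show "((\<lambda>t. w t $ j) \<longlongrightarrow> ystar $ j) at_top" by (simp add: LIM_zero_iff)
  have "((\<lambda>t. z i t $ j - w t $ j) \<longlongrightarrow> 0) at_top"
    by (rule square_lim) (rule z_le)
  from tendsto_add[OF this w_lim[of j]] show "((\<lambda>t. z i t $ j) \<longlongrightarrow> ystar $ j) at_top"
    by (simp add: LIM_zero_iff)
  show "\<exists>L. (c i j \<longlongrightarrow> L) at_top"
    by (rule mono_bounded_tendsto[of "c i j" B]) (use gain_mono[OF traj] bnd in \<open>force simp: abs_le_iff\<close>)+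
qed

end

section \<open>Existence of estimator trajectories\<close>

text \<open>Existence of some Lipschitz constant; on compact sets this is stable under products.\<close>

definition lipschitzian_on :: "'a::metric_space set \<Rightarrow> ('a \<Rightarrow> real) \<Rightarrow> bool" where
  "lipschitzian_on S f \<longleftrightarrow> (\<exists>L. L-lipschitz_on S f)"

lemma lipschitzian_on_add: "lipschitzian_on S f \<Longrightarrow> lipschitzian_on S g \<Longrightarrow> lipschitzian_on S (\<lambda>x. f x + g x)"
  unfolding lipschitzian_on_def by (blast intro: lipschitz_on_add)

lemma lipschitzian_on_diff: "lipschitzian_on S f \<Longrightarrow> lipschitzian_on S g \<Longrightarrow> lipschitzian_on S (\<lambda>x. f x - g x)"
  unfolding lipschitzian_on_def by (blast intro: lipschitz_on_diff)

lemma lipschitzian_on_minus: "lipschitzian_on S f \<Longrightarrow> lipschitzian_on S (\<lambda>x. - f x)"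
  unfolding lipschitzian_on_def by (blast intro: lipschitz_on_minus)

lemma lipschitzian_on_const: "lipschitzian_on S (\<lambda>_. c)"
  unfolding lipschitzian_on_def by (blast intro: lipschitz_on_constant)

lemma lipschitzian_on_sum:
  "(\<And>i. i \<in> A \<Longrightarrow> lipschitzian_on S (f i)) \<Longrightarrow> lipschitzian_on S (\<lambda>x. \<Sum>i\<in>A. f i x)"
  by (induction A rule: infinite_finite_induct)
    (simp_all add: lipschitzian_on_const lipschitzian_on_add)

lemma lipschitzian_on_mult:
  assumes "compact S" "lipschitzian_on S f" "lipschitzian_on S g"
  shows "lipschitzian_on S (\<lambda>x. f x * g x)"
proof -
  have bounded: "\<exists>M\<ge>0. \<forall>x\<in>S. \<bar>h x\<bar> \<le> M" if "lipschitzian_on S h" for h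
  proof -
    have "continuous_on S h"
      using that unfolding lipschitzian_on_def by (blast intro: lipschitz_on_continuous_on)
    then have "bounded (h ` S)" using assms(1) by (blast intro: compact_imp_bounded compact_continuous_image)
    then obtain M where "M > 0" "\<forall>x\<in>S. \<bar>h x\<bar> \<le> M" unfolding bounded_pos by auto
    then show ?thesis by (meson less_imp_le)
  qed
  obtain M where M: "M \<ge> 0" "\<And>x. x \<in> S \<Longrightarrow> \<bar>f x\<bar> \<le> M" using bounded[OF assms(2)] by blast
  obtain N where N: "N \<ge> 0" "\<And>x. x \<in> S \<Longrightarrow> \<bar>g x\<bar> \<le> N" using bounded[OF assms(3)] by blast
  obtain K where K: "K-lipschitz_on S f" using assms(2) by (auto simp: lipschitzian_on_def)
  obtain L where L: "L-lipschitz_on S g" using assms(3) by (auto simp: lipschitzian_on_def)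
  have "(M * L + K * N)-lipschitz_on S (\<lambda>x. f x * g x)"
  proof (rule lipschitz_onI)
    fix x y assume x: "x \<in> S" and y: "y \<in> S"
    have "f x * g x - f y * g y = f x * (g x - g y) + (f x - f y) * g y" by (simp add: algebra_simps)
    then have "dist (f x * g x) (f y * g y) \<le> \<bar>f x\<bar> * \<bar>g x - g y\<bar> + \<bar>f x - f y\<bar> * \<bar>g y\<bar>"
      unfolding dist_real_def by (metis abs_mult abs_triangle_ineq)
    also have "\<dots> \<le> M * (L * dist x y) + (K * dist x y) * N"
      using M N x y lipschitz_onD[OF K x y] lipschitz_onD[OF L x y]
        lipschitz_on_nonneg[OF K] lipschitz_on_nonneg[OF L]
      by (intro add_mono mult_mono) (auto simp: dist_real_def)
    finally show "dist (f x * g x) (f y * g y) \<le> (M * L + K * N) * dist x y"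
      by (simp add: algebra_simps)
  qed (use M N lipschitz_on_nonneg[OF K] lipschitz_on_nonneg[OF L] in simp)
  then show ?thesis unfolding lipschitzian_on_def by blast
qed

lemma lipschitzian_on_power:
  "compact S \<Longrightarrow> lipschitzian_on S f \<Longrightarrow> lipschitzian_on S (\<lambda>x. f x ^ n)"
  by (induction n) (simp_all add: lipschitzian_on_const lipschitzian_on_mult)

lemma lipschitzian_on_nth: "lipschitzian_on S (\<lambda>x :: real ^ 'k::finite. x $ k)"
  unfolding lipschitzian_on_def
  by (intro exI[of _ 1] lipschitz_onI) (auto simp: dist_vec_nth_le)

lemma lipschitz_on_vecI:
  fixes F :: "'a::metric_space \<Rightarrow> real ^ 'k::finite"
  assumes "\<And>k. lipschitzian_on S (\<lambda>x. F x $ k)"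
  shows "\<exists>L. L-lipschitz_on S F"
proof -
  obtain L where L: "\<And>k. (L k)-lipschitz_on S (\<lambda>x. F x $ k)"
    using assms unfolding lipschitzian_on_def by metis
  have "(\<Sum>k\<in>UNIV. L k)-lipschitz_on S F"
  proof (rule lipschitz_onI)
    fix x y assume "x \<in> S" "y \<in> S"
    have "dist (F x) (F y) \<le> (\<Sum>k\<in>UNIV. \<bar>(F x - F y) $ k\<bar>)" unfolding dist_norm by (rule norm_le_l1_cart)
    also have "\<dots> \<le> (\<Sum>k\<in>UNIV. L k * dist x y)"
      using lipschitz_onD[OF L \<open>x \<in> S\<close> \<open>y \<in> S\<close>] by (intro sum_mono) (simp add: dist_real_def)
    finally show "dist (F x) (F y) \<le> (\<Sum>k\<in>UNIV. L k) * dist x y" by (simp add: sum_distrib_right)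
  qed (use lipschitz_on_nonneg[OF L] in \<open>simp add: sum_nonneg\<close>)
  then show ?thesis by blast
qed

context estimator_network
begin

text \<open>The triple \<open>(w, z, c)\<close> is packed into one Euclidean vector whose index type is the sum of the three
index types.\<close>

theorem trajectory_exists:
  assumes c0: "\<And>i j. c0 i j > 0"
  obtains w z c where "trajectory {0..} w z c" "w 0 = w0" "\<And>i. z i 0 = z0 i" "\<And>i j. c i j 0 = c0 i j"
proof -
  define W :: "real ^ ('n + 'n \<times> 'n + 'n \<times> 'n) \<Rightarrow> real ^ 'n" where "W u = (\<chi> j. u $ Inl j)" for u
  define Z :: "real ^ ('n + 'n \<times> 'n + 'n \<times> 'n) \<Rightarrow> 'n \<Rightarrow> real ^ 'n"
    where "Z u i = (\<chi> j. u $ Inr (Inl (i, j)))" for u i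
  define C :: "real ^ ('n + 'n \<times> 'n + 'n \<times> 'n) \<Rightarrow> 'n \<Rightarrow> 'n \<Rightarrow> real"
    where "C u i j = u $ Inr (Inr (i, j))" for u i j
  define F :: "real ^ ('n + 'n \<times> 'n + 'n \<times> 'n) \<Rightarrow> real ^ ('n + 'n \<times> 'n + 'n \<times> 'n)"
    where "F u = (\<chi> k. case k of Inl j \<Rightarrow> - g j (Z u j)
      | Inr (Inl (i, j)) \<Rightarrow> - feedback (W u) (Z u) (C u) i j
      | Inr (Inr (i, j)) \<Rightarrow> (residual (W u) (Z u) i j)\<^sup>2)" for u
  define u0 :: "real ^ ('n + 'n \<times> 'n + 'n \<times> 'n)" where
    "u0 = (\<chi> k. case k of Inl j \<Rightarrow> w0 $ j | Inr (Inl (i, j)) \<Rightarrow> z0 i $ j | Inr (Inr (i, j)) \<Rightarrow> c0 i j)"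
  have init: "W u0 = w0" "Z u0 = z0" "C u0 = c0"
    by (auto simp: W_def Z_def C_def u0_def Finite_Cartesian_Product.vec_eq_iff fun_eq_iff)
  have entries: "W u $ j = u $ Inl j" "Z u i $ j = u $ Inr (Inl (i, j))" for u i j
    by (simp_all add: W_def Z_def)
  have traj: "trajectory S (\<lambda>t. W (u t)) (\<lambda>i t. Z (u t) i) (\<lambda>i j t. C (u t) i j)"
    if u: "\<And>t. t \<in> S \<Longrightarrow> (u has_vector_derivative F (u t)) (at t within S)" for u S
  proof -
    have co: "((\<lambda>s. u s $ k) has_real_derivative F (u t) $ k) (at t within S)" if "t \<in> S" for t k
      using bounded_linear.has_vector_derivative[OF bounded_linear_vec_nth u[OF that], of k]
      by (simp add: has_real_derivative_iff_has_vector_derivative)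
    show ?thesis
      unfolding trajectory_def
    proof (intro ballI allI conjI)
      fix t i j assume t: "t \<in> S"
      show "((\<lambda>s. W (u s) $ j) has_real_derivative - g j (Z (u t) j)) (at t within S)"
        using co[OF t, of "Inl j"] by (simp add: entries F_def)
      show "((\<lambda>s. Z (u s) i $ j) has_real_derivative
          - feedback (W (u t)) (\<lambda>i. Z (u t) i) (\<lambda>i j. C (u t) i j) i j) (at t within S)"
        using co[OF t, of "Inr (Inl (i, j))"] by (simp add: entries F_def)
      show "((\<lambda>s. C (u s) i j) has_real_derivative (residual (W (u t)) (\<lambda>i. Z (u t) i) i j)\<^sup>2) (at t within S)"
        using co[OF t, of "Inr (Inr (i, j))"] by (simp add: C_def F_def)
    qed
  qed
  obtain B where B: "\<And>T w z c i j. T \<ge> 0 \<Longrightarrow> trajectory {0..T} w z c \<Longrightarrow> w 0 = w0 \<Longrightarrow>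
      (\<And>i. z i 0 = z0 i) \<Longrightarrow> (\<And>i j. c i j 0 = c0 i j) \<Longrightarrow>
      \<bar>w T $ j\<bar> \<le> B \<and> \<bar>z i T $ j\<bar> \<le> B \<and> \<bar>c i j T\<bar> \<le> B"
    using apriori_bound[of c0 w0 z0] c0 by metis
  define B' where "B' = max (norm u0) (real CARD('n + 'n \<times> 'n + 'n \<times> 'n) * B)"
  have loc_lip: "\<exists>L. L-lipschitz_on (cball 0 M) F" for M
  proof (rule lipschitz_on_vecI)
    let ?S = "cball 0 M :: (real ^ ('n + 'n \<times> 'n + 'n \<times> 'n)) set"
    have lw: "lipschitzian_on ?S (\<lambda>u. W u $ j)" and lz: "lipschitzian_on ?S (\<lambda>u. Z u i $ j)"
      and lc: "lipschitzian_on ?S (\<lambda>u. C u i j)" for i j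
      by (simp_all add: W_def Z_def C_def lipschitzian_on_nth)
    have lr: "lipschitzian_on ?S (\<lambda>u. residual (W u) (Z u) i j)" for i j
      unfolding residual_def pinned_laplacian_def
      by (intro lipschitzian_on_add lipschitzian_on_sum lipschitzian_on_mult lipschitzian_on_diff
          lipschitzian_on_const lz lw compact_cball)
    have lf: "lipschitzian_on ?S (\<lambda>u. feedback (W u) (Z u) (C u) i j)" for i j
      unfolding feedback_def
      by (intro lipschitzian_on_add lipschitzian_on_mult lipschitzian_on_power lr lc compact_cball)
    have lg: "lipschitzian_on ?S (\<lambda>u. g j (Z u j))" for j
    proof -
      obtain L where L: "L-lipschitz_on ?S (\<lambda>u. Z u j)" using lipschitz_on_vecI[OF lz] by blast
      have "\<bar>l j\<bar>-lipschitz_on UNIV (g j)"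
      proof (rule lipschitz_onI)
        show "dist (g j y) (g j y') \<le> \<bar>l j\<bar> * dist y y'" for y y'
          using g_lipschitz[of j y y'] mult_right_mono[OF abs_ge_self[of "l j"] norm_ge_zero[of "y - y'"]]
          by (simp add: dist_norm)
      qed simp
      then have "(\<bar>l j\<bar> * L)-lipschitz_on ?S (\<lambda>u. g j (Z u j))"
        using L by (intro lipschitz_on_compose2) (auto intro: lipschitz_on_subset)
      then show ?thesis unfolding lipschitzian_on_def by blast
    qed
    fix k :: "'n + 'n \<times> 'n + 'n \<times> 'n"
    consider j where "k = Inl j" | i j where "k = Inr (Inl (i, j))" | i j where "k = Inr (Inr (i, j))"
      by (metis sum.exhaust surj_pair)
    then show "lipschitzian_on ?S (\<lambda>u. F u $ k)"
      by cases (auto simp: F_def intro!: lipschitzian_on_minus lg lf lipschitzian_on_power lr compact_cball)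
  qed
  obtain u where u: "u 0 = u0" "\<And>t. t \<ge> 0 \<Longrightarrow> (u has_vector_derivative F (u t)) (at t within {0..})"
  proof (rule bounded_ode_has_solution[of F u0 B'])
    show "norm u0 \<le> B'" by (simp add: B'_def)
    fix T u assume T: "T \<ge> 0" and u: "u 0 = u0"
      "\<And>t. t \<in> {0..T} \<Longrightarrow> (u has_vector_derivative F (u t)) (at t within {0..T})"
    have comps: "\<bar>W (u T) $ j\<bar> \<le> B \<and> \<bar>Z (u T) i $ j\<bar> \<le> B \<and> \<bar>C (u T) i j\<bar> \<le> B" for i j
      using B[OF T traj[of "{0..T}" u, OF u(2)], of j i] u(1) init by simp
    have "\<bar>u T $ k\<bar> \<le> B" for k
    proof -
      consider j where "k = Inl j" | i j where "k = Inr (Inl (i, j))" | i j where "k = Inr (Inr (i, j))"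
        by (metis sum.exhaust surj_pair)
      then show ?thesis using comps by cases (auto simp: W_def Z_def C_def)
    qed
    then have "(\<Sum>k\<in>UNIV. \<bar>u T $ k\<bar>) \<le> real CARD('n + 'n \<times> 'n + 'n \<times> 'n) * B"
      by (rule sum_bounded_above)
    then show "norm (u T) \<le> B'" using norm_le_l1_cart[of "u T"] by (simp add: B'_def)
  qed (use loc_lip in blast)+
  show ?thesis
  proof
    show "trajectory {0..} (\<lambda>t. W (u t)) (\<lambda>i t. Z (u t) i) (\<lambda>i j t. C (u t) i j)"
      by (rule traj) (use u in simp)
  qed (use u init in simp_all)
qed

end

section \<open>The change of coordinates\<close>

lemma pow_mat_mult_vec:
  assumes "A \<in> carrier_mat n n" "v \<in> carrier_vec n"
  shows "(A ^\<^sub>m k) *\<^sub>v v = (((*\<^sub>v) A) ^^ k) v"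
  using assms(2)
proof (induction k arbitrary: v)
  case 0
  then show ?case using assms(1) by simp
next
  case (Suc k)
  have "(A ^\<^sub>m Suc k) *\<^sub>v v = (A ^\<^sub>m k) *\<^sub>v (A *\<^sub>v v)"
    using assms(1) Suc.prems by (simp add: assoc_mult_mat_vec[of _ n n _ n])
  also have "\<dots> = (((*\<^sub>v) A) ^^ Suc k) v"
    using Suc assms(1) by (simp add: funpow_swap1)
  finally show ?case .
qed

lemma funpow_mult_vec_carrier:
  assumes "A \<in> carrier_mat n n" "v \<in> carrier_vec n"
  shows "(((*\<^sub>v) A) ^^ k) v \<in> carrier_vec n"
  using assms by (induction k) auto

lemma A_mat_carrier: "A_mat m \<in> carrier_mat m m" by (simp add: A_mat_def)
lemma Abar_mat_carrier: "Abar_mat m \<theta> \<in> carrier_mat m m" by (simp add: Abar_mat_def)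
lemma B_vec_carrier: "B_vec m \<in> carrier_vec m" by (simp add: B_vec_def)
lemma Bbar_vec_carrier: "Bbar_vec m \<in> carrier_vec m" by (simp add: Bbar_vec_def)

lemma A_mat_mult_vec:
  assumes "v \<in> carrier_vec m" "p < m"
  shows "(A_mat m *\<^sub>v v) $v p = (if p + 1 < m then v $v (p + 1) else 0)"
proof -
  have "(A_mat m *\<^sub>v v) $v p = (\<Sum>q\<in>{0..<m}. (if q = p + 1 then 1 else 0) * v $v q)"
    using assms by (simp add: A_mat_def scalar_prod_def)
  also have "\<dots> = (\<Sum>q\<in>{0..<m}. if q = p + 1 then v $v q else 0)"
    by (intro sum.cong) auto
  finally show ?thesis by (simp only: sum.delta[OF finite_atLeastLessThan]) simp
qed

lemma Abar_mat_mult_vec: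
  assumes "v \<in> carrier_vec m" "p < m"
  shows "(Abar_mat m \<theta> *\<^sub>v v) $v p = (\<Sum>q = p + 1..<m. \<theta> ^ (m - q) * v $v q)"
proof -
  have "(Abar_mat m \<theta> *\<^sub>v v) $v p = (\<Sum>q\<in>{0..<m}. (if p < q then \<theta> ^ (m - q) * v $v q else 0))"
    using assms by (auto simp: Abar_mat_def scalar_prod_def intro!: sum.cong)
  also have "\<dots> = (\<Sum>q\<in>{q\<in>{0..<m}. p < q}. \<theta> ^ (m - q) * v $v q)"
    by (rule sum.inter_filter[symmetric]) simp
  also have "{q\<in>{0..<m}. p < q} = {p + 1..<m}" by auto
  finally show ?thesis .
qed

text \<open>The controllability matrix of \<open>(A, B)\<close> is the reversal of the identity.\<close>

lemma A_mat_orbit: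
  assumes "p < m"
  shows "((((*\<^sub>v) (A_mat m)) ^^ k) (B_vec m)) $v p = (if p + k = m - 1 then 1 else 0)"
  using assms
proof (induction k arbitrary: p)
  case 0
  then show ?case by (auto simp: B_vec_def)
next
  case (Suc k)
  then show ?case
    using A_mat_mult_vec[OF funpow_mult_vec_carrier[OF A_mat_carrier B_vec_carrier], of p m k] by auto
qed

text \<open>Each multiplication by the strictly upper triangular matrix with positive entries empties one more
component from below and keeps the components above it positive. So the controllability matrix is
triangular with respect to its antidiagonal.\<close>

lemma Abar_mat_orbit:
  assumes "\<theta> > 0" "p < m"
  defines "v \<equiv> \<lambda>k. (((*\<^sub>v) (Abar_mat m \<theta>)) ^^ k) (Bbar_vec m)"
  shows "(p + k < m \<longrightarrow> v k $v p > 0) \<and> (p + k \<ge> m \<longrightarrow> v k $v p = 0)"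
  using assms(2)
proof (induction k arbitrary: p)
  case 0
  then show ?case by (auto simp: v_def Bbar_vec_def)
next
  case (Suc k)
  have step: "v (Suc k) $v p = (\<Sum>q = p + 1..<m. \<theta> ^ (m - q) * v k $v q)"
    using Abar_mat_mult_vec[OF funpow_mult_vec_carrier[OF Abar_mat_carrier Bbar_vec_carrier] Suc.prems]
    by (simp add: v_def)
  have nonneg: "\<theta> ^ (m - q) * v k $v q \<ge> 0" if "q \<in> {p + 1..<m}" for q
    using Suc.IH[of q] that \<open>\<theta> > 0\<close> by (cases "q + k < m") auto
  show ?case
  proof (intro conjI impI)
    assume "p + Suc k < m"
    then have "\<theta> ^ (m - (p + 1)) * v k $v (p + 1) > 0" using Suc.IH[of "p + 1"] \<open>\<theta> > 0\<close> by simp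
    moreover have "\<theta> ^ (m - (p + 1)) * v k $v (p + 1) \<le> v (Suc k) $v p"
      unfolding step using nonneg \<open>p + Suc k < m\<close>
      by (intro member_le_sum[where f="\<lambda>q. \<theta> ^ (m - q) * v k $v q"]) auto
    ultimately show "v (Suc k) $v p > 0" by linarith
  next
    assume "p + Suc k \<ge> m"
    then show "v (Suc k) $v p = 0"
      unfolding step using Suc.IH by (intro sum.neutral) auto
  qed
qed

lemma controllability_mat_carrier: "controllability_mat m A B \<in> carrier_mat m m"
  unfolding controllability_mat_def
  by (metis length_map length_upt mat_of_cols_carrier(1) minus_nat.diff_0)

lemma col_controllability_mat:
  assumes "A \<in> carrier_mat m m" "B \<in> carrier_vec m" "k < m"
  shows "col (controllability_mat m A B) k = (((*\<^sub>v) A) ^^ k) B"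
  using assms pow_mat_mult_vec[OF assms(1,2)] funpow_mult_vec_carrier[OF assms(1,2)]
  by (simp add: controllability_mat_def)

text \<open>Substitution along the antidiagonal: row \<open>m - 1 - k\<close> involves only the unknowns up to number \<open>k\<close>.\<close>

lemma anti_triangular_has_inverse:
  fixes M :: "real mat"
  assumes M: "M \<in> carrier_mat m m"
    and zero: "\<And>p k. p < m \<Longrightarrow> k < m \<Longrightarrow> p + k \<ge> m \<Longrightarrow> M $$ (p, k) = 0"
    and diag: "\<And>p k. p < m \<Longrightarrow> k < m \<Longrightarrow> p + k = m - 1 \<Longrightarrow> M $$ (p, k) \<noteq> 0"
  shows "\<exists>N. mat_inverse M = Some N"
proof -
  have "Determinant.det M \<noteq> 0"
  proof
    assume "Determinant.det M = 0"
    then obtain v where v: "v \<in> carrier_vec m" "v \<noteq> 0\<^sub>v m" "M *\<^sub>v v = 0\<^sub>v m"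
      using det_0_iff_vec_prod_zero[OF M] by blast
    have "v $v k = 0" if "k < m" for k
      using that
    proof (induction k rule: less_induct)
      case (less k)
      define p where "p = m - 1 - k"
      have p: "p < m" "p + k = m - 1" using less.prems by (auto simp: p_def)
      have "0 = (M *\<^sub>v v) $v p" using v(3) p by simp
      also have "\<dots> = (\<Sum>q\<in>{0..<m}. M $$ (p, q) * v $v q)"
        using M v(1) p by (auto simp: scalar_prod_def)
      also have "\<dots> = (\<Sum>q\<in>{0..<m}. if q = k then M $$ (p, k) * v $v k else 0)"
      proof (intro sum.cong refl)
        fix q assume q: "q \<in> {0..<m}"
        consider "q < k" | "q = k" | "q > k" by linarith
        then show "M $$ (p, q) * v $v q = (if q = k then M $$ (p, k) * v $v k else 0)"
          using less.IH[of q] zero[of p q] p q by cases auto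
      qed
      also have "\<dots> = M $$ (p, k) * v $v k" using less.prems by simp
      finally show ?case using diag[OF p(1) less.prems p(2)] by simp
    qed
    then have "v = 0\<^sub>v m" using v(1) by auto
    then show False using v(2) by simp
  qed
  then have "M \<in> Units (ring_mat TYPE(real) m undefined)" by (rule det_non_zero_imp_unit[OF M])
  then show ?thesis using mat_inverse(1)[OF M, of undefined] by (cases "mat_inverse M") auto
qed

text \<open>\<open>T\<close> sends the controllability basis of \<open>(Abar, Bbar)\<close> to that of \<open>(A, B)\<close>. Both matrices are nilpotent
of order \<open>m\<close>, so \<open>T\<close> intertwines them on every basis vector, the last one included.\<close>

lemma T_mat_properties:
  assumes \<theta>: "\<theta> > 0" and m: "m > 0"
  obtains S where "T_mat m \<theta> \<in> carrier_mat m m" "S \<in> carrier_mat m m"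
    "mat_inverse (T_mat m \<theta>) = Some S"
    "T_mat m \<theta> * S = 1\<^sub>m m" "S * T_mat m \<theta> = 1\<^sub>m m"
    "T_mat m \<theta> * Abar_mat m \<theta> = A_mat m * T_mat m \<theta>"
    "T_mat m \<theta> *\<^sub>v Bbar_vec m = B_vec m"
proof -
  let ?A = "A_mat m" and ?B = "B_vec m" and ?Ab = "Abar_mat m \<theta>" and ?Bb = "Bbar_vec m"
  define R where "R = controllability_mat m ?A ?B"
  define Rb where "Rb = controllability_mat m ?Ab ?Bb"
  have R: "R \<in> carrier_mat m m" and Rb: "Rb \<in> carrier_mat m m"
    by (simp_all add: R_def Rb_def controllability_mat_carrier)
  have colR: "col R k = (((*\<^sub>v) ?A) ^^ k) ?B" if "k < m" for k
    unfolding R_def by (rule col_controllability_mat[OF A_mat_carrier B_vec_carrier that])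
  have colRb: "col Rb k = (((*\<^sub>v) ?Ab) ^^ k) ?Bb" if "k < m" for k
    unfolding Rb_def by (rule col_controllability_mat[OF Abar_mat_carrier Bbar_vec_carrier that])
  have R_entry: "R $$ (p, k) = (if p + k = m - 1 then 1 else 0)" if "p < m" "k < m" for p k
    using colR[OF that(2)] A_mat_orbit[OF that(1), of k] R that by (metis carrier_matD index_col)
  have Rb_entry: "Rb $$ (p, k) = (((*\<^sub>v) ?Ab) ^^ k) ?Bb $v p" if "p < m" "k < m" for p k
    using colRb[OF that(2)] Rb that by (metis carrier_matD index_col)
  obtain Ri where "mat_inverse R = Some Ri"
    using anti_triangular_has_inverse[OF R] R_entry by force
  then have Ri: "Ri \<in> carrier_mat m m" "R * Ri = 1\<^sub>m m" "Ri * R = 1\<^sub>m m"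
    using mat_inverse(2)[OF R] by auto
  have "\<exists>N. mat_inverse Rb = Some N"
  proof (rule anti_triangular_has_inverse[OF Rb])
    show "Rb $$ (p, k) = 0" if "p < m" "k < m" "p + k \<ge> m" for p k
      using Rb_entry[OF that(1,2)] Abar_mat_orbit[OF \<theta> that(1), of k] that(3) by simp
    show "Rb $$ (p, k) \<noteq> 0" if "p < m" "k < m" "p + k = m - 1" for p k
      using Rb_entry[OF that(1,2)] Abar_mat_orbit[OF \<theta> that(1), of k] that(3) m by simp
  qed
  then obtain Rbi where Rbi_inv: "mat_inverse Rb = Some Rbi" by blast
  then have Rbi: "Rbi \<in> carrier_mat m m" "Rb * Rbi = 1\<^sub>m m" "Rbi * Rb = 1\<^sub>m m"
    using mat_inverse(2)[OF Rb] by auto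
  define T where "T = T_mat m \<theta>"
  have T_eq: "T = R * Rbi" using Rbi_inv by (simp add: T_def T_mat_def R_def Rb_def)
  have T: "T \<in> carrier_mat m m" using R Rbi by (simp add: T_eq)
  have TRb: "T * Rb = R"
    unfolding T_eq using R Rb Rbi by (simp add: assoc_mult_mat[of _ m m _ m _ m])
  define S where "S = Rb * Ri"
  have S: "S \<in> carrier_mat m m" using Rb Ri by (simp add: S_def)
  have TS: "T * S = 1\<^sub>m m"
    unfolding S_def using T Rb Ri TRb by (simp add: assoc_mult_mat[of _ m m _ m _ m, symmetric])
  have ST: "S * T = 1\<^sub>m m" by (rule mat_mult_left_right_inverse[OF T S TS])
  have inv: "mat_inverse T = Some S"
  proof -
    have "T \<in> Units (ring_mat TYPE(real) m undefined)"
      using T S TS ST unfolding Units_def by (auto simp: ring_mat_simps)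
    then obtain N where N: "mat_inverse T = Some N"
      using mat_inverse(1)[OF T, of undefined] by (cases "mat_inverse T") auto
    then have N': "N \<in> carrier_mat m m" "T * N = 1\<^sub>m m" using mat_inverse(2)[OF T] by auto
    have "S = S * (T * N)" using S N' by simp
    also have "\<dots> = (S * T) * N" by (rule assoc_mult_mat[OF S T N'(1), symmetric])
    also have "\<dots> = N" using N' ST by simp
    finally show ?thesis using N by simp
  qed
  have orbit: "T *\<^sub>v ((((*\<^sub>v) ?Ab) ^^ k) ?Bb) = (((*\<^sub>v) ?A) ^^ k) ?B" if "k \<le> m" for k
  proof (cases "k < m")
    case True
    then show ?thesis
      using colR[OF True] colRb[OF True] TRb col_mult2[OF T Rb True] by simp
  next
    case False
    have c1: "(((*\<^sub>v) ?Ab) ^^ k) ?Bb \<in> carrier_vec m" and c2: "(((*\<^sub>v) ?A) ^^ k) ?B \<in> carrier_vec m"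
      by (intro funpow_mult_vec_carrier Abar_mat_carrier Bbar_vec_carrier A_mat_carrier B_vec_carrier)+
    have z1: "(((*\<^sub>v) ?Ab) ^^ k) ?Bb = 0\<^sub>v m"
      by (rule eq_vecI) (use Abar_mat_orbit[OF \<theta>, of _ m k] False c1 in auto)
    have z2: "(((*\<^sub>v) ?A) ^^ k) ?B = 0\<^sub>v m"
      by (rule eq_vecI) (use A_mat_orbit[of _ m k] False m c2 in auto)
    show ?thesis unfolding z1 z2 by (rule eq_vecI) (use T in auto)
  qed
  have TA: "T * ?Ab = ?A * T"
  proof -
    have TAb: "T * ?Ab \<in> carrier_mat m m" and AT: "?A * T \<in> carrier_mat m m"
      using T A_mat_carrier Abar_mat_carrier by (auto intro: mult_carrier_mat)
    have "(T * ?Ab) * Rb = (?A * T) * Rb"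
    proof (rule mat_col_eqI)
      fix k assume "k < dim_col (?A * T * Rb)"
      then have k: "k < m" using Rb by simp
      let ?v = "(((*\<^sub>v) ?Ab) ^^ k) ?Bb"
      have v: "?v \<in> carrier_vec m" by (rule funpow_mult_vec_carrier[OF Abar_mat_carrier Bbar_vec_carrier])
      have "col (T * ?Ab * Rb) k = (T * ?Ab) *\<^sub>v ?v"
        using col_mult2[OF TAb Rb k] colRb[OF k] by simp
      also have "\<dots> = T *\<^sub>v (?Ab *\<^sub>v ?v)" using assoc_mult_mat_vec[OF T Abar_mat_carrier v] .
      also have "\<dots> = ?A *\<^sub>v (T *\<^sub>v ?v)" using orbit[of "Suc k"] orbit[of k] k by simp
      also have "\<dots> = (?A * T) *\<^sub>v ?v" using assoc_mult_mat_vec[OF A_mat_carrier T v] by simp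
      also have "\<dots> = col (?A * T * Rb) k"
        using col_mult2[OF AT Rb k] colRb[OF k] by simp
      finally show "col (T * ?Ab * Rb) k = col (?A * T * Rb) k" .
    qed (use TAb AT Rb in \<open>simp_all only: carrier_mat_def mem_Collect_eq index_mult_mat\<close>)
    then have "(T * ?Ab) * (Rb * Rbi) = (?A * T) * (Rb * Rbi)"
      using assoc_mult_mat[OF TAb Rb Rbi(1)] assoc_mult_mat[OF AT Rb Rbi(1)] by simp
    then show ?thesis unfolding Rbi(2) right_mult_one_mat[OF TAb] right_mult_one_mat[OF AT] .
  qed
  show ?thesis
    using that[of S] T S inv TS ST TA orbit[of 0] by (simp add: T_def)
qed

text \<open>Reading \<open>T Abar = A T\<close> entrywise, each row of \<open>T\<close> determines the next one: \<open>T\<close> is upper triangular and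
its diagonal is multiplied by \<open>\<theta> ^ (m - q)\<close> from \<open>q - 1\<close> to \<open>q\<close>. The last row of \<open>T Bbar = B\<close> says
that the last diagonal entry is 1.\<close>

lemma T_mat_entry_00:
  assumes \<theta>: "\<theta> > 0" and m: "m > 0"
  shows "T_mat m \<theta> $$ (0, 0) * (\<Prod>k = 1..m - 1. \<theta> ^ k) = 1"
proof -
  define T where "T = T_mat m \<theta>"
  have T: "T \<in> carrier_mat m m" and TA: "T * Abar_mat m \<theta> = A_mat m * T"
    and TB: "T *\<^sub>v Bbar_vec m = B_vec m"
    unfolding T_def by (rule T_mat_properties[OF \<theta> m], assumption)+
  have rec: "T $$ (Suc p, q) = \<theta> ^ (m - q) * (\<Sum>s<q. T $$ (p, s))" if "Suc p < m" "q < m" for p q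
  proof -
    have "T $$ (Suc p, q) = (A_mat m * T) $$ (p, q)"
    proof -
      have "(A_mat m * T) $$ (p, q) = (A_mat m *\<^sub>v col T q) $v p"
        using T that A_mat_carrier[of m] by simp
      then show ?thesis using A_mat_mult_vec[of "col T q" m p] T that by auto
    qed
    also have "\<dots> = (T * Abar_mat m \<theta>) $$ (p, q)" by (simp add: TA)
    also have "\<dots> = (\<Sum>s\<in>{0..<m}. if s < q then T $$ (p, s) * \<theta> ^ (m - q) else 0)"
      using T that by (auto simp: Abar_mat_def scalar_prod_def intro!: sum.cong)
    also have "\<dots> = (\<Sum>s\<in>{s\<in>{0..<m}. s < q}. T $$ (p, s) * \<theta> ^ (m - q))"
      by (rule sum.inter_filter[symmetric]) simp
    also have "{s\<in>{0..<m}. s < q} = {..<q}" using that by auto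
    finally show ?thesis by (simp add: sum_distrib_left mult.commute)
  qed
  have lower: "T $$ (p, q) = 0" if "q < p" "p < m" for p q
    using that
  proof (induction p arbitrary: q)
    case (Suc p)
    then show ?case by (subst rec) (auto intro!: sum.neutral)
  qed simp
  have diag: "T $$ (p, p) = T $$ (0, 0) * (\<Prod>q = 1..p. \<theta> ^ (m - q))" if "p < m" for p
    using that
  proof (induction p)
    case (Suc p)
    have "T $$ (Suc p, Suc p) = \<theta> ^ (m - Suc p) * ((\<Sum>s<p. T $$ (p, s)) + T $$ (p, p))"
      using rec[OF Suc.prems Suc.prems] by simp
    also have "(\<Sum>s<p. T $$ (p, s)) = 0" using lower Suc.prems by (intro sum.neutral) auto
    finally show ?case using Suc by (simp add: mult_ac)
  qed simp
  have "1 = (T *\<^sub>v Bbar_vec m) $v (m - 1)" unfolding TB using m by (simp add: B_vec_def)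
  also have "\<dots> = (\<Sum>q\<in>{0..<m}. T $$ (m - 1, q))"
    using T m by (auto simp: Bbar_vec_def scalar_prod_def)
  also have "\<dots> = (\<Sum>q\<in>{0..<m}. if q = m - 1 then T $$ (m - 1, m - 1) else 0)"
    using lower[of _ "m - 1"] m by (intro sum.cong refl) auto
  also have "\<dots> = T $$ (m - 1, m - 1)" using m by simp
  also have "\<dots> = T $$ (0, 0) * (\<Prod>q = 1..m - 1. \<theta> ^ (m - q))" by (rule diag) (use m in simp)
  also have "(\<Prod>q = 1..m - 1. \<theta> ^ (m - q)) = (\<Prod>k = 1..m - 1. \<theta> ^ k)"
    by (rule prod.reindex_bij_witness[of _ "\<lambda>k. m - k" "\<lambda>k. m - k"]) auto
  finally show ?thesis by (simp add: T_def)
qed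

section \<open>The tracking loop of a single player\<close>

lemma continuous_on_halfline_if_deriv:
  fixes h :: "real \<Rightarrow> real"
  assumes "\<And>t. t \<ge> 0 \<Longrightarrow> (h has_real_derivative h' t) (at t within {0..})"
  shows "continuous_on {0..} h"
  using assms by (auto simp: continuous_on_eq_continuous_within intro: DERIV_continuous)

lemma bar_field_nth:
  assumes "v \<in> carrier_vec m" "k < m"
  shows "(Abar_mat m \<theta> *\<^sub>v v + u \<cdot>\<^sub>v Bbar_vec m) $v k = (\<Sum>q = k + 1..<m. \<theta> ^ (m - q) * v $v q) + u"
  using assms Abar_mat_mult_vec[OF assms, of \<theta>] Abar_mat_carrier[of m \<theta>] by (simp add: Bbar_vec_def)

lemma mult_mat_vec_nth:
  assumes "M \<in> carrier_mat m m" "v \<in> carrier_vec m" "k < m"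
  shows "(M *\<^sub>v v) $v k = (\<Sum>q<m. M $$ (k, q) * v $v q)"
  using assms by (simp add: scalar_prod_def lessThan_atLeast0)

text \<open>Up to reversing the order of the coordinates and adding the tracked signal to the first one, the
transformed state is the saturated cascade; the drift of the signal is the vanishing disturbance.\<close>

lemma player_converges:
  fixes x :: "real \<Rightarrow> real Matrix.vec" and \<sigma> \<sigma>' :: "real \<Rightarrow> real"
  assumes m: "m > 1" and \<theta>: "0 < \<theta>" "\<theta> < 1 / 2" and \<Delta>: "\<Delta> > 0"
    and carrier: "\<And>t. t \<ge> 0 \<Longrightarrow> x t \<in> carrier_vec m"
    and deriv: "\<And>t k. t \<ge> 0 \<Longrightarrow> k < m \<Longrightarrow> ((\<lambda>s. x s $v k) has_real_derivative
      (A_mat m *\<^sub>v x t + control_input m \<theta> \<Delta> (bar_coords m \<theta> (x t)) (\<sigma> t) \<cdot>\<^sub>v B_vec m) $v k)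
      (at t within {0..})"
    and \<sigma>: "\<And>t. t \<ge> 0 \<Longrightarrow> (\<sigma> has_real_derivative \<sigma>' t) (at t within {0..})"
    and \<sigma>'_lim: "(\<sigma>' \<longlongrightarrow> 0) at_top" and \<sigma>_lim: "(\<sigma> \<longlongrightarrow> - y) at_top"
  shows "((\<lambda>t. C_vec m \<bullet>v x t) \<longlongrightarrow> y) at_top"
    and "\<And>k. k < m \<Longrightarrow> \<exists>L. ((\<lambda>t. x t $v k) \<longlongrightarrow> L) at_top"
proof -
  define T where "T = T_mat m \<theta>"
  define P where "P = (\<Prod>k = 1..m - 1. \<theta> ^ k)"
  have m0: "m > 0" using m by simp
  have TP: "T $$ (0, 0) * P = 1" using T_mat_entry_00[OF \<theta>(1) m0] by (simp add: T_def P_def)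
  obtain S where T: "T \<in> carrier_mat m m" and S: "S \<in> carrier_mat m m"
    and inv: "mat_inverse T = Some S" and TS: "T * S = 1\<^sub>m m" and ST: "S * T = 1\<^sub>m m"
    and TA: "T * Abar_mat m \<theta> = A_mat m * T" and TB: "T *\<^sub>v Bbar_vec m = B_vec m"
    unfolding T_def by (rule T_mat_properties[OF \<theta>(1) m0])
  have bar: "bar_coords m \<theta> v = S *\<^sub>v v" for v using inv by (simp add: bar_coords_def T_def)
  define b where "b k t = (\<Sum>q<m. S $$ (k, q) * x t $v q)" for k t
  define u where "u t = control_input m \<theta> \<Delta> (S *\<^sub>v x t) (\<sigma> t)" for t
  have b_eq: "(S *\<^sub>v x t) $v k = b k t" if "t \<ge> 0" "k < m" for t k
    using mult_mat_vec_nth[OF S carrier[OF that(1)] that(2)] by (simp add: b_def)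
  have Sx: "S *\<^sub>v x t \<in> carrier_vec m" if "t \<ge> 0" for t
    using S carrier[OF that] by simp
  have TSx: "T *\<^sub>v (S *\<^sub>v x t) = x t" if "t \<ge> 0" for t
    using assoc_mult_mat_vec[OF T S carrier[OF that]] carrier[OF that] by (simp add: TS)
  have x_eq: "x t $v k = (\<Sum>q<m. T $$ (k, q) * b q t)" if "t \<ge> 0" "k < m" for t k
  proof -
    have "x t $v k = (T *\<^sub>v (S *\<^sub>v x t)) $v k" by (simp add: TSx[OF that(1)])
    also have "\<dots> = (\<Sum>q<m. T $$ (k, q) * (S *\<^sub>v x t) $v q)"
      by (rule mult_mat_vec_nth[OF T Sx[OF that(1)] that(2)])
    finally show ?thesis using b_eq[OF that(1)] by simp
  qed
  have b_deriv: "(b k has_real_derivative (\<Sum>q = k + 1..<m. \<theta> ^ (m - q) * b q t) + u t) (at t within {0..})"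
    if t: "t \<ge> 0" and k: "k < m" for t k
  proof -
    let ?v = "S *\<^sub>v x t"
    let ?X = "A_mat m *\<^sub>v x t + u t \<cdot>\<^sub>v B_vec m"
    have X: "?X \<in> carrier_vec m"
      using A_mat_carrier[of m] B_vec_carrier[of m] carrier[OF t] by simp
    have v: "?v \<in> carrier_vec m" by (rule Sx[OF t])
    have w: "Abar_mat m \<theta> *\<^sub>v ?v + u t \<cdot>\<^sub>v Bbar_vec m \<in> carrier_vec m"
      using Abar_mat_carrier[of m \<theta>] Bbar_vec_carrier[of m] v by simp
    have "T *\<^sub>v (Abar_mat m \<theta> *\<^sub>v ?v + u t \<cdot>\<^sub>v Bbar_vec m)
        = T *\<^sub>v (Abar_mat m \<theta> *\<^sub>v ?v) + T *\<^sub>v (u t \<cdot>\<^sub>v Bbar_vec m)"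
      by (rule mult_add_distrib_mat_vec[OF T])
        (use Abar_mat_carrier[of m \<theta>] Bbar_vec_carrier[of m] v in auto)
    also have "T *\<^sub>v (u t \<cdot>\<^sub>v Bbar_vec m) = u t \<cdot>\<^sub>v B_vec m"
      using mult_mat_vec[OF T Bbar_vec_carrier] TB by simp
    also have "T *\<^sub>v (Abar_mat m \<theta> *\<^sub>v ?v) = A_mat m *\<^sub>v x t"
      using assoc_mult_mat_vec[OF T Abar_mat_carrier v, symmetric] assoc_mult_mat_vec[OF A_mat_carrier T v]
        TSx[OF t] TA by simp
    finally have "S *\<^sub>v ?X = S *\<^sub>v (T *\<^sub>v (Abar_mat m \<theta> *\<^sub>v ?v + u t \<cdot>\<^sub>v Bbar_vec m))" by simp
    also have "\<dots> = Abar_mat m \<theta> *\<^sub>v ?v + u t \<cdot>\<^sub>v Bbar_vec m"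
      using assoc_mult_mat_vec[OF S T w, symmetric] w by (simp add: ST)
    finally have SX: "S *\<^sub>v ?X = Abar_mat m \<theta> *\<^sub>v ?v + u t \<cdot>\<^sub>v Bbar_vec m" .
    have "(b k has_real_derivative (\<Sum>q<m. S $$ (k, q) * ?X $v q)) (at t within {0..})"
      unfolding b_def[abs_def]
      by (intro DERIV_sum DERIV_cmult) (use deriv[OF t] in \<open>simp add: bar u_def\<close>)
    also have "(\<Sum>q<m. S $$ (k, q) * ?X $v q) = (S *\<^sub>v ?X) $v k"
      by (rule mult_mat_vec_nth[OF S X k, symmetric])
    also have "\<dots> = (\<Sum>q = k + 1..<m. \<theta> ^ (m - q) * b q t) + u t"
      unfolding SX bar_field_nth[OF v k] using b_eq[OF t] by simp
    finally show ?thesis .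
  qed
  \<comment> \<open>Stage l of the cascade is coordinate m - l, counted from 0, so the tracked signal enters at l = m.\<close>
  define s where "s l t = b (m - l) t + (if l = m then P * \<sigma> t else 0)" for l t
  define d where "d l t = (if l = m then P * \<sigma>' t else 0)" for l t
  have u_eq: "u t = - (\<Sum>l = 1..m. \<theta> ^ l * sat \<Delta> (s l t))" if t: "t \<ge> 0" for t
  proof -
    have "{1..m} = insert m {1..m - 1}" using m by auto
    then have "(\<Sum>l = 1..m. \<theta> ^ l * sat \<Delta> (s l t))
        = \<theta> ^ m * sat \<Delta> (s m t) + (\<Sum>l = 1..m - 1. \<theta> ^ l * sat \<Delta> (s l t))"
      using m by simp
    also have "(\<Sum>l = 1..m - 1. \<theta> ^ l * sat \<Delta> (s l t)) = (\<Sum>l = 1..m - 1. \<theta> ^ l * sat \<Delta> ((S *\<^sub>v x t) $v (m - l)))"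
      by (intro sum.cong refl) (use m in \<open>auto simp: s_def b_eq[OF t]\<close>)
    finally show ?thesis
      using m by (simp add: u_def control_input_def P_def s_def b_eq[OF t])
  qed
  have s_lim: "(s l \<longlongrightarrow> 0) at_top" if "l \<in> {1..m}" for l
  proof (rule saturated_cascade_tendsto_0[where d=d and m=m and \<theta>=\<theta> and \<Delta>=\<Delta>])
    fix l t assume l: "l \<in> {1..m}" and t: "t \<ge> (0::real)"
    have "(s l has_real_derivative (\<Sum>q = m - l + 1..<m. \<theta> ^ (m - q) * b q t) + u t + d l t) (at t within {0..})"
      unfolding s_def[abs_def] d_def
      by (rule DERIV_add[OF b_deriv[OF t]]) (use l m \<sigma>[OF t] in \<open>auto intro: DERIV_cmult\<close>)
    also have "(\<Sum>q = m - l + 1..<m. \<theta> ^ (m - q) * b q t) = (\<Sum>r = 1..<l. \<theta> ^ r * s r t)"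
      by (rule sum.reindex_bij_witness[of _ "\<lambda>r. m - r" "\<lambda>q. m - q"]) (use l in \<open>auto simp: s_def\<close>)
    finally show "(s l has_real_derivative (\<Sum>r = 1..<l. \<theta> ^ r * s r t)
        - (\<Sum>l = 1..m. \<theta> ^ l * sat \<Delta> (s l t)) + d l t) (at t within {0..})"
      by (simp add: u_eq[OF t])
  next
    show "(d l \<longlongrightarrow> 0) at_top" for l
      using tendsto_mult_right_zero[OF \<sigma>'_lim, of P] by (cases "l = m") (simp_all add: d_def[abs_def])
  qed (use \<theta> \<Delta> that in auto)
  have b_lim: "(b q \<longlongrightarrow> (if q = 0 then P * y else 0)) at_top" if "q < m" for q
  proof (cases "q = 0")
    case True
    have "((\<lambda>t. s m t - P * \<sigma> t) \<longlongrightarrow> 0 - P * - y) at_top"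
      using m by (intro tendsto_diff tendsto_mult tendsto_const s_lim \<sigma>_lim) auto
    then show ?thesis using True by (simp add: s_def)
  next
    case False
    then have "m - q \<noteq> m" using that by simp
    then show ?thesis using s_lim[of "m - q"] that False by (simp add: s_def[abs_def])
  qed
  have x_lim: "((\<lambda>t. x t $v k) \<longlongrightarrow> T $$ (k, 0) * (P * y)) at_top" if k: "k < m" for k
  proof -
    have "((\<lambda>t. \<Sum>q<m. T $$ (k, q) * b q t) \<longlongrightarrow>
        (\<Sum>q<m. T $$ (k, q) * (if q = 0 then P * y else 0))) at_top"
      by (intro tendsto_sum tendsto_mult tendsto_const b_lim) simp
    moreover have "(\<Sum>q<m. T $$ (k, q) * (if q = 0 then P * y else 0)) = T $$ (k, 0) * (P * y)"
      using m by (simp add: if_distrib[of "\<lambda>z. T $$ (k, _) * z"] cong: if_cong)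
    moreover have "eventually (\<lambda>t. x t $v k = (\<Sum>q<m. T $$ (k, q) * b q t)) at_top"
      using x_eq[OF _ k] by (auto simp: eventually_at_top_linorder)
    ultimately show ?thesis by (simp add: tendsto_cong)
  qed
  then show "\<exists>L. ((\<lambda>t. x t $v k) \<longlongrightarrow> L) at_top" if "k < m" for k using that by blast
  have "((\<lambda>t. x t $v 0) \<longlongrightarrow> y) at_top"
    using x_lim[OF m0] TP by (simp add: mult.assoc[symmetric])
  moreover have "eventually (\<lambda>t. C_vec m \<bullet>v x t = x t $v 0) at_top"
    unfolding eventually_at_top_linorder C_vec_def
    by (intro exI[of _ 0] allI impI scalar_prod_left_unit[OF carrier m0])
  ultimately show "((\<lambda>t. C_vec m \<bullet>v x t) \<longlongrightarrow> y) at_top" by (simp add: tendsto_cong)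
qed

text \<open>For a given signal the loop is globally Lipschitz, because saturation does not expand distances. The
system is solved in the transformed coordinates.\<close>

lemma player_solution_exists:
  fixes \<sigma> :: "real \<Rightarrow> real" and x0 :: "real Matrix.vec"
  assumes m: "m > 0" and \<theta>: "0 < \<theta>" "\<theta> \<le> 1" and \<Delta>: "\<Delta> > 0"
    and \<sigma>: "continuous_on {0..} \<sigma>" and x0: "x0 \<in> carrier_vec m"
  obtains x where "x 0 = x0" "\<And>t. x t \<in> carrier_vec m"
    "\<And>t k. t \<ge> 0 \<Longrightarrow> k < m \<Longrightarrow> ((\<lambda>s. x s $v k) has_real_derivative
      (A_mat m *\<^sub>v x t + control_input m \<theta> \<Delta> (bar_coords m \<theta> (x t)) (\<sigma> t) \<cdot>\<^sub>v B_vec m) $v k)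
      (at t within {0..})"
proof -
  define T where "T = T_mat m \<theta>"
  define P where "P = (\<Prod>k = 1..m - 1. \<theta> ^ k)"
  obtain S where T: "T \<in> carrier_mat m m" and S: "S \<in> carrier_mat m m"
    and inv: "mat_inverse T = Some S" and TS: "T * S = 1\<^sub>m m" and ST: "S * T = 1\<^sub>m m"
    and TA: "T * Abar_mat m \<theta> = A_mat m * T" and TB: "T *\<^sub>v Bbar_vec m = B_vec m"
    unfolding T_def by (rule T_mat_properties[OF \<theta>(1) m])
  have bar: "bar_coords m \<theta> v = S *\<^sub>v v" for v using inv by (simp add: bar_coords_def T_def)
  define \<Phi> where "\<Phi> t X k = (\<Sum>q = k + 1..<m. \<theta> ^ (m - q) * X q)
     - (\<Sum>l = 1..m - 1. \<theta> ^ l * sat \<Delta> (X (m - l))) - \<theta> ^ m * sat \<Delta> (X 0 + P * \<sigma> t)"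
    for t and X :: "nat \<Rightarrow> real" and k
  obtain X where X0: "\<And>k. k \<in> {..<m} \<Longrightarrow> X 0 k = (S *\<^sub>v x0) $v k"
    and X: "\<And>t k. t \<ge> 0 \<Longrightarrow> k \<in> {..<m} \<Longrightarrow> ((\<lambda>s. X s k) has_real_derivative \<Phi> t (X t) k) (at t within {0..})"
  proof (rule finite_system_has_solution[of "{..<m}" \<Phi> "real m + real m + 1" \<Delta> "\<lambda>k. (S *\<^sub>v x0) $v k"])
    fix t :: real and Y Z :: "nat \<Rightarrow> real" and k assume k: "k \<in> {..<m}"
    define D where "D = (\<Sum>q\<in>{..<m}. \<bar>Y q - Z q\<bar>)"
    have D: "\<bar>Y q - Z q\<bar> \<le> D" if "q < m" for q
      unfolding D_def by (rule member_le_sum[where f="\<lambda>q. \<bar>Y q - Z q\<bar>"]) (use that in auto)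
    have D0: "D \<ge> 0" by (simp add: D_def sum_nonneg)
    have pow: "\<theta> ^ n * r \<le> D" if "r \<le> D" "r \<ge> 0" for n r
      using mult_mono[of "\<theta> ^ n" 1 r D] power_le_one[of \<theta> n] \<theta> that D0 by simp
    have satd: "\<theta> ^ n * \<bar>sat \<Delta> r - sat \<Delta> r'\<bar> \<le> D" if "\<bar>r - r'\<bar> \<le> D" for n r r'
      using sat_lipschitz[of \<Delta> r r'] \<Delta> that by (intro pow) auto
    have "\<Phi> t Y k - \<Phi> t Z k = (\<Sum>q = k + 1..<m. \<theta> ^ (m - q) * (Y q - Z q))
      - (\<Sum>l = 1..m - 1. \<theta> ^ l * (sat \<Delta> (Y (m - l)) - sat \<Delta> (Z (m - l))))
      - \<theta> ^ m * (sat \<Delta> (Y 0 + P * \<sigma> t) - sat \<Delta> (Z 0 + P * \<sigma> t))"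
      unfolding \<Phi>_def right_diff_distrib sum_subtractf by simp
    then have "\<bar>\<Phi> t Y k - \<Phi> t Z k\<bar> \<le> \<bar>\<Sum>q = k + 1..<m. \<theta> ^ (m - q) * (Y q - Z q)\<bar>
      + \<bar>\<Sum>l = 1..m - 1. \<theta> ^ l * (sat \<Delta> (Y (m - l)) - sat \<Delta> (Z (m - l)))\<bar>
      + \<bar>\<theta> ^ m * (sat \<Delta> (Y 0 + P * \<sigma> t) - sat \<Delta> (Z 0 + P * \<sigma> t))\<bar>" by linarith
    also have "\<dots> \<le> real m * D + real m * D + D"
    proof (intro add_mono)
      have "\<bar>\<Sum>q = k + 1..<m. \<theta> ^ (m - q) * (Y q - Z q)\<bar> \<le> (\<Sum>q = k + 1..<m. D)"
        by (intro order_trans[OF sum_abs] sum_mono)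
          (use \<theta> D in \<open>auto simp: abs_mult intro!: pow\<close>)
      also have "\<dots> \<le> real m * D" using D0 by (simp add: mult_right_mono)
      finally show "\<bar>\<Sum>q = k + 1..<m. \<theta> ^ (m - q) * (Y q - Z q)\<bar> \<le> real m * D" .
      have "\<bar>\<Sum>l = 1..m - 1. \<theta> ^ l * (sat \<Delta> (Y (m - l)) - sat \<Delta> (Z (m - l)))\<bar> \<le> (\<Sum>l = 1..m - 1. D)"
        by (intro order_trans[OF sum_abs] sum_mono)
          (use \<theta> D m in \<open>auto simp: abs_mult intro!: satd\<close>)
      also have "\<dots> \<le> real m * D" using D0 by (simp add: mult_right_mono)
      finally show "\<bar>\<Sum>l = 1..m - 1. \<theta> ^ l * (sat \<Delta> (Y (m - l)) - sat \<Delta> (Z (m - l)))\<bar> \<le> real m * D" .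
      show "\<bar>\<theta> ^ m * (sat \<Delta> (Y 0 + P * \<sigma> t) - sat \<Delta> (Z 0 + P * \<sigma> t))\<bar> \<le> D"
        using \<theta> D m by (auto simp: abs_mult intro!: satd)
    qed
    finally show "\<bar>\<Phi> t Y k - \<Phi> t Z k\<bar> \<le> (real m + real m + 1) * (\<Sum>q\<in>{..<m}. \<bar>Y q - Z q\<bar>)"
      by (simp add: D_def algebra_simps)
  next
    fix Y k
    have sat_cont: "continuous_on UNIV (sat \<Delta>)"
      by (rule lipschitz_on_continuous_on[of 1], rule lipschitz_onI)
        (use sat_lipschitz[of \<Delta>] \<Delta> in \<open>auto simp: dist_real_def\<close>)
    show "continuous_on {0..} (\<lambda>t. \<Phi> t Y k)"
      unfolding \<Phi>_def by (intro continuous_intros continuous_on_compose2[OF sat_cont] \<sigma>) auto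
  next
    fix t :: real and k
    have "\<bar>\<Phi> t (\<lambda>_. 0) k\<bar> = \<theta> ^ m * \<bar>sat \<Delta> (P * \<sigma> t)\<bar>"
      using \<theta> by (simp add: \<Phi>_def sat_def abs_mult)
    also have "\<dots> \<le> 1 * \<Delta>"
      using \<theta> \<Delta> abs_sat_le[of \<Delta>] by (intro mult_mono power_le_one) auto
    finally show "\<bar>\<Phi> t (\<lambda>_. 0) k\<bar> \<le> \<Delta>" by simp
  qed (use m in auto)
  define xb where "xb t = Matrix.vec m (X t)" for t
  have xb: "xb t \<in> carrier_vec m" for t by (simp add: xb_def)
  define x where "x t = T *\<^sub>v xb t" for t
  have bar_x: "bar_coords m \<theta> (x t) = xb t" for t
    by (simp only: bar x_def assoc_mult_mat_vec[OF S T xb, symmetric] ST one_mult_mat_vec[OF xb])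
  show ?thesis
  proof
    have "xb 0 = S *\<^sub>v x0" by (rule eq_vecI) (use X0 S in \<open>auto simp: xb_def\<close>)
    then show "x 0 = x0"
      unfolding x_def using assoc_mult_mat_vec[OF T S x0] x0 by (simp add: TS)
    show x_carrier: "x t \<in> carrier_vec m" for t using T xb by (simp add: x_def)
    fix t :: real and k assume t: "t \<ge> 0" and k: "k < m"
    define u where "u = control_input m \<theta> \<Delta> (xb t) (\<sigma> t)"
    let ?V = "Abar_mat m \<theta> *\<^sub>v xb t + u \<cdot>\<^sub>v Bbar_vec m"
    have V: "?V \<in> carrier_vec m"
      using Abar_mat_carrier[of m \<theta>] Bbar_vec_carrier[of m] xb by simp
    have V_nth: "?V $v q = \<Phi> t (X t) q" if "q < m" for q
      unfolding bar_field_nth[OF xb that] using m that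
      by (simp add: \<Phi>_def u_def control_input_def xb_def P_def)
    have "T *\<^sub>v ?V = T *\<^sub>v (Abar_mat m \<theta> *\<^sub>v xb t) + T *\<^sub>v (u \<cdot>\<^sub>v Bbar_vec m)"
      by (rule mult_add_distrib_mat_vec[OF T])
        (use Abar_mat_carrier[of m \<theta>] Bbar_vec_carrier[of m] xb in auto)
    also have "T *\<^sub>v (u \<cdot>\<^sub>v Bbar_vec m) = u \<cdot>\<^sub>v B_vec m"
      using mult_mat_vec[OF T Bbar_vec_carrier] TB by simp
    also have "T *\<^sub>v (Abar_mat m \<theta> *\<^sub>v xb t) = A_mat m *\<^sub>v x t"
      using assoc_mult_mat_vec[OF T Abar_mat_carrier xb, symmetric] assoc_mult_mat_vec[OF A_mat_carrier T xb]
        TA by (simp add: x_def)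
    finally have TV: "T *\<^sub>v ?V = A_mat m *\<^sub>v x t + u \<cdot>\<^sub>v B_vec m" .
    have "((\<lambda>s. \<Sum>q<m. T $$ (k, q) * X s q) has_real_derivative (\<Sum>q<m. T $$ (k, q) * \<Phi> t (X t) q))
        (at t within {0..})"
      by (intro DERIV_sum DERIV_cmult X t)
    moreover have "(\<lambda>s. x s $v k) = (\<lambda>s. \<Sum>q<m. T $$ (k, q) * X s q)"
      unfolding x_def mult_mat_vec_nth[OF T xb k] by (simp add: xb_def)
    moreover have "(A_mat m *\<^sub>v x t + u \<cdot>\<^sub>v B_vec m) $v k = (\<Sum>q<m. T $$ (k, q) * \<Phi> t (X t) q)"
      unfolding TV[symmetric] mult_mat_vec_nth[OF T V k] using V_nth by simp
    ultimately show "((\<lambda>s. x s $v k) has_real_derivative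
      (A_mat m *\<^sub>v x t + control_input m \<theta> \<Delta> (bar_coords m \<theta> (x t)) (\<sigma> t) \<cdot>\<^sub>v B_vec m) $v k)
      (at t within {0..})"
      by (simp only: bar_x u_def)
  qed
qed

section \<open>The closed loop\<close>

lemma xi_eq_pinned_laplacian:
  "xi f a z i j t = pinned_laplacian a j (\<lambda>k. z k t $ j - - grad_integral f z j t) i"
  by (simp add: xi_def pinned_laplacian_def algebra_simps)

theorem theorem1:
  fixes f :: "'n::finite \<Rightarrow> real ^ 'n \<Rightarrow> real"
    and m :: "'n \<Rightarrow> nat"
    and \<theta> \<Delta> l :: "'n \<Rightarrow> real"
    and \<omega> :: real
    and E :: "('n \<times> 'n) set"
    and a :: "'n \<Rightarrow> 'n \<Rightarrow> real"
  assumes players: "CARD('n) > 1"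
    and dims: "\<And>i. m i > 1"
    and A1_smooth: "\<And>i. continuously_differentiable (f i)"
    and A1_pos: "\<And>i. l i > 0"
    and A1_lipschitz:
      "\<And>i y z. \<bar>partial_deriv i (f i) y - partial_deriv i (f i) z\<bar> \<le> l i * norm (y - z)"
    and A2_pos: "\<omega> > 0"
    and A2_monotone:
      "\<And>y z. (y - z) \<bullet> (pseudo_gradient f y - pseudo_gradient f z) \<ge> \<omega> * (norm (y - z))\<^sup>2"
    and weights: "weights_of_digraph E a"
    and A3: "strongly_connected E"
    and theta: "\<And>i. 0 < \<theta> i \<and> \<theta> i < 1 / 2"
    and Delta: "\<And>i. \<Delta> i > 0"
  shows "\<exists>ystar. (\<forall>w. nash_equilibrium f w \<longleftrightarrow> w = ystar) \<and>
    (\<forall>x0 z0 c0. (\<forall>i. x0 i \<in> carrier_vec (m i)) \<and> (\<forall>i j. c0 i j > 0) \<longrightarrow>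
      (\<exists>x z c. closed_loop m \<theta> \<Delta> f a x z c \<and>
         (\<forall>i. x i 0 = x0 i \<and> z i 0 = z0 i \<and> (\<forall>j. c i j 0 = c0 i j))) \<and>
      (\<forall>x z c. closed_loop m \<theta> \<Delta> f a x z c \<and>
         (\<forall>i. x i 0 = x0 i \<and> z i 0 = z0 i \<and> (\<forall>j. c i j 0 = c0 i j)) \<longrightarrow>
         ((\<lambda>t. norm (outputs m x t - ystar)) \<longlongrightarrow> 0) at_top \<and>
         (\<forall>i. (\<forall>k<m i. bounded_and_convergent (\<lambda>t. x i t $v k)) \<and>
              (\<forall>j. bounded_and_convergent (\<lambda>t. z i t $ j) \<and>
                   bounded_and_convergent (c i j)))))"
proof -
  let ?g = "\<lambda>i. partial_deriv i (f i)"
  obtain p where p: "\<And>i. p i > 0" "\<And>k. (\<Sum>j\<in>UNIV. p k * a k j) = (\<Sum>i\<in>UNIV. p i * a i k)"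
    using exists_balancing_weights[OF weights A3] by metis
  obtain \<mu> where \<mu>: "\<mu> > 0"
    "\<And>j v. \<mu> * (\<Sum>i\<in>UNIV. (v i)\<^sup>2) \<le> (\<Sum>i\<in>UNIV. p i * v i * pinned_laplacian a j v i)"
    using pinned_laplacian_coercive[OF players weights A3 p] by metis
  have "(\<Sum>i\<in>UNIV. l i) > 0" using A1_pos by (intro sum_pos) auto
  then have "\<exists>!y. pseudo_gradient f y = 0"
    using strongly_monotone_unique_zero[OF pseudo_gradient_lipschitz[OF A1_lipschitz] A2_monotone A2_pos] by blast
  then obtain ystar where ystar: "pseudo_gradient f ystar = 0"
    and unique: "\<And>y. pseudo_gradient f y = 0 \<Longrightarrow> y = ystar" by blast
  have "(y - z) \<bullet> (pseudo_gradient f y - pseudo_gradient f z) \<ge> 0" for y z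
    using A2_monotone[of y z] A2_pos by (smt (verit) mult_nonneg_nonneg zero_le_power2)
  then have nash: "nash_equilibrium f w \<longleftrightarrow> w = ystar" for w
    using nash_equilibrium_iff_critical[of f w, OF A1_smooth] ystar unique by blast
  interpret estimator_network ?g a p l ystar \<omega> \<mu>
  proof
    show "\<omega> * (norm (y - ystar))\<^sup>2 \<le> (y - ystar) \<bullet> (\<chi> j. ?g j y)" for y
      using A2_monotone[of y ystar] ystar by (simp add: pseudo_gradient_def)
    show "?g j ystar = 0" for j
      using ystar by (metis pseudo_gradient_nth zero_index)
  qed (use A1_lipschitz A2_pos p \<mu> in auto)
  have g_cont: "continuous_on UNIV (?g j)" for j
  proof (rule lipschitz_on_continuous_on[of "l j"], rule lipschitz_onI)
    show "dist (?g j y) (?g j z) \<le> l j * dist y z" for y z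
      using A1_lipschitz[of j y z] by (simp add: dist_norm)
  qed (use A1_pos less_imp_le in blast)
  \<comment> \<open>The residuals depend on the controller's integral terms only through this signal.\<close>
  define W where "W z t = (\<chi> j. - grad_integral f z j t)" for z :: "'n \<Rightarrow> real \<Rightarrow> real ^ 'n" and t
  have xi_eq: "xi f a z i j t = residual (W z t) (\<lambda>i. z i t) i j" for z i j t
    by (simp add: xi_eq_pinned_laplacian residual_def W_def)
  have gz_cont: "continuous_on {0..} (\<lambda>t. ?g j (z j t))"
    if "\<And>k. continuous_on {0..} (\<lambda>t. z j t $ k)" for z :: "'n \<Rightarrow> real \<Rightarrow> real ^ 'n" and j
  proof -
    have "continuous_on {0..} (\<lambda>t. \<chi> k. z j t $ k)" by (intro continuous_on_vec_lambda that)
    then have "continuous_on {0..} (z j)" by simp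
    then show ?thesis by (intro continuous_on_compose2[OF g_cont]) auto
  qed
  have grad_deriv: "(grad_integral f z j has_real_derivative ?g j (z j t)) (at t within {0..})"
    if "\<And>k. continuous_on {0..} (\<lambda>t. z j t $ k)" "t \<ge> 0" for z j t
    using integral_has_vector_derivative_halfline[OF gz_cont[where z=z, OF that(1)] that(2)]
    unfolding grad_integral_def[abs_def] by (simp add: has_real_derivative_iff_has_vector_derivative)
  have exists: "\<exists>x z c. closed_loop m \<theta> \<Delta> f a x z c \<and>
      (\<forall>i. x i 0 = x0 i \<and> z i 0 = z0 i \<and> (\<forall>j. c i j 0 = c0 i j))"
    if x0: "\<And>i. x0 i \<in> carrier_vec (m i)" and c0: "\<And>i j. c0 i j > 0" for x0 z0 c0
  proof -
    obtain w z c where traj: "trajectory {0..} w z c" and w0: "w 0 = 0"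
      and z0: "\<And>i. z i 0 = z0 i" and c0: "\<And>i j. c i j 0 = c0 i j"
      using trajectory_exists[of c0 0 z0] c0 by metis
    have w_deriv: "((\<lambda>s. w s $ j) has_real_derivative - ?g j (z j t)) (at t within {0..})"
      if "t \<ge> 0" for t j using traj that by (simp add: trajectory_def)
    have z_cont: "continuous_on {0..} (\<lambda>t. z i t $ j)" for i j
      by (rule continuous_on_halfline_if_deriv[where h'="\<lambda>t. - feedback (w t) (\<lambda>i. z i t) (\<lambda>i j. c i j t) i j"])
        (use traj in \<open>simp add: trajectory_def\<close>)
    \<comment> \<open>The trajectory carries w as a state; integrating its equation recovers the controller's integral.\<close>
    have W_eq: "W z t = w t" if t: "t \<ge> 0" for t
    proof -
      have "grad_integral f z j t = - w t $ j" for j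
      proof -
        have "((\<lambda>\<tau>. - ?g j (z j \<tau>)) has_integral w t $ j - w 0 $ j) {0..t}"
          using t DERIV_subset[OF w_deriv, of _ "{0..t}"]
          by (intro fundamental_theorem_of_calculus)
            (auto simp: has_real_derivative_iff_has_vector_derivative[symmetric])
        from has_integral_neg[OF this] show ?thesis
          unfolding grad_integral_def by (intro integral_unique) (simp add: w0)
      qed
      then show ?thesis by (simp add: W_def Finite_Cartesian_Product.vec_eq_iff)
    qed
    have \<sigma>_cont: "continuous_on {0..} (grad_integral f z i)" for i
      by (rule continuous_on_halfline_if_deriv[OF grad_deriv[OF z_cont]])
    have "\<exists>x. x 0 = x0 i \<and> (\<forall>t. x t \<in> carrier_vec (m i)) \<and>
        (\<forall>t\<ge>0. \<forall>k<m i. ((\<lambda>s. x s $v k) has_real_derivative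
          (A_mat (m i) *\<^sub>v x t + control_input (m i) (\<theta> i) (\<Delta> i) (bar_coords (m i) (\<theta> i) (x t))
            (grad_integral f z i t) \<cdot>\<^sub>v B_vec (m i)) $v k) (at t within {0..}))" for i
    proof (rule player_solution_exists[of "m i" "\<theta> i" "\<Delta> i" "grad_integral f z i" "x0 i"])
      show "m i > 0" using dims[of i] by simp
      show "0 < \<theta> i" "\<theta> i \<le> 1" using theta[of i] by auto
    qed (use Delta \<sigma>_cont x0 in blast)+
    then obtain x where x: "\<And>i. x i 0 = x0 i" "\<And>i t. x i t \<in> carrier_vec (m i)"
      "\<And>i t k. t \<ge> 0 \<Longrightarrow> k < m i \<Longrightarrow> ((\<lambda>s. x i s $v k) has_real_derivative
          (A_mat (m i) *\<^sub>v x i t + control_input (m i) (\<theta> i) (\<Delta> i) (bar_coords (m i) (\<theta> i) (x i t))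
            (grad_integral f z i t) \<cdot>\<^sub>v B_vec (m i)) $v k) (at t within {0..})"
      by metis
    have "closed_loop m \<theta> \<Delta> f a x z c"
      unfolding closed_loop_def Let_def
    proof (intro allI impI conjI)
      fix t i j assume t: "(0::real) \<le> t"
      show "((\<lambda>s. z i s $ j) has_real_derivative - (c i j t + (xi f a z i j t)\<^sup>2) * xi f a z i j t) (at t within {0..})"
        using traj t unfolding trajectory_def feedback_def xi_eq W_eq[OF t] minus_mult_left by simp
      show "(c i j has_real_derivative (xi f a z i j t)\<^sup>2) (at t within {0..})"
        using traj t unfolding trajectory_def xi_eq W_eq[OF t] by simp
    qed (use x in auto)
    then show ?thesis using x(1) z0 c0 by blast
  qed
  have converges: "((\<lambda>t. norm (outputs m x t - ystar)) \<longlongrightarrow> 0) at_top \<and>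
      (\<forall>i. (\<forall>k<m i. bounded_and_convergent (\<lambda>t. x i t $v k)) \<and>
        (\<forall>j. bounded_and_convergent (\<lambda>t. z i t $ j) \<and> bounded_and_convergent (c i j)))"
    if loop: "closed_loop m \<theta> \<Delta> f a x z c" and c_pos: "\<And>i j. c i j 0 > 0" for x z c
  proof -
    have x_carrier: "x i t \<in> carrier_vec (m i)"
      and x_deriv: "\<And>k. k < m i \<Longrightarrow> ((\<lambda>s. x i s $v k) has_real_derivative
          (A_mat (m i) *\<^sub>v x i t + control_input (m i) (\<theta> i) (\<Delta> i) (bar_coords (m i) (\<theta> i) (x i t))
            (grad_integral f z i t) \<cdot>\<^sub>v B_vec (m i)) $v k) (at t within {0..})"
      and z_deriv: "\<And>j. ((\<lambda>s. z i s $ j) has_real_derivative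
          - (c i j t + (xi f a z i j t)\<^sup>2) * xi f a z i j t) (at t within {0..})"
      and c_deriv: "\<And>j. (c i j has_real_derivative (xi f a z i j t)\<^sup>2) (at t within {0..})"
      if "t \<ge> 0" for i t
      using loop that unfolding closed_loop_def Let_def by auto
    have z_cont: "continuous_on {0..} (\<lambda>t. z i t $ j)" for i j
      using z_deriv by (rule continuous_on_halfline_if_deriv)
    have traj: "trajectory {0..} (W z) z c"
      unfolding trajectory_def
    proof (intro ballI allI conjI)
      fix t :: real and i j assume "t \<in> {0..}"
      then have t: "t \<ge> 0" by simp
      show "((\<lambda>s. W z s $ j) has_real_derivative - ?g j (z j t)) (at t within {0..})"
        using DERIV_minus[OF grad_deriv[OF z_cont t]] by (simp add: W_def)
      show "((\<lambda>s. z i s $ j) has_real_derivative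
          - feedback (W z t) (\<lambda>i. z i t) (\<lambda>i j. c i j t) i j) (at t within {0..})"
        using z_deriv[OF t, of i j] unfolding feedback_def xi_eq minus_mult_left .
      show "(c i j has_real_derivative (residual (W z t) (\<lambda>i. z i t) i j)\<^sup>2) (at t within {0..})"
        using c_deriv[OF t] by (simp add: xi_eq)
    qed
    note lim = trajectory_converges[OF traj c_pos]
    have players_lim: "((\<lambda>t. C_vec (m i) \<bullet>v x i t) \<longlongrightarrow> ystar $ i) at_top
        \<and> (\<forall>k<m i. \<exists>L. ((\<lambda>t. x i t $v k) \<longlongrightarrow> L) at_top)" for i
    proof -
      have "((\<lambda>t. - (- grad_integral f z i t)) \<longlongrightarrow> - ystar $ i) at_top"
        using lim(1)[of i] by (intro tendsto_minus) (simp add: W_def)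
      then have \<sigma>_lim: "(grad_integral f z i \<longlongrightarrow> - ystar $ i) at_top" by simp
      have "(z i \<longlongrightarrow> ystar) at_top" by (rule vec_tendstoI) (rule lim(2))
      then have "((\<lambda>t. ?g i (z i t)) \<longlongrightarrow> ?g i ystar) at_top"
        using g_cont[of i] by (intro continuous_on_tendsto_compose[OF g_cont]) auto
      then have \<sigma>'_lim: "((\<lambda>t. ?g i (z i t)) \<longlongrightarrow> 0) at_top" by (simp add: g_zero)
      have th: "0 < \<theta> i" "\<theta> i < 1 / 2" using theta by auto
      show ?thesis
        using player_converges[OF dims th Delta x_carrier x_deriv grad_deriv[OF z_cont] \<sigma>'_lim \<sigma>_lim]
        by blast
    qed
    have "(outputs m x \<longlongrightarrow> ystar) at_top"
      by (rule vec_tendstoI) (simp add: outputs_def players_lim)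
    then have "((\<lambda>t. norm (outputs m x t - ystar)) \<longlongrightarrow> 0) at_top"
      by (intro tendsto_norm_zero LIM_zero)
    moreover have "bounded_and_convergent (\<lambda>t. x i t $v k)" if k: "k < m i" for i k
    proof -
      obtain L where "((\<lambda>t. x i t $v k) \<longlongrightarrow> L) at_top" using players_lim[of i] k by blast
      moreover have "continuous_on {0..} (\<lambda>t. x i t $v k)"
        using x_deriv[OF _ k] by (rule continuous_on_halfline_if_deriv)
      ultimately show ?thesis by (intro bounded_and_convergentI)
    qed
    moreover have "bounded_and_convergent (\<lambda>t. z i t $ j)" for i j
      by (rule bounded_and_convergentI[OF z_cont lim(2)])
    moreover have "bounded_and_convergent (c i j)" for i j
    proof -
      obtain L where "(c i j \<longlongrightarrow> L) at_top" using lim(3) by blast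
      moreover have "continuous_on {0..} (c i j)"
        using c_deriv by (rule continuous_on_halfline_if_deriv)
      ultimately show ?thesis by (intro bounded_and_convergentI)
    qed
    ultimately show ?thesis by blast
  qed
  have main: "(\<exists>x z c. closed_loop m \<theta> \<Delta> f a x z c \<and>
         (\<forall>i. x i 0 = x0 i \<and> z i 0 = z0 i \<and> (\<forall>j. c i j 0 = c0 i j))) \<and>
      (\<forall>x z c. closed_loop m \<theta> \<Delta> f a x z c \<and>
         (\<forall>i. x i 0 = x0 i \<and> z i 0 = z0 i \<and> (\<forall>j. c i j 0 = c0 i j)) \<longrightarrow>
         ((\<lambda>t. norm (outputs m x t - ystar)) \<longlongrightarrow> 0) at_top \<and>
         (\<forall>i. (\<forall>k<m i. bounded_and_convergent (\<lambda>t. x i t $v k)) \<and>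
              (\<forall>j. bounded_and_convergent (\<lambda>t. z i t $ j) \<and> bounded_and_convergent (c i j))))"
    if init: "(\<forall>i. x0 i \<in> carrier_vec (m i)) \<and> (\<forall>i j. c0 i j > 0)" for x0 z0 c0
  proof (rule conjI; (intro allI impI)?)
    show "\<exists>x z c. closed_loop m \<theta> \<Delta> f a x z c \<and>
         (\<forall>i. x i 0 = x0 i \<and> z i 0 = z0 i \<and> (\<forall>j. c i j 0 = c0 i j))"
      using init by (intro exists) auto
  next
    fix x z c
    assume sol: "closed_loop m \<theta> \<Delta> f a x z c \<and>
         (\<forall>i. x i 0 = x0 i \<and> z i 0 = z0 i \<and> (\<forall>j. c i j 0 = c0 i j))"
    show "((\<lambda>t. norm (outputs m x t - ystar)) \<longlongrightarrow> 0) at_top \<and>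
         (\<forall>i. (\<forall>k<m i. bounded_and_convergent (\<lambda>t. x i t $v k)) \<and>
              (\<forall>j. bounded_and_convergent (\<lambda>t. z i t $ j) \<and> bounded_and_convergent (c i j)))"
      by (rule converges) (use sol init in auto)
  qed
  show ?thesis
    by (rule exI[of _ ystar], rule conjI[OF allI[OF nash]], intro allI impI, rule main)
qed

end
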